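(* Let $(\mathbb{R}^n,*_G)$ be a rational stratified Lie group with $\dim(G)=n$. Then the space $\mathcal S(\mathbb{R}^n)$ of rapidly decaying smooth functions is contained in $M_{p,q}^{s,\alpha}(G)$ for all $1\le p,q\le\infty$, $s\in\mathbb{R}$ and $0\le\alpha\le1$.
   Context: **Stratified Lie groups.** A connected, simply connected Lie group $G$ with Lie algebra $\mathfrak g$ is stratified if $\mathfrak g=V_1\oplus\dots\oplus V_\sigma$ with $[V_1,V_j]=V_{j+1}$ for $1\le j<\sigma$ and $[V_1,V_\sigma]=\{0\}$. Elements of $V_i$ have degree $i$, and $Q=\sum_j j\dim V_j$ is the homogeneous dimension. Through the exponential map $G$ is identified with $(\mathbb{R}^n,*_G)$, with $*_G$ given by the Baker-Campbell-Hausdorff formula (Haar measure is Lebesgue measure $|\cdot|$) and coordinates in a basis adapted to the stratification; $v_j$ is the degree of $x_j$. Dilations: $D_r^G(x)=(r^{v_1}x_1,\dots,r^{v_n}x_n)$. A lattice is a discrete subgroup $N$ such that $G/N$ carries a finite $G$-invariant Borel measure; $G$ is rational if it has a lattice. A homogeneous quasi-norm is a continuous $\|\cdot\|:\mathbb{R}^n\to[0,\infty)$ with $\|D_r^Gx\|=r\|x\|$, $\|x^{-1}\|=\|x\|$, $\|x\|=0$ only for $x=0$; $B^{\|\cdot\|}(x,R)=\{y:\|x^{-1}*_Gy\|<R\}$. **Generalized $\alpha$-coverings.** A covering $(Q_i)_{i\in I}$ of $\mathbb{R}^n$ by non-empty sets is admissible if $\sup_i\#\{j:Q_i\cap Q_j\neq\emptyset\}<\infty$.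 An admissible covering $(P_i^\alpha)_{i\in I}$ by open connected sets is a generalized $\alpha$-covering for $(\mathbb{R}^n,*_G)$ if (1) $|P_i^\alpha|\asymp(1+\|\xi_i\|^2)^{\alpha Q/2}$ for all $\xi_i\in P_i^\alpha$, uniformly in $i,\xi_i$, and (2) $\sup_iR^{\|\cdot\|}(P_i^\alpha)/r^{\|\cdot\|}(P_i^\alpha)<\infty$, where $r^{\|\cdot\|}(P)=\sup\{r:B^{\|\cdot\|}(c,r)\subset P\text{ for some }c\in\mathbb{R}^n\}$ and $R^{\|\cdot\|}(P)=\inf\{R:P\subset B^{\|\cdot\|}(c,R)\text{ for some }c\in\mathbb{R}^n\}$. **The spaces.** A $\mathcal Q$-BAPU is a family of non-negative smooth functions $(\psi_i)$ with $\operatorname{supp}\psi_i\subset Q_i$, $\sum_i\psi_i\equiv1$, $\sup_i\|\mathcal F^{-1}\psi_i\|_{L^1}<\infty$. Let $Z(\mathbb{R}^n)=\mathcal F(C_c^\infty(\mathbb{R}^n))$ with topology transported by the Fourier transform $\mathcal F$ (with kernel $e^{-2\pi i x\cdot\omega}$), and $Z'(\mathbb{R}^n)$ its dual. For a generalized $\alpha$-covering $(P_i^\alpha)$ with BAPU $(\psi_i)$ and $\xi_i\in P_i^\alpha$, $M_{p,q}^{s,\alpha}(G)$ is the space of $f\in Z'(\mathbb{R}^n)$ with $$\Big\|\big((1+\|\xi_i\|^2)^{s/2}\|\mathcal F^{-1}(\psi_i\cdot\mathcal Ff)\|_{L^p}\big)_{i\in I}\Big\|_{\ell^q(I)}<\infty;$$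 up to equivalent norms it is independent of all choices. Convention of the paper: statements about $M_{p,q}^{s,\alpha}(G)$ presuppose the existence of a generalized $\alpha$-covering with a BAPU (which is known if the step is at most two), and may be vacuous otherwise. *)

theory Defs
  imports "HOL-Analysis.Analysis" "HOL-Probability.Essential_Supremum"
begin

section \<open>Stratified Lie algebras on \<open>real ^ 'n\<close>\<close>

definition lie_bracket :: "(real^'n \<Rightarrow> real^'n \<Rightarrow> real^'n) \<Rightarrow> bool" where
  "lie_bracket br \<longleftrightarrow>
     bilinear br \<and> (\<forall>x. br x x = 0) \<and>
     (\<forall>x y z. br x (br y z) + br y (br z x) + br z (br x y) = 0)"

text \<open>The standard basis is taken to be adapted to the stratification: \<open>v j\<close> is the degree of the
  coordinate \<open>x $ j\<close>, and the layer of degree \<open>k\<close> is spanned by the basis vectors of degree \<open>k\<close>,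
  so that the space is automatically the direct sum of the layers.\<close>

definition layer :: "('n::finite \<Rightarrow> nat) \<Rightarrow> nat \<Rightarrow> (real^'n) set" where
  "layer v k = span {axis j 1 | j. v j = k}"

definition bracket_span ::
    "(real^'n \<Rightarrow> real^'n \<Rightarrow> real^'n) \<Rightarrow> (real^'n) set \<Rightarrow> (real^'n) set \<Rightarrow> (real^'n) set" where
  "bracket_span br A B = span {br x y | x y. x \<in> A \<and> y \<in> B}"

definition stratified ::
    "(real^'n \<Rightarrow> real^'n \<Rightarrow> real^'n) \<Rightarrow> ('n::finite \<Rightarrow> nat) \<Rightarrow> nat \<Rightarrow> bool" where
  "stratified br v \<sigma> \<longleftrightarrow>
     lie_bracket br \<and> 1 \<le> \<sigma> \<and> (\<forall>j. 1 \<le> v j \<and> v j \<le> \<sigma>) \<and>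
     (\<forall>k. 1 \<le> k \<and> k < \<sigma> \<longrightarrow> bracket_span br (layer v 1) (layer v k) = layer v (k + 1)) \<and>
     bracket_span br (layer v 1) (layer v \<sigma>) = {0}"

definition hom_dim :: "('n::finite \<Rightarrow> nat) \<Rightarrow> nat \<Rightarrow> nat" where
  "hom_dim v \<sigma> = (\<Sum>k = 1..\<sigma>. k * dim (layer v k))"

section \<open>The group law\<close>

fun nested_bracket :: "(real^'n \<Rightarrow> real^'n \<Rightarrow> real^'n) \<Rightarrow> (real^'n) list \<Rightarrow> real^'n" where
  "nested_bracket br [] = 0"
| "nested_bracket br [x] = x"
| "nested_bracket br (x # y # zs) = br x (nested_bracket br (y # zs))"

text \<open>The Baker-Campbell-Hausdorff formula in Dynkin's form
  \[ x * y = \sum_{k \ge 1} \frac{(-1)^{k-1}}{k} \sum_{r_i + s_i > 0}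
      \frac{[x^{r_1} y^{s_1} \cdots x^{r_k} y^{s_k}]}
           {\sum_i (r_i + s_i) \; \prod_i r_i! \, s_i!} \]
  with right-nested brackets. A stratified algebra of step \<open>\<sigma>\<close> has no nonzero brackets of length
  greater than \<open>\<sigma>\<close>, so only the (finitely many) terms of length at most \<open>\<sigma>\<close> are kept.
  The list \<open>rs\<close> contains the pairs \<open>(r_i, s_i)\<close>.\<close>

definition bch_length :: "(nat \<times> nat) list \<Rightarrow> nat" where
  "bch_length rs = (\<Sum>(r, s)\<leftarrow>rs. r + s)"

definition bch_index :: "nat \<Rightarrow> (nat \<times> nat) list set" where
  "bch_index \<sigma> = {rs. rs \<noteq> [] \<and> (\<forall>(r, s)\<in>set rs. 0 < r + s) \<and> bch_length rs \<le> \<sigma>}"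

definition gmult ::
    "(real^'n \<Rightarrow> real^'n \<Rightarrow> real^'n) \<Rightarrow> nat \<Rightarrow> real^'n \<Rightarrow> real^'n \<Rightarrow> real^'n" where
  "gmult br \<sigma> x y =
     (\<Sum>rs\<in>bch_index \<sigma>.
        ((-1) ^ (length rs - 1) /
          (real (length rs) * real (bch_length rs) * (\<Prod>(r, s)\<leftarrow>rs. fact r * fact s))) *\<^sub>R
        nested_bracket br (concat (map (\<lambda>(r, s). replicate r x @ replicate s y) rs)))"

text \<open>In exponential coordinates the identity element is \<open>0\<close> and the inverse of \<open>x\<close> is \<open>- x\<close>.\<close>

definition left_coset ::
    "(real^'n \<Rightarrow> real^'n \<Rightarrow> real^'n) \<Rightarrow> nat \<Rightarrow> real^'n \<Rightarrow> (real^'n) set \<Rightarrow> (real^'n) set" where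
  "left_coset br \<sigma> g A = gmult br \<sigma> g ` A"

text \<open>The Borel sets of \<open>G / N\<close> (left cosets) are generated by the quotient topology. The invariant
  measure must be nonzero, as the zero measure is always finite and invariant.\<close>

definition lattice_subgroup ::
    "(real^'n \<Rightarrow> real^'n \<Rightarrow> real^'n) \<Rightarrow> nat \<Rightarrow> (real^'n) set \<Rightarrow> bool" where
  "lattice_subgroup br \<sigma> N \<longleftrightarrow>
     0 \<in> N \<and> (\<forall>x\<in>N. \<forall>y\<in>N. gmult br \<sigma> x y \<in> N) \<and> (\<forall>x\<in>N. - x \<in> N) \<and>
     discrete N \<and>
     (\<exists>\<mu> :: (real^'n) set measure. \<exists>X.
        X = range (\<lambda>g. left_coset br \<sigma> g N) \<and>
        space \<mu> = X \<and>
        sets \<mu> = sigma_sets X {U. U \<subseteq> X \<and> open (\<Union>U)} \<and>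
        emeasure \<mu> X \<noteq> 0 \<and> emeasure \<mu> X \<noteq> \<infinity> \<and>
        (\<forall>g. \<forall>A\<in>sets \<mu>. emeasure \<mu> (left_coset br \<sigma> g ` A) = emeasure \<mu> A))"

definition rational_group :: "(real^'n \<Rightarrow> real^'n \<Rightarrow> real^'n) \<Rightarrow> nat \<Rightarrow> bool" where
  "rational_group br \<sigma> \<longleftrightarrow> (\<exists>N. lattice_subgroup br \<sigma> N)"

section \<open>Homogeneous quasi-norms\<close>

definition dilation :: "('n::finite \<Rightarrow> nat) \<Rightarrow> real \<Rightarrow> real^'n \<Rightarrow> real^'n" where
  "dilation v r x = (\<chi> j. r ^ v j * x $ j)"

definition homogeneous_quasi_norm :: "('n::finite \<Rightarrow> nat) \<Rightarrow> (real^'n \<Rightarrow> real) \<Rightarrow> bool" where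
  "homogeneous_quasi_norm v nrm \<longleftrightarrow>
     continuous_on UNIV nrm \<and> (\<forall>x. 0 \<le> nrm x) \<and>
     (\<forall>r>0. \<forall>x. nrm (dilation v r x) = r * nrm x) \<and>
     (\<forall>x. nrm (- x) = nrm x) \<and> (\<forall>x. nrm x = 0 \<longrightarrow> x = 0)"

definition qball ::
    "(real^'n \<Rightarrow> real^'n \<Rightarrow> real^'n) \<Rightarrow> nat \<Rightarrow> (real^'n \<Rightarrow> real) \<Rightarrow> real^'n \<Rightarrow> real \<Rightarrow> (real^'n) set" where
  "qball br \<sigma> nrm x R = {y. nrm (gmult br \<sigma> (- x) y) < R}"

definition inner_radius ::
    "(real^'n \<Rightarrow> real^'n \<Rightarrow> real^'n) \<Rightarrow> nat \<Rightarrow> (real^'n \<Rightarrow> real) \<Rightarrow> (real^'n) set \<Rightarrow> ennreal" where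
  "inner_radius br \<sigma> nrm A = Sup {ennreal r | r. \<exists>c. qball br \<sigma> nrm c r \<subseteq> A}"

definition outer_radius ::
    "(real^'n \<Rightarrow> real^'n \<Rightarrow> real^'n) \<Rightarrow> nat \<Rightarrow> (real^'n \<Rightarrow> real) \<Rightarrow> (real^'n) set \<Rightarrow> ennreal" where
  "outer_radius br \<sigma> nrm A = Inf {ennreal R | R. \<exists>c. A \<subseteq> qball br \<sigma> nrm c R}"

section \<open>Generalized \<open>\<alpha>\<close>-coverings\<close>

definition admissible_covering :: "'i set \<Rightarrow> ('i \<Rightarrow> (real^'n) set) \<Rightarrow> bool" where
  "admissible_covering I P \<longleftrightarrow>
     (\<Union>i\<in>I. P i) = UNIV \<and> (\<forall>i\<in>I. P i \<noteq> {}) \<and>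
     (\<exists>m::nat. \<forall>i\<in>I. finite {j\<in>I. P i \<inter> P j \<noteq> {}} \<and> card {j\<in>I. P i \<inter> P j \<noteq> {}} \<le> m)"

definition generalized_alpha_covering ::
    "(real^'n \<Rightarrow> real^'n \<Rightarrow> real^'n) \<Rightarrow> ('n::finite \<Rightarrow> nat) \<Rightarrow> nat \<Rightarrow> (real^'n \<Rightarrow> real) \<Rightarrow>
     real \<Rightarrow> 'i set \<Rightarrow> ('i \<Rightarrow> (real^'n) set) \<Rightarrow> bool" where
  "generalized_alpha_covering br v \<sigma> nrm \<alpha> I P \<longleftrightarrow>
     admissible_covering I P \<and>
     (\<forall>i\<in>I. open (P i) \<and> connected (P i)) \<and>
     (\<exists>c C :: real. 0 < c \<and> 0 < C \<and>
        (\<forall>i\<in>I. \<forall>x\<in>P i.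
           ennreal (c * (1 + (nrm x)\<^sup>2) powr (\<alpha> * hom_dim v \<sigma> / 2)) \<le> emeasure lborel (P i) \<and>
           emeasure lborel (P i) \<le> ennreal (C * (1 + (nrm x)\<^sup>2) powr (\<alpha> * hom_dim v \<sigma> / 2)))) \<and>
     (SUP i\<in>I. outer_radius br \<sigma> nrm (P i) / inner_radius br \<sigma> nrm (P i)) < \<infinity>"

section \<open>Function spaces and the Fourier transform\<close>

text \<open>Iterated partial derivatives, indexed by lists of coordinate directions.\<close>

fun pderivs :: "'n::finite list \<Rightarrow> (real^'n \<Rightarrow> 'a::real_normed_vector) \<Rightarrow> real^'n \<Rightarrow> 'a" where
  "pderivs [] f = f"
| "pderivs (j # js) f = (\<lambda>x. frechet_derivative (pderivs js f) (at x) (axis j 1))"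

definition smooth :: "(real^'n::finite \<Rightarrow> 'a::real_normed_vector) \<Rightarrow> bool" where
  "smooth f \<longleftrightarrow> (\<forall>js x. pderivs js f differentiable (at x))"

definition supp :: "(real^'n \<Rightarrow> 'a::zero) \<Rightarrow> (real^'n) set" where
  "supp f = closure {x. f x \<noteq> 0}"

definition test_functions :: "(real^'n::finite \<Rightarrow> complex) set" where
  "test_functions = {\<phi>. smooth \<phi> \<and> compact (supp \<phi>)}"

definition schwartz :: "(real^'n::finite \<Rightarrow> complex) set" where
  "schwartz = {f. smooth f \<and>
     (\<forall>js m. \<exists>C. \<forall>x. (1 + norm x) ^ m * norm (pderivs js f x) \<le> C)}"

definition fourier :: "(real^'n::finite \<Rightarrow> complex) \<Rightarrow> real^'n \<Rightarrow> complex" where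
  "fourier f \<omega> = (LINT x|lborel. f x * cis (- 2 * pi * (x \<bullet> \<omega>)))"

definition inv_fourier :: "(real^'n::finite \<Rightarrow> complex) \<Rightarrow> real^'n \<Rightarrow> complex" where
  "inv_fourier g x = (LINT \<omega>|lborel. g \<omega> * cis (2 * pi * (x \<bullet> \<omega>)))"

definition Z_space :: "(real^'n::finite \<Rightarrow> complex) set" where
  "Z_space = fourier ` test_functions"

text \<open>Functionals on \<open>Z_space\<close> and on \<open>test_functions\<close> are represented by functions that are
  \<open>undefined\<close> outside their domain. Since the topology on \<open>Z_space\<close> is transported by
  \<open>fourier\<close>, continuity of \<open>T\<close> means that \<open>T \<circ> fourier\<close> is a distribution; continuity on
  \<open>test_functions\<close> (an inductive limit) amounts to a seminorm estimate over each compact set.\<close>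

definition Z_dual :: "((real^'n::finite \<Rightarrow> complex) \<Rightarrow> complex) set" where
  "Z_dual = {T \<in> extensional Z_space.
     (\<forall>\<phi>\<in>Z_space. \<forall>\<eta>\<in>Z_space. T (\<lambda>x. \<phi> x + \<eta> x) = T \<phi> + T \<eta>) \<and>
     (\<forall>a. \<forall>\<phi>\<in>Z_space. T (\<lambda>x. a * \<phi> x) = a * T \<phi>) \<and>
     (\<forall>K. compact K \<longrightarrow>
        (\<exists>C m. \<forall>\<phi>\<in>test_functions. supp \<phi> \<subseteq> K \<longrightarrow>
           norm (T (fourier \<phi>)) \<le> C * (\<Sum>js | length js \<le> m. SUP x. norm (pderivs js \<phi> x))))}"

text \<open>The inclusion of (Schwartz) functions into \<open>Z_dual\<close>.\<close>

definition functional_of :: "(real^'n::finite \<Rightarrow> complex) \<Rightarrow> (real^'n \<Rightarrow> complex) \<Rightarrow> complex" where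
  "functional_of f = (\<lambda>\<phi>\<in>Z_space. LINT x|lborel. f x * \<phi> x)"

definition fourier_functional ::
    "((real^'n::finite \<Rightarrow> complex) \<Rightarrow> complex) \<Rightarrow> (real^'n \<Rightarrow> complex) \<Rightarrow> complex" where
  "fourier_functional T = (\<lambda>\<phi>\<in>test_functions. T (fourier \<phi>))"

definition mult_functional ::
    "(real^'n::finite \<Rightarrow> real) \<Rightarrow> ((real^'n \<Rightarrow> complex) \<Rightarrow> complex) \<Rightarrow> (real^'n \<Rightarrow> complex) \<Rightarrow> complex" where
  "mult_functional \<psi> S = (\<lambda>\<phi>\<in>test_functions. S (\<lambda>x. complex_of_real (\<psi> x) * \<phi> x))"

definition inv_fourier_functional ::
    "((real^'n::finite \<Rightarrow> complex) \<Rightarrow> complex) \<Rightarrow> (real^'n \<Rightarrow> complex) \<Rightarrow> complex" where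
  "inv_fourier_functional S = (\<lambda>\<phi>\<in>Z_space. S (inv_fourier \<phi>))"

text \<open>\<open>L^p\<close> norm of a nonnegative function, for \<open>0 < p \<le> \<infinity>\<close>; over \<open>count_space I\<close> this is the
  \<open>\<ell>^p(I)\<close> norm.\<close>

definition ennreal_powr :: "ennreal \<Rightarrow> real \<Rightarrow> ennreal" where
  "ennreal_powr x a = (if x = \<infinity> then \<infinity> else ennreal (enn2real x powr a))"

definition Lp_norm :: "'a measure \<Rightarrow> ennreal \<Rightarrow> ('a \<Rightarrow> ennreal) \<Rightarrow> ennreal" where
  "Lp_norm M p g =
     (if p = \<infinity> then esssup M g
      else ennreal_powr (\<integral>\<^sup>+ x. ennreal_powr (g x) (enn2real p) \<partial>M) (1 / enn2real p))"

text \<open>\<open>L^p\<close> norm of an element of \<open>Z_dual\<close>: the norm of the \<open>L^p\<close> function representing it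
  (all such functions agree almost everywhere), and \<open>\<infinity>\<close> if there is none.\<close>

definition Lp_norm_functional ::
    "ennreal \<Rightarrow> ((real^'n::finite \<Rightarrow> complex) \<Rightarrow> complex) \<Rightarrow> ennreal" where
  "Lp_norm_functional p T =
     Inf {Lp_norm lborel p (\<lambda>x. ennreal (norm (u x))) | u.
            u \<in> borel_measurable lborel \<and>
            Lp_norm lborel p (\<lambda>x. ennreal (norm (u x))) < \<infinity> \<and>
            (\<forall>\<phi>\<in>Z_space. T \<phi> = (LINT x|lborel. u x * \<phi> x))}"

section \<open>The spaces \<open>M_{p,q}^{s,\<alpha>}(G)\<close>\<close>

text \<open>The members of a generalized \<open>\<alpha>\<close>-covering are bounded, so the functions \<open>\<psi> i\<close> of a BAPU
  subordinate to it have compact support and the integral defining \<open>inv_fourier\<close> converges.\<close>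

definition BAPU :: "'i set \<Rightarrow> ('i \<Rightarrow> (real^'n::finite) set) \<Rightarrow> ('i \<Rightarrow> real^'n \<Rightarrow> real) \<Rightarrow> bool" where
  "BAPU I P \<psi> \<longleftrightarrow>
     (\<forall>i\<in>I. smooth (\<psi> i) \<and> (\<forall>x. 0 \<le> \<psi> i x) \<and> supp (\<psi> i) \<subseteq> P i) \<and>
     (\<forall>x. ((\<lambda>i. \<psi> i x) has_sum 1) I) \<and>
     (SUP i\<in>I. Lp_norm lborel 1
        (\<lambda>x. ennreal (norm (inv_fourier (\<lambda>\<omega>. complex_of_real (\<psi> i \<omega>)) x)))) < \<infinity>"

text \<open>The dependence on the group and on \<open>\<alpha>\<close> is through the quasi-norm \<open>nrm\<close>, the covering to
  which \<open>\<psi>\<close> is subordinate, and the chosen points \<open>\<xi> i\<close> of its members.\<close>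

definition alpha_modulation_space ::
    "(real^'n::finite \<Rightarrow> real) \<Rightarrow> 'i set \<Rightarrow> ('i \<Rightarrow> real^'n \<Rightarrow> real) \<Rightarrow> ('i \<Rightarrow> real^'n) \<Rightarrow>
     ennreal \<Rightarrow> ennreal \<Rightarrow> real \<Rightarrow> ((real^'n \<Rightarrow> complex) \<Rightarrow> complex) set" where
  "alpha_modulation_space nrm I \<psi> \<xi> p q s =
     {f \<in> Z_dual.
        Lp_norm (count_space I) q
          (\<lambda>i. ennreal ((1 + (nrm (\<xi> i))\<^sup>2) powr (s / 2)) *
               Lp_norm_functional p
                 (inv_fourier_functional (mult_functional (\<psi> i) (fourier_functional f)))) < \<infinity>}"

end

theory Submission
  imports Defs "HOL-Probability.Characteristic_Functions" "HOL-Probability.Sinc_Integral"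
begin

text \<open>For a Schwartz function \<open>f\<close> the \<open>i\<close>-th piece is \<open>u\<^sub>i = inv_fourier (\<psi> i * fourier f)\<close>, and
  \<open>L\<^sup>p\<close> and \<open>\<ell>\<^sup>q\<close> norms are controlled by the cases \<open>1\<close> and \<open>\<infinity>\<close>. Let \<open>d\<^sub>i\<close> be the distance of
  \<open>P i\<close> from the origin. The supremum of \<open>u\<^sub>i\<close> decays rapidly in \<open>d\<^sub>i\<close> because \<open>fourier f\<close> does. For the
  \<open>L\<^sup>1\<close> norm only \<open>\<parallel>inv_fourier (\<psi> i)\<parallel>\<^sub>1\<close> is controlled, so \<open>f\<close> is first replaced by its part of frequency
  at least of order \<open>d\<^sub>i\<close>: with a compactly supported \<open>\<theta>\<close>, \<open>\<theta> 0 = 1\<close>, one has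
  \<open>\<psi> i * fourier f = \<psi> i * (1 - \<theta> (\<cdot> / \<rho>)) ^ k * fourier f\<close> for \<open>\<rho>\<close> of order \<open>d\<^sub>i\<close>, and each factor
  \<open>1 - \<theta> (\<omega> / \<rho>) = \<rho>\<^sup>-\<^sup>1 (\<Sum>j. \<omega>\<^sub>j m\<^sub>j (\<omega> / \<rho>))\<close>, with \<open>L\<^sup>1\<close> multipliers \<open>m\<^sub>j\<close>, trades a derivative of \<open>f\<close> for a factor \<open>1 / \<rho>\<close>.

  Within one member of the covering all points are polynomially comparable in size, so the decay in \<open>d\<^sub>i\<close>
  beats the weight, and the bounded overlap together with the lower bound on the measures of the members
  compares the sum over \<open>i\<close> with the integral of an integrable weight.\<close>

section \<open>Integration on \<open>real ^ 'n\<close>\<close>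

text \<open>A BAPU carries no uniform bound on the derivatives of its members, so decay of the L^1
  norm of a piece cannot come from integrating by parts against \<open>\<psi> i\<close>. Every
  derivative has to fall on \<open>f\<close>, through operators bounded on L^1 uniformly in
  \<open>\<rho>\<close>; Hadamard's lemma supplies them as transforms of finite measures. For this
  the kernel of \<open>\<theta>\<close> must be integrable even after multiplication by one
  coordinate, and a product of one-dimensional piecewise polynomials has just enough decay.

  Comparability for \<alpha> = 0 is where the group enters: a member lies in a left translate of a
  fixed quasi-ball, about a centre of which nothing is known. Two consequences of the triangular
  form of the Baker-Campbell-Hausdorff law with respect to the degree deal with the centre. Left
  translations are compositions of shears and preserve Lebesgue measure, so the volume of a
  quasi-ball does not depend on its centre; and the centre can be eliminated from the coordinates of
  two points of the same quasi-ball at polynomial cost.\<close>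

lemma lborel_vec_prod:
  fixes g :: "'n::finite \<Rightarrow> real \<Rightarrow> 'a::{real_normed_field,banach,second_countable_topology}"
  assumes g: "\<And>j. integrable lborel (g j)"
  shows integrable_vec_prod: "integrable lborel (\<lambda>x::real^'n. \<Prod>j\<in>UNIV. g j (x $ j))"
    and integral_vec_prod: "(LINT x|lborel. (\<Prod>j\<in>UNIV. g j ((x::real^'n) $ j))) = (\<Prod>j\<in>UNIV. (LINT t|lborel. g j t))"
proof -
  interpret product_sigma_finite "\<lambda>b :: real^'n. lborel :: real measure" by standard
  define ax where "ax = (\<lambda>j. axis j 1 :: real^'n)"
  have inj: "inj ax" by (auto simp: inj_on_def ax_def axis_eq_axis)
  have Basis: "(Basis :: (real^'n) set) = range ax"
    by (auto simp: Basis_vec_def ax_def)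
  define h where "h b = g (inv ax b)" for b
  have h_ax: "h (ax j) = g j" for j using inj by (simp add: h_def)
  have [measurable]: "g j \<in> borel_measurable borel" for j
    using borel_measurable_integrable[OF g[of j]] by simp
  have h: "b \<in> Basis \<Longrightarrow> integrable lborel (h b)" for b
    using g by (simp add: h_def)
  \<comment> \<open>\<open>lborel_eq\<close> assembles a vector from a function on
    \<open>Basis\<close>; this reads off its coordinates, so that a product over \<open>'n\<close>
    becomes one over \<open>Basis\<close>.\<close>
  have comp: "(\<Sum>b\<in>Basis. f b *\<^sub>R b) $ j = f (ax j)" for f :: "real^'n \<Rightarrow> real" and j
  proof -
    have "(\<Sum>b\<in>Basis. f b *\<^sub>R b) = (\<Sum>j\<in>UNIV. f (ax j) *\<^sub>R ax j)"
      unfolding Basis by (simp add: sum.reindex[OF inj])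
    then have "(\<Sum>b\<in>Basis. f b *\<^sub>R b) $ j = (\<Sum>i\<in>UNIV. f (ax i) *\<^sub>R ax i) $ j" by simp
    also have "\<dots> = (\<Sum>i\<in>UNIV. if i = j then f (ax i) else 0)"
      by (simp add: ax_def axis_def if_distrib eq_commute cong: if_cong)
    finally show ?thesis by simp
  qed
  have prod: "(\<Prod>j\<in>UNIV. g j ((\<Sum>b\<in>Basis. f b *\<^sub>R b) $ j)) = (\<Prod>b\<in>Basis. h b (f b))" for f
    unfolding comp by (simp add: Basis prod.reindex[OF inj] h_ax)
  have [measurable]: "(\<lambda>x::real^'n. \<Prod>j\<in>UNIV. g j (x $ j)) \<in> borel_measurable borel"
    by measurable
  show "integrable lborel (\<lambda>x::real^'n. \<Prod>j\<in>UNIV. g j (x $ j))"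
    by (subst lborel_eq, subst integrable_distr_eq) (simp_all del: sum_component add: prod product_integrable_prod h)
  have "(LINT x|lborel. (\<Prod>j\<in>UNIV. g j ((x::real^'n) $ j))) = (\<Prod>b\<in>Basis. (LINT t|lborel. h b t))"
    by (subst lborel_eq, subst integral_distr) (simp_all del: sum_component add: prod product_integral_prod h)
  then show "(LINT x|lborel. (\<Prod>j\<in>UNIV. g j ((x::real^'n) $ j))) = (\<Prod>j\<in>UNIV. (LINT t|lborel. g j t))"
    unfolding Basis by (simp add: prod.reindex[OF inj] h_ax)
qed

lemma lborel_affine_vec:
  fixes f :: "'b::euclidean_space \<Rightarrow> 'a::{banach,second_countable_topology}"
  assumes c: "c \<noteq> 0" and f: "f \<in> borel_measurable borel"
  shows integrable_affine_iff: "integrable lborel (\<lambda>x. f (t + c *\<^sub>R x)) \<longleftrightarrow> integrable lborel f"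
    and integral_affine: "(LINT x|lborel. f x) = \<bar>c\<bar> ^ DIM('b) *\<^sub>R (LINT x|lborel. f (t + c *\<^sub>R x))"
proof -
  note [measurable] = f
  have "integrable lborel f \<longleftrightarrow> integrable lborel (\<lambda>x. \<bar>c\<bar> ^ DIM('b) *\<^sub>R f (t + c *\<^sub>R x))"
    by (subst lborel_affine[OF c, of t], subst integrable_density) (auto simp: integrable_distr_eq)
  also have "\<dots> \<longleftrightarrow> integrable lborel (\<lambda>x. f (t + c *\<^sub>R x))"
    using integrable_scaleR_right[of "inverse (\<bar>c\<bar> ^ DIM('b))" lborel "\<lambda>x. \<bar>c\<bar> ^ DIM('b) *\<^sub>R f (t + c *\<^sub>R x)"] c
    by auto
  finally show "integrable lborel (\<lambda>x. f (t + c *\<^sub>R x)) \<longleftrightarrow> integrable lborel f" ..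
  show "(LINT x|lborel. f x) = \<bar>c\<bar> ^ DIM('b) *\<^sub>R (LINT x|lborel. f (t + c *\<^sub>R x))"
    by (subst lborel_affine[OF c, of t], subst integral_density) (auto simp: integral_distr)
qed

lemma lborel_reflect:
  fixes f :: "'b::euclidean_space \<Rightarrow> 'a::{banach,second_countable_topology}"
  assumes f: "f \<in> borel_measurable borel"
  shows integrable_translate: "integrable lborel (\<lambda>x. f (x - t)) \<longleftrightarrow> integrable lborel f"
    and integral_translate: "(LINT x|lborel. f (x - t)) = (LINT x|lborel. f x)"
    and integrable_uminus: "integrable lborel (\<lambda>x. f (- x)) \<longleftrightarrow> integrable lborel f"
    and integral_uminus: "(LINT x|lborel. f (- x)) = (LINT x|lborel. f x)"
  using integrable_affine_iff[of 1, OF _ f, of "-t"] integral_affine[of 1, OF _ f, of "-t"]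
    integrable_affine_iff[of "-1", OF _ f, of 0] integral_affine[of "-1", OF _ f, of 0]
  by simp_all

text \<open>A kernel bounded by one leaves \<open>f x * g y\<close> as an integrable majorant on the
  product space. Keeping the kernel general serves the multiplication formula, the inversion theorem
  and convolutions alike.\<close>

lemma (in pair_sigma_finite) Fubini_kernel:
  fixes f :: "'a \<Rightarrow> complex" and g :: "'b \<Rightarrow> complex"
  assumes f: "integrable M1 f" and g: "integrable M2 g"
    and e: "case_prod e \<in> borel_measurable (M1 \<Otimes>\<^sub>M M2)" and le: "\<And>x y. norm (e x y) \<le> 1"
  shows "(LINT x|M1. f x * (LINT y|M2. g y * e x y)) = (LINT y|M2. g y * (LINT x|M1. f x * e x y))"
proof -
  note [measurable] = borel_measurable_integrable[OF f] borel_measurable_integrable[OF g] e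
  have fg: "integrable (M1 \<Otimes>\<^sub>M M2) (\<lambda>(x,y). f x * g y)"
  proof (rule Fubini_integrable)
    show "integrable M1 (\<lambda>x. LINT y|M2. norm (case (x, y) of (x, y) \<Rightarrow> f x * g y))"
      using f by (simp add: norm_mult)
    show "AE x in M1. integrable M2 (\<lambda>y. case (x, y) of (x, y) \<Rightarrow> f x * g y)"
      using g by simp
  qed simp
  have fge: "integrable (M1 \<Otimes>\<^sub>M M2) (\<lambda>(x,y). f x * (g y * e x y))"
  proof (rule Bochner_Integration.integrable_bound[OF fg])
    show "(\<lambda>(x,y). f x * (g y * e x y)) \<in> borel_measurable (M1 \<Otimes>\<^sub>M M2)" by measurable
    show "AE z in M1 \<Otimes>\<^sub>M M2. norm (case z of (x, y) \<Rightarrow> f x * (g y * e x y)) \<le> norm (case z of (x, y) \<Rightarrow> f x * g y)"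
      by (rule AE_I2) (auto simp: norm_mult intro!: mult_left_mono mult_left_le le)
  qed
  have "(LINT x|M1. f x * (LINT y|M2. g y * e x y)) = (LINT x|M1. (LINT y|M2. f x * (g y * e x y)))"
    by simp
  also have "\<dots> = (LINT y|M2. (LINT x|M1. f x * (g y * e x y)))"
    using integral_fst[OF fge] integral_snd[OF fge] by simp
  also have "\<dots> = (LINT y|M2. (LINT x|M1. g y * (f x * e x y)))"
    by (simp add: mult.left_commute)
  finally show ?thesis by simp
qed

section \<open>The Fourier transform of integrable functions\<close>

lemma cis_measurable [measurable (raw)]:
  assumes "f \<in> borel_measurable M" shows "(\<lambda>x. cis (f x)) \<in> borel_measurable M"
proof -
  have "cis \<in> borel_measurable borel"
    by (intro borel_measurable_continuous_onI continuous_intros)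
  then show ?thesis using assms by measurable
qed

lemma fourier_measurable [measurable]:
  fixes f :: "real^'n::finite \<Rightarrow> complex"
  assumes [measurable]: "f \<in> borel_measurable borel"
  shows "fourier f \<in> borel_measurable borel" "inv_fourier f \<in> borel_measurable borel"
  unfolding fourier_def inv_fourier_def by measurable

lemma integrable_mult_cis:
  fixes f :: "'a \<Rightarrow> complex"
  assumes f: "integrable M f" and [measurable]: "\<theta> \<in> borel_measurable M"
  shows "integrable M (\<lambda>x. f x * cis (\<theta> x))"
proof (rule Bochner_Integration.integrable_bound[OF f])
  have [measurable]: "f \<in> borel_measurable M" using f by simp
  show "(\<lambda>x. f x * cis (\<theta> x)) \<in> borel_measurable M" by measurable
qed (simp add: norm_mult)

lemma norm_fourier_le:
  fixes f :: "real^'n::finite \<Rightarrow> complex"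
  shows "norm (fourier f \<omega>) \<le> (LINT x|lborel. norm (f x))"
    "norm (inv_fourier f \<omega>) \<le> (LINT x|lborel. norm (f x))"
  unfolding fourier_def inv_fourier_def
  by (rule integral_norm_bound[THEN order_trans], simp add: norm_mult)+

text \<open>The multiplication formula. It later moves the transforms off the test function when a
  functional is to be represented by a function.\<close>

lemma fourier_multiplication:
  fixes f g :: "real^'n::finite \<Rightarrow> complex"
  assumes "integrable lborel f" "integrable lborel g"
  shows "(LINT x|lborel. f x * fourier g x) = (LINT x|lborel. g x * fourier f x)"
    and "(LINT x|lborel. f x * inv_fourier g x) = (LINT x|lborel. g x * inv_fourier f x)"
proof -
  show "(LINT x|lborel. f x * fourier g x) = (LINT x|lborel. g x * fourier f x)"
    unfolding fourier_def
    by (subst lborel_pair.Fubini_kernel[OF assms]) (auto simp: inner_commute)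
  show "(LINT x|lborel. f x * inv_fourier g x) = (LINT x|lborel. g x * inv_fourier f x)"
    unfolding inv_fourier_def
    by (subst lborel_pair.Fubini_kernel[OF assms]) (auto simp: inner_commute)
qed

lemma inv_fourier_eq: "inv_fourier f x = fourier f (- x)"
  by (simp add: inv_fourier_def fourier_def inner_commute)

text \<open>The two transforms differ by a reflection, which leaves the integral unchanged. This
  turns \<open>fourier_inversion\<close> into inversion in the opposite order.\<close>

lemma fourier_inv_fourier_swap:
  fixes f :: "real^'n::finite \<Rightarrow> complex"
  assumes [measurable]: "f \<in> borel_measurable borel"
  shows "fourier (inv_fourier f) x = inv_fourier (fourier f) x"
proof -
  have "fourier (inv_fourier f) x = (LINT y|lborel. fourier f (- y) * cis (2 * pi * ((- y) \<bullet> x)))"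
    unfolding fourier_def[of "inv_fourier f"] inv_fourier_eq by (simp add: algebra_simps)
  also have "\<dots> = (LINT y|lborel. fourier f y * cis (2 * pi * (y \<bullet> x)))"
    by (rule integral_uminus[where f="\<lambda>y. fourier f y * cis (2 * pi * (y \<bullet> x))"]) measurable
  finally show ?thesis by (simp add: inv_fourier_def inner_commute)
qed

subsection \<open>Inversion\<close>

definition gauss :: "real^'n::finite \<Rightarrow> real" where
  "gauss z = (\<Prod>j\<in>UNIV. std_normal_density (z $ j))"

lemma gauss_integrable: "integrable lborel (gauss :: real^'n::finite \<Rightarrow> real)"
  unfolding gauss_def by (rule integrable_vec_prod) auto

lemma gauss_integral: "(LINT z|lborel. gauss (z::real^'n::finite)) = 1"
  unfolding gauss_def by (subst integral_vec_prod) auto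

lemma gauss_measurable [measurable]: "(gauss :: real^'n::finite \<Rightarrow> real) \<in> borel_measurable borel"
  using borel_measurable_integrable[OF gauss_integrable] by simp

lemma gauss_nonneg: "0 \<le> gauss z"
  unfolding gauss_def by (intro prod_nonneg) auto

lemma std_normal_fourier:
  "(LINT x|lborel. complex_of_real (std_normal_density x) * cis (t * x)) = exp (- t\<^sup>2 / 2)"
proof -
  have "char std_normal_distribution t = (CLINT x|std_normal_distribution. cis (t * x))"
    by (simp add: char_def cis_conv_exp)
  also have "\<dots> = (LINT x|lborel. complex_of_real (std_normal_density x) * cis (t * x))"
    by (subst integral_density) (auto simp: scaleR_conv_of_real)
  finally show ?thesis by (simp add: char_std_normal_distribution)
qed

text \<open>The regularising factor in the inversion integral: its inverse transform is \<open>gauss\<close> concentrated at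
  scale \<open>\<delta>\<close>.\<close>

definition gauss_damp :: "real \<Rightarrow> real^'n::finite \<Rightarrow> complex" where
  "gauss_damp \<delta> \<omega> = (\<Prod>j\<in>UNIV. exp (- (2 * pi * \<delta> * \<omega> $ j)\<^sup>2 / 2))"

text \<open>Up to the factor \<open>sqrt (2 * pi)\<close> the integrand is the standard normal
  density at \<open>2 * pi * \<delta> * t\<close>, so rescaling the characteristic function of the
  normal distribution gives its transform.\<close>

lemma gauss_damp_1d:
  assumes d: "\<delta> > 0"
  shows "integrable lborel (\<lambda>t. complex_of_real (exp (- (2 * pi * \<delta> * t)\<^sup>2 / 2)))"
    and "(LINT t|lborel. complex_of_real (exp (- (2 * pi * \<delta> * t)\<^sup>2 / 2)) * cis (2 * pi * (b * t)))
      = std_normal_density (b / \<delta>) / \<delta>"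
proof -
  have c: "2 * pi * \<delta> \<noteq> 0" using d by simp
  have e: "exp (- (2 * pi * \<delta> * t)\<^sup>2 / 2) = sqrt (2 * pi) * std_normal_density (0 + 2 * pi * \<delta> * t)" for t
    by (simp add: std_normal_density_def)
  have "integrable lborel (\<lambda>t. std_normal_density (0 + 2 * pi * \<delta> * t))"
    using lborel_integrable_real_affine_iff[OF c, of std_normal_density 0] by simp
  then show "integrable lborel (\<lambda>t. complex_of_real (exp (- (2 * pi * \<delta> * t)\<^sup>2 / 2)))"
    unfolding e by simp
  have "(LINT x|lborel. complex_of_real (std_normal_density x) * cis (b / \<delta> * x)) =
     \<bar>2 * pi * \<delta>\<bar> *\<^sub>R (LINT x|lborel. complex_of_real (std_normal_density (0 + 2 * pi * \<delta> * x)) * cis (b / \<delta> * (0 + 2 * pi * \<delta> * x)))"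
    by (rule lborel_integral_real_affine[OF c])
  moreover have "b / \<delta> * (0 + 2 * pi * \<delta> * x) = 2 * pi * (b * x)" for x using d by simp
  ultimately have "exp (- (b / \<delta>)\<^sup>2 / 2) = (2 * pi * \<delta>) *\<^sub>R (LINT x|lborel. complex_of_real (std_normal_density (0 + 2 * pi * \<delta> * x)) * cis (2 * pi * (b * x)))"
    using d unfolding std_normal_fourier by (simp only: abs_of_pos mult_pos_pos pi_gt_zero zero_less_numeral)
  then have "(LINT x|lborel. complex_of_real (std_normal_density (0 + 2 * pi * \<delta> * x)) * cis (2 * pi * (b * x))) = exp (- (b / \<delta>)\<^sup>2 / 2) / (2 * pi * \<delta>)"
    using d by (simp add: scaleR_conv_of_real field_simps)
  then have *: "(LINT t|lborel. complex_of_real (exp (- (2 * pi * \<delta> * t)\<^sup>2 / 2)) * cis (2 * pi * (b * t)))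
     = complex_of_real (sqrt (2 * pi)) * complex_of_real (exp (- (b / \<delta>)\<^sup>2 / 2)) / complex_of_real (2 * pi * \<delta>)"
    unfolding e of_real_mult mult.assoc[of "complex_of_real (sqrt (2 * pi))"] integral_mult_right_zero by simp
  have "sqrt (2 * pi) * exp (- (b / \<delta>)\<^sup>2 / 2) / (2 * pi * \<delta>) = std_normal_density (b / \<delta>) / \<delta>"
  proof -
    have "sqrt (2 * pi) * exp (- (b / \<delta>)\<^sup>2 / 2) / (2 * pi * \<delta>) = (sqrt (2 * pi) / (2 * pi)) * exp (- (b / \<delta>)\<^sup>2 / 2) / \<delta>"
      by (simp only: times_divide_eq_left times_divide_eq_right divide_divide_eq_left)
    then show ?thesis by (simp only: sqrt_divide_self_eq std_normal_density_def inverse_eq_divide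
        zero_le_mult_iff pi_ge_zero zero_le_numeral simp_thms)
  qed
  with * show "(LINT t|lborel. complex_of_real (exp (- (2 * pi * \<delta> * t)\<^sup>2 / 2)) * cis (2 * pi * (b * t)))
      = std_normal_density (b / \<delta>) / \<delta>"
    by (simp only: of_real_mult[symmetric] of_real_divide[symmetric])
qed

lemma cis_sum: "finite A \<Longrightarrow> cis (\<Sum>j\<in>A. f j) = (\<Prod>j\<in>A. cis (f j))"
  by (induction A rule: finite_induct) (auto simp: cis_mult[symmetric])

lemma cis_inner_vec: "cis (c * (x \<bullet> y)) = (\<Prod>j\<in>UNIV. cis (c * (x $ j * y $ j)))"
  by (simp add: inner_vec_def sum_distrib_left cis_sum)

lemma gauss_damp_integrable:
  assumes "\<delta> > 0" shows "integrable lborel (gauss_damp \<delta> :: real^'n::finite \<Rightarrow> complex)"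
  unfolding gauss_damp_def of_real_prod
  by (rule integrable_vec_prod[where g="\<lambda>j t. complex_of_real (exp (- (2 * pi * \<delta> * t)\<^sup>2 / 2))"])
     (rule gauss_damp_1d[OF assms])

lemma inv_fourier_gauss_damp:
  fixes b :: "real^'n::finite"
  assumes d: "\<delta> > 0"
  shows "inv_fourier (gauss_damp \<delta>) b = gauss (b /\<^sub>R \<delta>) / \<delta> ^ CARD('n)"
proof -
  have "inv_fourier (gauss_damp \<delta>) b = (LINT \<omega>|lborel. (\<Prod>j\<in>UNIV. (\<lambda>t. complex_of_real (exp (- (2 * pi * \<delta> * t)\<^sup>2 / 2)) * cis (2 * pi * (b $ j * t))) (\<omega> $ j)))"
    unfolding inv_fourier_def gauss_damp_def cis_inner_vec by (simp add: prod.distrib)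
  also have "\<dots> = (\<Prod>j\<in>UNIV. std_normal_density (b $ j / \<delta>) / \<delta>)"
    unfolding of_real_prod
    by (subst integral_vec_prod, rule integrable_mult_cis[OF gauss_damp_1d(1)[OF d]], measurable)
       (simp only: gauss_damp_1d(2)[OF d])
  also have "\<dots> = gauss (b /\<^sub>R \<delta>) / \<delta> ^ CARD('n)"
    by (simp add: gauss_def prod_dividef divide_inverse mult.commute prod.distrib power_inverse)
  finally show ?thesis by simp
qed

text \<open>With \<open>gauss_damp\<close> inserted into the inversion integral, dominated
  convergence recovers the inverse transform as the damping vanishes. Exchanging the integrals shows
  that the same quantity is a Gaussian average of \<open>\<phi>\<close> around \<open>x\<close>,
  which tends to \<open>\<phi> x\<close> by continuity and boundedness.\<close>

theorem fourier_inversion: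
  fixes \<phi> :: "real^'n::finite \<Rightarrow> complex"
  assumes int: "integrable lborel \<phi>" and intF: "integrable lborel (fourier \<phi>)"
    and cont: "continuous_on UNIV \<phi>" and bdd: "\<And>y. norm (\<phi> y) \<le> B"
  shows "inv_fourier (fourier \<phi>) x = \<phi> x"
proof -
  define \<delta> :: "nat \<Rightarrow> real" where "\<delta> k = 1 / Suc k" for k
  have dpos: "\<delta> k > 0" for k by (simp add: \<delta>_def)
  have dlim: "\<delta> \<longlonglongrightarrow> 0" unfolding \<delta>_def using LIMSEQ_inverse_real_of_nat by (simp add: inverse_eq_divide)
  note [measurable] = borel_measurable_integrable[OF int, simplified] borel_measurable_continuous_onI[OF cont]
  have [measurable]: "gauss_damp a \<in> borel_measurable borel" for a :: real
    unfolding gauss_damp_def by measurable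
  define J where "J k = (LINT \<omega>|lborel. (fourier \<phi> \<omega> * cis (2 * pi * (x \<bullet> \<omega>))) * gauss_damp (\<delta> k) \<omega>)" for k
  have "J \<longlonglongrightarrow> (LINT \<omega>|lborel. (fourier \<phi> \<omega> * cis (2 * pi * (x \<bullet> \<omega>))) * 1)"
    unfolding J_def
  proof (rule integral_dominated_convergence[where w="\<lambda>\<omega>. norm (fourier \<phi> \<omega>)"])
    show "integrable lborel (\<lambda>\<omega>. norm (fourier \<phi> \<omega>))" using intF by simp
    show "AE \<omega> in lborel. (\<lambda>k. fourier \<phi> \<omega> * cis (2 * pi * (x \<bullet> \<omega>)) * gauss_damp (\<delta> k) \<omega>) \<longlonglongrightarrow>
       fourier \<phi> \<omega> * cis (2 * pi * (x \<bullet> \<omega>)) * 1"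
    proof (intro AE_I2 tendsto_mult tendsto_const)
      fix \<omega> :: "real^'n"
      have "(\<lambda>k. \<Prod>j\<in>UNIV. exp (- (2 * pi * \<delta> k * \<omega> $ j)\<^sup>2 / 2)) \<longlonglongrightarrow> (\<Prod>j\<in>(UNIV::'n set). exp (- (2 * pi * 0 * \<omega> $ j)\<^sup>2 / 2))"
        by (intro tendsto_intros dlim) auto
      then have "(\<lambda>k. complex_of_real (\<Prod>j\<in>UNIV. exp (- (2 * pi * \<delta> k * \<omega> $ j)\<^sup>2 / 2))) \<longlonglongrightarrow> of_real 1"
        by (intro tendsto_of_real) simp
      then show "(\<lambda>k. gauss_damp (\<delta> k) \<omega>) \<longlonglongrightarrow> 1" by (simp add: gauss_damp_def)
    qed
    show "AE \<omega> in lborel. norm (fourier \<phi> \<omega> * cis (2 * pi * (x \<bullet> \<omega>)) * gauss_damp (\<delta> k) \<omega>) \<le> norm (fourier \<phi> \<omega>)" for k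
    proof (rule AE_I2)
      fix \<omega> :: "real^'n"
      have "norm (gauss_damp (\<delta> k) \<omega>) \<le> 1"
        unfolding gauss_damp_def norm_of_real abs_prod by (intro prod_le_1) auto
      then show "norm (fourier \<phi> \<omega> * cis (2 * pi * (x \<bullet> \<omega>)) * gauss_damp (\<delta> k) \<omega>) \<le> norm (fourier \<phi> \<omega>)"
        by (simp add: norm_mult mult_left_le)
    qed
  qed measurable
  then have lim1: "J \<longlonglongrightarrow> inv_fourier (fourier \<phi>) x"
    by (simp add: inv_fourier_def)
  \<comment> \<open>The substitution \<open>y = x - D * z\<close> brings the factor
    \<open>D ^ CARD('n)\<close>, which cancels the normalisation in
    \<open>inv_fourier_gauss_damp\<close>.\<close>
  have J: "J k = (LINT z|lborel. \<phi> (x + (- \<delta> k) *\<^sub>R z) * gauss z)" for k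
  proof -
    define D where "D = \<delta> k"
    have D: "D > 0" using dpos by (simp add: D_def)
    have "J k = (LINT \<omega>|lborel. (gauss_damp D \<omega> * cis (2 * pi * (x \<bullet> \<omega>))) * (LINT y|lborel. \<phi> y * cis (- 2 * pi * (y \<bullet> \<omega>))))"
      unfolding J_def D_def[symmetric] fourier_def by (intro Bochner_Integration.integral_cong) auto
    also have "\<dots> = (LINT y|lborel. \<phi> y * (LINT \<omega>|lborel. (gauss_damp D \<omega> * cis (2 * pi * (x \<bullet> \<omega>))) * cis (- 2 * pi * (y \<bullet> \<omega>))))"
      by (rule lborel_pair.Fubini_kernel) (auto intro!: integrable_mult_cis gauss_damp_integrable D int)
    also have "\<dots> = (LINT y|lborel. \<phi> y * inv_fourier (gauss_damp D) (x - y))"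
      unfolding inv_fourier_def by (simp add: mult.assoc cis_mult inner_diff_left algebra_simps)
    also have "\<dots> = (LINT y|lborel. \<phi> y * gauss ((x - y) /\<^sub>R D) / D ^ CARD('n))"
      by (simp add: inv_fourier_gauss_damp[OF D])
    also have "\<dots> = \<bar>- D\<bar> ^ DIM(real^'n) *\<^sub>R (LINT z|lborel. \<phi> (x + (- D) *\<^sub>R z) * gauss ((x - (x + (- D) *\<^sub>R z)) /\<^sub>R D) / D ^ CARD('n))"
      by (rule integral_affine) (use D in \<open>auto\<close>)
    also have "\<dots> = (LINT z|lborel. \<phi> (x + (- D) *\<^sub>R z) * gauss z)"
    proof -
      have "(x - (x + (- D) *\<^sub>R z)) /\<^sub>R D = z" for z using D by simp
      then have "(LINT z|lborel. \<phi> (x + (- D) *\<^sub>R z) * gauss ((x - (x + (- D) *\<^sub>R z)) /\<^sub>R D) / D ^ CARD('n))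
        = (LINT z|lborel. \<phi> (x + (- D) *\<^sub>R z) * gauss z) / D ^ CARD('n)" by (simp only: integral_divide_zero of_real_power)
      then show ?thesis using D by (simp add: scaleR_conv_of_real[of _ "_::complex"])
    qed
    finally show ?thesis by (simp add: D_def)
  qed
  have "(\<lambda>k. LINT z|lborel. \<phi> (x + (- \<delta> k) *\<^sub>R z) * gauss z) \<longlonglongrightarrow> (LINT z|lborel. \<phi> x * gauss (z::real^'n))"
  proof (rule integral_dominated_convergence[where w="\<lambda>z::real^'n. B * gauss z"])
    show "integrable lborel (\<lambda>z::real^'n. B * gauss z)" by (simp add: gauss_integrable)
    show "AE z in lborel. norm (\<phi> (x + - \<delta> k *\<^sub>R z) * gauss z) \<le> B * gauss z" for k
      by (rule AE_I2) (auto simp: norm_mult gauss_nonneg intro!: mult_right_mono bdd)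
    show "AE z in lborel. (\<lambda>k. \<phi> (x + - \<delta> k *\<^sub>R z) * complex_of_real (gauss z)) \<longlonglongrightarrow> \<phi> x * complex_of_real (gauss z)"
    proof (intro AE_I2 tendsto_mult tendsto_const)
      fix z :: "real^'n"
      have "(\<lambda>k. x + - \<delta> k *\<^sub>R z) \<longlonglongrightarrow> x + - 0 *\<^sub>R z" by (intro tendsto_intros dlim)
      then have *: "(\<lambda>k. x + - \<delta> k *\<^sub>R z) \<longlonglongrightarrow> x" by simp
      have "isCont \<phi> x" using cont by (simp add: continuous_on_eq_continuous_at)
      then show "(\<lambda>k. \<phi> (x + - \<delta> k *\<^sub>R z)) \<longlonglongrightarrow> \<phi> x"
        by (rule isCont_tendsto_compose[OF _ *])
    qed
  qed measurable
  moreover have "(LINT z|lborel. \<phi> x * complex_of_real (gauss (z::real^'n))) = \<phi> x"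
    by (simp add: gauss_integral)
  ultimately have "J \<longlonglongrightarrow> \<phi> x" unfolding J[abs_def] by (simp only:)
  with lim1 show ?thesis by (rule LIMSEQ_unique)
qed

section \<open>Smooth functions\<close>

lemma pderivs_append: "pderivs (js @ ks) f = pderivs js (pderivs ks f)"
  by (induction js) auto

lemma smooth_pderivs: "smooth f \<Longrightarrow> smooth (pderivs ks f)"
  unfolding smooth_def by (metis pderivs_append)

lemma smooth_differentiable: "smooth f \<Longrightarrow> pderivs js f differentiable (at x)"
  by (simp add: smooth_def)

lemma smooth_continuous: "smooth f \<Longrightarrow> continuous_on A (pderivs js f)"
  by (meson continuous_at_imp_continuous_on differentiable_imp_continuous_within smooth_def)

lemma smooth_continuous0: "smooth f \<Longrightarrow> continuous_on A f"
  using smooth_continuous[of f A "[]"] by simp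

text \<open>Grading smoothness by order gives the closure under products a parameter for
  induction.\<close>

definition smooth_upto :: "nat \<Rightarrow> (real^'n::finite \<Rightarrow> 'a::real_normed_vector) \<Rightarrow> bool" where
  "smooth_upto n f \<longleftrightarrow> (\<forall>js x. length js \<le> n \<longrightarrow> pderivs js f differentiable (at x))"

lemma smooth_iff_upto: "smooth f \<longleftrightarrow> (\<forall>n. smooth_upto n f)"
  by (auto simp: smooth_def smooth_upto_def)

lemma pderivs_add:
  assumes "smooth_upto n f" "smooth_upto n g" "length js \<le> Suc n"
  shows "pderivs js (\<lambda>x. f x + g x) = (\<lambda>x. pderivs js f x + pderivs js g x)"
  using assms(3)
proof (induction js)
  case (Cons j js)
  show ?case
  proof
    fix x
    have "(pderivs js f has_derivative frechet_derivative (pderivs js f) (at x)) (at x)"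
      "(pderivs js g has_derivative frechet_derivative (pderivs js g) (at x)) (at x)"
      using assms Cons.prems by (auto simp: smooth_upto_def frechet_derivative_works[symmetric])
    from has_derivative_add[OF this]
    show "pderivs (j # js) (\<lambda>x. f x + g x) x = pderivs (j # js) f x + pderivs (j # js) g x"
      using Cons by (simp add: frechet_derivative_at[symmetric])
  qed
qed auto

lemma smooth_upto_add: "smooth_upto n f \<Longrightarrow> smooth_upto n g \<Longrightarrow> smooth_upto n (\<lambda>x. f x + g x)"
  unfolding smooth_upto_def[of _ "\<lambda>x. f x + g x"]
  by (auto simp: pderivs_add[of n f g] smooth_upto_def intro!: differentiable_add)

lemma smooth_add: "smooth f \<Longrightarrow> smooth g \<Longrightarrow> smooth (\<lambda>x. f x + g x)"
  by (simp add: smooth_iff_upto smooth_upto_add)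

text \<open>Induction on the order with both factors arbitrary: a first derivative of the product is
  a sum of two products of smooth functions, to which the hypothesis applies again.\<close>

lemma smooth_bilinear:
  fixes f :: "real^'n::finite \<Rightarrow> 'a::real_normed_vector" and g :: "real^'n \<Rightarrow> 'b::real_normed_vector"
  assumes b: "bounded_bilinear b" and "smooth f" "smooth g"
  shows "smooth (\<lambda>x. b (f x) (g x))"
proof -
  interpret bounded_bilinear b by fact
  have "smooth_upto n (\<lambda>x. b (f x) (g x))" for n
    using assms(2,3)
  proof (induction n arbitrary: f g)
    case (0 f g)
    have "(\<lambda>x. b (f x) (g x)) differentiable (at x)" for x
    proof -
      obtain f' g' where "(f has_derivative f') (at x)" "(g has_derivative g') (at x)"
        using smooth_differentiable[of f "[]" x] smooth_differentiable[of g "[]" x] 0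
        unfolding differentiable_def by auto
      from FDERIV[OF this] show ?thesis unfolding differentiable_def by blast
    qed
    then show ?case by (simp add: smooth_upto_def)
  next
    case (Suc n f g)
    note diff = smooth_differentiable[of f "[]", OF Suc.prems(1)] smooth_differentiable[of g "[]", OF Suc.prems(2)]
    have der: "((\<lambda>x. b (f x) (g x)) has_derivative
       (\<lambda>h. b (f x) (frechet_derivative g (at x) h) + b (frechet_derivative f (at x) h) (g x))) (at x)" for x
      using diff by (intro FDERIV) (auto simp: frechet_derivative_works[symmetric])
    have 1: "pderivs [j] (\<lambda>x. b (f x) (g x)) = (\<lambda>x. b (f x) (pderivs [j] g x) + b (pderivs [j] f x) (g x))" for j
      using frechet_derivative_at[OF der] by (auto simp: fun_eq_iff)
    show ?case unfolding smooth_upto_def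
    proof (intro allI impI)
      fix js :: "'n list" and x assume len: "length js \<le> Suc n"
      show "pderivs js (\<lambda>x. b (f x) (g x)) differentiable at x"
      \<comment> \<open>\<open>pderivs\<close> takes the derivative in the last direction of the
        list first, so the list is split at its end.\<close>
      proof (cases js rule: rev_exhaust)
        case Nil
        then show ?thesis using der by (auto simp: differentiable_def)
      next
        case (snoc ks j)
        have "smooth_upto n (pderivs [j] (\<lambda>x. b (f x) (g x)))"
          unfolding 1 using Suc.prems by (intro smooth_upto_add Suc.IH smooth_pderivs)
        then show ?thesis using len snoc by (simp add: pderivs_append smooth_upto_def)
      qed
    qed
  qed
  then show ?thesis by (simp add: smooth_iff_upto)
qed

lemma pderivs_linear:
  assumes L: "bounded_linear L" and f: "smooth f"
  shows "pderivs js (\<lambda>x. L (f x)) = (\<lambda>x. L (pderivs js f x))"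
proof (induction js)
  case (Cons j js)
  show ?case
  proof
    fix x
    have "(pderivs js f has_derivative frechet_derivative (pderivs js f) (at x)) (at x)"
      using f by (auto simp: smooth_def frechet_derivative_works[symmetric])
    from frechet_derivative_at[OF bounded_linear.has_derivative[OF L this], symmetric]
    show "pderivs (j # js) (\<lambda>x. L (f x)) x = L (pderivs (j # js) f x)"
      using Cons by simp
  qed
qed auto

lemma smooth_linear:
  assumes L: "bounded_linear L" and f: "smooth f"
  shows "smooth (\<lambda>x. L (f x))"
  unfolding smooth_def pderivs_linear[OF assms]
  using bounded_linear.has_derivative[OF L] smooth_differentiable[OF f]
  unfolding differentiable_def by blast

section \<open>Supports and test functions\<close>

lemma pderivs_outside_supp: "x \<notin> supp f \<Longrightarrow> pderivs js f x = 0"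
proof (induction js arbitrary: x)
  case Nil
  then show ?case unfolding supp_def using closure_subset[of "{x. f x \<noteq> 0}"] by auto
next
  case (Cons j js)
  have "(pderivs js f has_derivative (\<lambda>_. 0)) (at x)"
    by (rule has_derivative_transform_within_open[of "\<lambda>_. 0" _ _ _ "- supp f"])
       (use Cons in \<open>auto simp: supp_def\<close>)
  from frechet_derivative_at[OF this, symmetric] show ?case by simp
qed

lemma supp_subset_closed: "(\<And>x. f x \<noteq> 0 \<Longrightarrow> x \<in> K) \<Longrightarrow> closed K \<Longrightarrow> supp f \<subseteq> K"
  unfolding supp_def by (rule closure_minimal) auto

lemma compact_supp_mono:
  assumes "\<And>x. f x \<noteq> 0 \<Longrightarrow> x \<in> K" "compact K"
  shows "compact (supp f)"
proof -
  have "supp f \<subseteq> K" using assms by (intro supp_subset_closed) (auto simp: compact_imp_closed)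
  then show ?thesis
    using assms by (metis supp_def closed_closure compact_Int_closed inf.absorb_iff2)
qed

lemma in_supp: "f x \<noteq> 0 \<Longrightarrow> x \<in> supp f"
  unfolding supp_def using closure_subset[of "{x. f x \<noteq> 0}"] by auto

lemma test_functions_add:
  assumes "f \<in> test_functions" "g \<in> test_functions"
  shows "(\<lambda>x. f x + g x) \<in> test_functions"
proof -
  have "compact (supp (\<lambda>x. f x + g x))"
    by (rule compact_supp_mono[of _ "supp f \<union> supp g"])
       (use assms in \<open>auto simp: test_functions_def in_supp\<close>, metis add.right_neutral add.left_neutral in_supp)
  then show ?thesis using assms by (auto simp: test_functions_def smooth_add)
qed

lemma test_functions_scale:
  assumes "f \<in> test_functions"
  shows "(\<lambda>x. a * f x) \<in> test_functions"
proof -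
  have "compact (supp (\<lambda>x. a * f x))"
    by (rule compact_supp_mono[of _ "supp f"]) (use assms in \<open>auto simp: test_functions_def in_supp\<close>)
  then show ?thesis using assms smooth_linear[OF bounded_linear_mult_right]
    by (auto simp: test_functions_def)
qed

lemma test_functions_mult:
  assumes "smooth \<psi>" "f \<in> test_functions"
  shows "(\<lambda>x. complex_of_real (\<psi> x) * f x) \<in> test_functions"
proof -
  have "compact (supp (\<lambda>x. complex_of_real (\<psi> x) * f x))"
    by (rule compact_supp_mono[of _ "supp f"]) (use assms in \<open>auto simp: test_functions_def in_supp\<close>)
  moreover have "smooth (\<lambda>x. \<psi> x *\<^sub>R f x)"
    using assms by (intro smooth_bilinear[OF bounded_bilinear_scaleR]) (auto simp: test_functions_def)
  ultimately show ?thesis by (simp add: test_functions_def scaleR_conv_of_real)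
qed

lemma test_functions_schwartz: "test_functions \<subseteq> schwartz"
proof
  fix f :: "real^'n::finite \<Rightarrow> complex" assume f: "f \<in> test_functions"
  then have sm: "smooth f" and comp: "compact (supp f)" by (auto simp: test_functions_def)
  have "\<exists>C. \<forall>x. (1 + norm x) ^ m * norm (pderivs js f x) \<le> C" for js m
  proof -
    have "continuous_on (supp f) (\<lambda>x. (1 + norm x) ^ m * norm (pderivs js f x))"
      by (intro continuous_intros smooth_continuous sm)
    then have "bounded ((\<lambda>x. (1 + norm x) ^ m * norm (pderivs js f x)) ` supp f)"
      by (intro compact_imp_bounded compact_continuous_image comp)
    then obtain C where C: "\<And>x. x \<in> supp f \<Longrightarrow> \<bar>(1 + norm x) ^ m * norm (pderivs js f x)\<bar> \<le> C"
      by (auto simp: bounded_iff)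
    have "(1 + norm x) ^ m * norm (pderivs js f x) \<le> max C 0" for x
      using C[of x] pderivs_outside_supp[of x f js] by (cases "x \<in> supp f") auto
    then show ?thesis by blast
  qed
  with sm show "f \<in> schwartz" by (simp add: schwartz_def)
qed

section \<open>Decay and the Fourier transform of Schwartz functions\<close>

lemma integrable_inverse_square: "integrable lborel (\<lambda>t::real. 1 / (1 + \<bar>t\<bar>)\<^sup>2)"
proof (rule Bochner_Integration.integrable_bound)
  show "integrable lborel (\<lambda>x::real. inverse (1 + x\<^sup>2))"
    using integrable_inverse_1_plus_square by (simp add: set_integrable_def)
  show "AE x in lborel. norm (1 / (1 + \<bar>x\<bar>)\<^sup>2) \<le> norm (inverse (1 + (x::real)\<^sup>2))"
  proof (rule AE_I2)
    fix x :: real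
    have "1 + x\<^sup>2 \<le> (1 + \<bar>x\<bar>)\<^sup>2" by (simp add: power2_eq_square algebra_simps)
    then have "1 / (1 + \<bar>x\<bar>)\<^sup>2 \<le> 1 / (1 + x\<^sup>2)"
      by (intro divide_left_mono mult_pos_pos) (auto simp: add_pos_nonneg)
    then show "norm (1 / (1 + \<bar>x\<bar>)\<^sup>2) \<le> norm (inverse (1 + x\<^sup>2))" by (simp add: inverse_eq_divide)
  qed
qed auto

lemma one_plus_norm_pos [simp]: "0 < 1 + norm x" "0 \<le> 1 + norm x" "1 + norm x \<noteq> 0" "1 \<le> 1 + norm x"
  by (simp_all add: add_pos_nonneg add_nonneg_eq_0_iff)

text \<open>The radial weight is dominated by a product of one-dimensional weights because each
  \<open>1 + \<bar>x $ j\<bar>\<close> is at most \<open>1 + norm x\<close>. Two powers per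
  coordinate give the exponent \<open>2 * CARD('n)\<close>.\<close>

lemma integrable_weight:
  assumes "2 * CARD('n) \<le> m"
  shows "integrable lborel (\<lambda>x::real^'n::finite. 1 / (1 + norm x) ^ m)"
proof (rule Bochner_Integration.integrable_bound)
  show "integrable lborel (\<lambda>x::real^'n. \<Prod>j\<in>UNIV. 1 / (1 + \<bar>x $ j\<bar>)\<^sup>2)"
    by (rule integrable_vec_prod) (rule integrable_inverse_square)
  show "AE x in lborel. norm (1 / (1 + norm x) ^ m) \<le> norm (\<Prod>j\<in>UNIV. 1 / (1 + \<bar>(x::real^'n) $ j\<bar>)\<^sup>2)"
  proof (rule AE_I2)
    fix x :: "real^'n"
    have "(\<Prod>j\<in>UNIV. (1 + \<bar>x $ j\<bar>)\<^sup>2) \<le> (\<Prod>j\<in>(UNIV::'n set). (1 + norm x)\<^sup>2)"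
      by (intro prod_mono conjI power_mono) (auto simp: component_le_norm_cart)
    also have "\<dots> = (1 + norm x) ^ (2 * CARD('n))" by (simp add: power_mult)
    also have "\<dots> \<le> (1 + norm x) ^ m" by (rule power_increasing[OF assms]) simp
    finally have "1 / (1 + norm x) ^ m \<le> 1 / (\<Prod>j\<in>UNIV. (1 + \<bar>x $ j\<bar>)\<^sup>2)"
      by (intro divide_left_mono mult_pos_pos prod_pos) (auto simp: add_pos_nonneg)
    then show "norm (1 / (1 + norm x) ^ m) \<le> norm (\<Prod>j\<in>UNIV. 1 / (1 + \<bar>x $ j\<bar>)\<^sup>2)"
      by (simp add: prod_dividef abs_prod prod_nonneg)
  qed
qed measurable

lemma schwartz_smooth: "f \<in> schwartz \<Longrightarrow> smooth f"
  by (simp add: schwartz_def)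

lemma schwartz_pderivs: "f \<in> schwartz \<Longrightarrow> pderivs ks f \<in> schwartz"
  by (simp add: schwartz_def smooth_pderivs pderivs_append[symmetric])

lemma schwartz_decay:
  assumes "f \<in> schwartz"
  obtains C where "C \<ge> 0" "\<And>x. norm (pderivs js f x) \<le> C * (1 / (1 + norm x) ^ m)"
proof -
  obtain C where "\<And>x. (1 + norm x) ^ m * norm (pderivs js f x) \<le> C"
    using assms unfolding schwartz_def by blast
  then have "norm (pderivs js f x) \<le> max C 0 * (1 / (1 + norm x) ^ m)" for x
    by (auto simp: field_simps intro: le_max_iff_disj[THEN iffD2])
  then show thesis by (intro that[of "max C 0"]) auto
qed

lemma schwartz_measurable [measurable]: "f \<in> schwartz \<Longrightarrow> f \<in> borel_measurable borel"
  by (intro borel_measurable_continuous_onI smooth_continuous0 schwartz_smooth)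

lemma schwartz_integrable:
  fixes f :: "real^'n::finite \<Rightarrow> complex"
  assumes f: "f \<in> schwartz"
  shows "integrable lborel f"
proof -
  obtain C where C: "C \<ge> 0" "\<And>x. norm (pderivs [] f x) \<le> C * (1 / (1 + norm x) ^ (2 * CARD('n)))"
    using schwartz_decay[OF f] by metis
  show ?thesis
    by (rule Bochner_Integration.integrable_bound[where f="\<lambda>x. C * (1 / (1 + norm x) ^ (2 * CARD('n)))"])
       (use C f in \<open>auto simp: integrable_weight simp del: times_divide_eq_right mult_1_right\<close>)
qed

section \<open>Derivatives become multiplication by the frequency\<close>

lemma vector_derivative_quotient:
  assumes "(f has_vector_derivative v) (at 0)"
  shows "((\<lambda>h. (f h - f 0) /\<^sub>R h) \<longlongrightarrow> v) (at 0)"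
proof -
  have "((\<lambda>h. norm (f (0 + h) - f 0 - h *\<^sub>R v) / norm h) \<longlongrightarrow> 0) (at 0)"
    using assms by (simp add: has_vector_derivative_def has_derivative_at)
  moreover have "norm (f (0 + h) - f 0 - h *\<^sub>R v) / norm h = norm ((f h - f 0) /\<^sub>R h - v)" if "h \<noteq> 0" for h
  proof -
    have "(f h - f 0) /\<^sub>R h - v = (f (0 + h) - f 0 - h *\<^sub>R v) /\<^sub>R h"
      using that by (simp add: scaleR_diff_right)
    then show ?thesis by (simp add: divide_inverse mult.commute)
  qed
  ultimately have "((\<lambda>h. norm ((f h - f 0) /\<^sub>R h - v)) \<longlongrightarrow> 0) (at 0)"
    by (elim Lim_transform_eventually) (simp add: eventually_at_filter)
  then show ?thesis using Lim_null tendsto_norm_zero_iff by blast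
qed

lemma directional_derivative:
  assumes "smooth f"
  shows "((\<lambda>t. f (x + t *\<^sub>R axis j 1)) has_vector_derivative pderivs [j] f (x + t *\<^sub>R axis j 1)) (at t within S)"
proof -
  let ?y = "x + t *\<^sub>R axis j 1"
  have f: "(f has_derivative frechet_derivative f (at ?y)) (at ?y)"
    using smooth_differentiable[OF assms, of "[]"] by (simp add: frechet_derivative_works[symmetric])
  have "((\<lambda>t. x + t *\<^sub>R axis j 1) has_derivative (\<lambda>h. h *\<^sub>R axis j 1)) (at t within S)"
    by (auto intro!: derivative_eq_intros)
  from has_derivative_compose[OF this f]
  have "((\<lambda>t. f (x + t *\<^sub>R axis j 1)) has_derivative (\<lambda>h. frechet_derivative f (at ?y) (h *\<^sub>R axis j 1))) (at t within S)" .
  moreover have "linear (frechet_derivative f (at ?y))"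
    using f by (rule has_derivative_linear)
  ultimately show ?thesis by (simp add: has_vector_derivative_def linear_scale)
qed

text \<open>Supplies the integrable majorant for difference quotients. A shift of length at most one
  changes \<open>1 + norm x\<close> by at most a factor of two, so the decay of the derivative on
  the segment passes to its starting point at the cost of \<open>2 ^ m\<close>.\<close>

lemma schwartz_increment:
  assumes f: "f \<in> schwartz"
  obtains C where "C \<ge> 0" "\<And>x t. \<bar>t\<bar> \<le> 1 \<Longrightarrow> norm (f (x + t *\<^sub>R axis j 1) - f x) \<le> \<bar>t\<bar> * (C * (1 / (1 + norm x) ^ m))"
proof -
  obtain C where C: "C \<ge> 0" "\<And>x. norm (pderivs [j] f x) \<le> C * (1 / (1 + norm x) ^ m)"
    using schwartz_decay[OF f] by metis
  have "norm (f (x + t *\<^sub>R axis j 1) - f (x + 0 *\<^sub>R axis j 1)) \<le> (C * 2 ^ m * (1 / (1 + norm x) ^ m)) * norm (t - 0)"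
    if t: "\<bar>t\<bar> \<le> 1" for x t
  proof (rule differentiable_bound[where S="{-1..1}"])
    fix s :: real assume s: "s \<in> {-1..1}"
    show "((\<lambda>t. f (x + t *\<^sub>R axis j 1)) has_derivative (\<lambda>h. h *\<^sub>R pderivs [j] f (x + s *\<^sub>R axis j 1))) (at s within {-1..1})"
      using directional_derivative[OF schwartz_smooth[OF f]] by (simp add: has_vector_derivative_def)
    have "norm x \<le> norm (x + s *\<^sub>R axis j 1) + norm (s *\<^sub>R axis j (1::real))"
      by (metis add_diff_cancel_right' norm_triangle_ineq4)
    also have "norm (s *\<^sub>R axis j (1::real)) \<le> 1" using s by (simp add: norm_axis_1 abs_le_iff)
    finally have *: "norm x \<le> norm (x + s *\<^sub>R axis j 1) + 1" by simp
    have "1 + nx \<le> 2 * (1 + N)" if "nx \<le> N + 1" "0 \<le> N" for nx N :: real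
      using that by simp
    from this[OF * norm_ge_zero] have "(1 + norm x) ^ m \<le> (2 * (1 + norm (x + s *\<^sub>R axis j 1))) ^ m"
      by (intro power_mono) auto
    then have "1 / (1 + norm (x + s *\<^sub>R axis j 1)) ^ m \<le> 2 ^ m * (1 / (1 + norm x) ^ m)"
      unfolding power_mult_distrib by (simp add: divide_simps mult.commute)
    then have "C * (1 / (1 + norm (x + s *\<^sub>R axis j 1)) ^ m) \<le> C * (2 ^ m * (1 / (1 + norm x) ^ m))"
      using C(1) by (rule mult_left_mono)
    with C(2)[of "x + s *\<^sub>R axis j 1"]
    have "norm (pderivs [j] f (x + s *\<^sub>R axis j 1)) \<le> C * 2 ^ m * (1 / (1 + norm x) ^ m)"
      by (simp only: mult.assoc)
    then show "onorm (\<lambda>h. h *\<^sub>R pderivs [j] f (x + s *\<^sub>R axis j 1)) \<le> C * 2 ^ m * (1 / (1 + norm x) ^ m)"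
      by (simp add: onorm_scaleR_left[OF bounded_linear_ident] onorm_id del: pderivs.simps)
  qed (use t in auto)
  then show thesis using C(1) by (intro that[of "C * 2 ^ m"]) (auto simp: mult_ac)
qed

text \<open>Boundary terms are avoided by computing the limit of the transformed difference
  quotients twice: under the integral by dominated convergence, and outside it from the fact that
  the transform of a translate is a modulation.\<close>

lemma fourier_pderivs:
  fixes f :: "real^'n::finite \<Rightarrow> complex"
  assumes f: "f \<in> schwartz"
  shows "fourier (pderivs [j] f) \<omega> = 2 * pi * \<i> * \<omega> $ j * fourier f \<omega>"
proof -
  define t :: "nat \<Rightarrow> real" where "t k = 1 / Suc k" for k
  have t0: "t k \<noteq> 0" "\<bar>t k\<bar> \<le> 1" for k by (auto simp: t_def)
  have tlim: "t \<longlonglongrightarrow> 0" unfolding t_def using LIMSEQ_inverse_real_of_nat by (simp add: inverse_eq_divide)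
  have tlim': "filterlim t (at 0) sequentially"
    using tlim t0 by (simp add: filterlim_at)
  let ?e = "axis j 1 :: real^'n"
  let ?c = "\<lambda>x. cis (- 2 * pi * (x \<bullet> \<omega>))"
  note [measurable] = schwartz_measurable[OF f] schwartz_measurable[OF schwartz_pderivs[OF f]]
  have sm: "smooth f" using f by (rule schwartz_smooth)
  obtain C where C: "C \<ge> 0" "\<And>x t. \<bar>t\<bar> \<le> 1 \<Longrightarrow> norm (f (x + t *\<^sub>R ?e) - f x) \<le> \<bar>t\<bar> * (C * (1 / (1 + norm x) ^ (2 * CARD('n))))"
    using schwartz_increment[OF f] by metis
  define q where "q k x = ((f (x + t k *\<^sub>R ?e) - f x) /\<^sub>R t k) * ?c x" for k x
  have "(\<lambda>k. LINT x|lborel. q k x) \<longlonglongrightarrow> (LINT x|lborel. pderivs [j] f x * ?c x)"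
  proof (rule integral_dominated_convergence[where w="\<lambda>x. C * (1 / (1 + norm x) ^ (2 * CARD('n)))"])
    show "integrable lborel (\<lambda>x::real^'n. C * (1 / (1 + norm x) ^ (2 * CARD('n))))"
      by (intro integrable_mult_right integrable_weight) simp
    show "AE x in lborel. norm (q k x) \<le> C * (1 / (1 + norm x) ^ (2 * CARD('n)))" for k
    proof (rule AE_I2)
      fix x
      have "norm (q k x) = norm (f (x + t k *\<^sub>R ?e) - f x) / \<bar>t k\<bar>"
        by (simp add: q_def norm_mult divide_inverse mult.commute)
      also have "\<dots> \<le> C * (1 / (1 + norm x) ^ (2 * CARD('n)))"
        using C(2)[OF t0(2)[of k], of x] t0(1)[of k] by (simp only: pos_divide_le_eq zero_less_abs_iff mult.commute[of _ "\<bar>t k\<bar>"] simp_thms)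
      finally show "norm (q k x) \<le> C * (1 / (1 + norm x) ^ (2 * CARD('n)))" .
    qed
    show "AE x in lborel. (\<lambda>k. q k x) \<longlonglongrightarrow> pderivs [j] f x * ?c x"
    proof (rule AE_I2)
      fix x
      have "((\<lambda>t. f (x + t *\<^sub>R ?e)) has_vector_derivative pderivs [j] f (x + 0 *\<^sub>R ?e)) (at 0)"
        by (rule directional_derivative[OF sm])
      then have "((\<lambda>h. (f (x + h *\<^sub>R ?e) - f x) /\<^sub>R h) \<longlongrightarrow> pderivs [j] f x) (at 0)"
        by (auto dest: vector_derivative_quotient)
      from filterlim_compose[OF this tlim']
      show "(\<lambda>k. q k x) \<longlonglongrightarrow> pderivs [j] f x * ?c x"
        unfolding q_def by (intro tendsto_mult tendsto_const)
    qed
  qed (auto simp: q_def simp del: pderivs.simps)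
  moreover have "(LINT x|lborel. q k x) = ((cis (2 * pi * t k * \<omega> $ j) - 1) /\<^sub>R t k) * fourier f \<omega>" for k
  proof -
    have i1: "integrable lborel (\<lambda>x. f x * ?c x)"
      by (intro integrable_mult_cis schwartz_integrable f) simp
    have i2: "integrable lborel (\<lambda>x. f (x + t k *\<^sub>R ?e) * ?c x)"
      using schwartz_integrable[OF f] integrable_translate[of f "- t k *\<^sub>R ?e"]
      by (intro integrable_mult_cis) auto
    have "(LINT x|lborel. f (x + t k *\<^sub>R ?e) * ?c x) = (LINT x|lborel. (\<lambda>y. f y * cis (- 2 * pi * ((y - t k *\<^sub>R ?e) \<bullet> \<omega>))) (x - (- t k *\<^sub>R ?e)))"
      by simp
    also have "\<dots> = (LINT y|lborel. f y * cis (- 2 * pi * ((y - t k *\<^sub>R ?e) \<bullet> \<omega>)))"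
      by (rule integral_translate) measurable
    also have "\<dots> = (LINT y|lborel. cis (2 * pi * t k * \<omega> $ j) * (f y * ?c y))"
      by (intro Bochner_Integration.integral_cong)
         (auto simp: cis_mult inner_diff_left inner_axis' algebra_simps)
    finally have s: "(LINT x|lborel. f (x + t k *\<^sub>R ?e) * ?c x) = cis (2 * pi * t k * \<omega> $ j) * fourier f \<omega>"
      by (simp add: fourier_def)
    have "(LINT x|lborel. q k x) = (LINT x|lborel. (f (x + t k *\<^sub>R ?e) * ?c x - f x * ?c x) /\<^sub>R t k)"
      unfolding q_def by (simp add: algebra_simps)
    also have "\<dots> = ((LINT x|lborel. f (x + t k *\<^sub>R ?e) * ?c x) - (LINT x|lborel. f x * ?c x)) /\<^sub>R t k"
      using i1 i2 by simp
    finally show ?thesis unfolding s by (simp add: fourier_def[of f] algebra_simps)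
  qed
  moreover have "(\<lambda>k. ((cis (2 * pi * t k * \<omega> $ j) - 1) /\<^sub>R t k) * fourier f \<omega>) \<longlonglongrightarrow> (2 * pi * \<i> * \<omega> $ j) * fourier f \<omega>"
  proof (intro tendsto_mult tendsto_const)
    have "((\<lambda>s. cis (2 * pi * s * \<omega> $ j)) has_vector_derivative (2 * pi * \<omega> $ j) *\<^sub>R (\<i> * cis (2 * pi * 0 * \<omega> $ j))) (at 0)"
      unfolding has_vector_derivative_def by (auto intro!: derivative_eq_intros simp: algebra_simps)
    then have "((\<lambda>h. (cis (2 * pi * h * \<omega> $ j) - 1) /\<^sub>R h) \<longlongrightarrow> 2 * pi * \<i> * \<omega> $ j) (at 0)"
      by (auto dest!: vector_derivative_quotient simp: scaleR_conv_of_real mult_ac)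
    from filterlim_compose[OF this tlim']
    show "(\<lambda>k. (cis (2 * pi * t k * \<omega> $ j) - 1) /\<^sub>R t k) \<longlonglongrightarrow> 2 * pi * \<i> * \<omega> $ j" .
  qed
  ultimately have "(\<lambda>k. LINT x|lborel. q k x) \<longlonglongrightarrow> (2 * pi * \<i> * \<omega> $ j) * fourier f \<omega>"
    "(\<lambda>k. LINT x|lborel. q k x) \<longlonglongrightarrow> fourier (pderivs [j] f) \<omega>"
    unfolding fourier_def[of "pderivs [j] f"] by (simp_all only:)
  then show ?thesis by (rule LIMSEQ_unique[symmetric])
qed

lemma fourier_pderivs_replicate:
  fixes f :: "real^'n::finite \<Rightarrow> complex"
  assumes f: "f \<in> schwartz"
  shows "fourier (pderivs (replicate k j) f) \<omega> = (2 * pi * \<i> * \<omega> $ j) ^ k * fourier f \<omega>"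
proof (induction k)
  case (Suc k)
  have "pderivs (replicate (Suc k) j) f = pderivs [j] (pderivs (replicate k j) f)" by simp
  then show ?case
    using fourier_pderivs[OF schwartz_pderivs[OF f, of "replicate k j"], of j \<omega>] Suc
    by (simp only: power_Suc mult.assoc)
qed simp

text \<open>The largest of 1 and the \<open>\<bar>x $ j\<bar>\<close> controls the norm, and its
  power is one of the summands. Only pure powers occur on the right, so repeated derivatives in a
  single direction are enough for \<open>fourier_decay\<close>.\<close>

lemma one_plus_norm_power_le:
  fixes x :: "real^'n::finite"
  shows "(1 + norm x) ^ k \<le> (1 + real CARD('n)) ^ k * (1 + (\<Sum>j\<in>UNIV. \<bar>x $ j\<bar> ^ k))"
proof -
  define M where "M = Max (insert 1 (range (\<lambda>j. \<bar>x $ j\<bar>)))"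
  have M1: "1 \<le> M" and Mj: "\<bar>x $ j\<bar> \<le> M" for j
    unfolding M_def by (auto simp del: Max_insert intro!: Max_ge)
  have "norm x \<le> (\<Sum>j\<in>UNIV. \<bar>x $ j\<bar>)" by (rule norm_le_l1_cart)
  also have "\<dots> \<le> (\<Sum>j\<in>(UNIV::'n set). M)" by (intro sum_mono Mj)
  finally have "1 + norm x \<le> (1 + real CARD('n)) * M" using M1 by (simp add: algebra_simps)
  then have "(1 + norm x) ^ k \<le> ((1 + real CARD('n)) * M) ^ k" by (intro power_mono) auto
  also have "\<dots> = (1 + real CARD('n)) ^ k * M ^ k" by (rule power_mult_distrib)
  also have "\<dots> \<le> (1 + real CARD('n)) ^ k * (1 + (\<Sum>j\<in>UNIV. \<bar>x $ j\<bar> ^ k))"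
  proof (rule mult_left_mono)
    have "M \<in> insert 1 (range (\<lambda>j. \<bar>x $ j\<bar>))" unfolding M_def by (rule Max_in) auto
    then consider "M = 1" | j where "M = \<bar>x $ j\<bar>" by auto
    then show "M ^ k \<le> 1 + (\<Sum>j\<in>UNIV. \<bar>x $ j\<bar> ^ k)"
    proof cases
      case 2
      have "\<bar>x $ j\<bar> ^ k \<le> (\<Sum>j\<in>UNIV. \<bar>x $ j\<bar> ^ k)" by (rule member_le_sum) auto
      then show ?thesis using 2 by simp
    qed (simp add: sum_nonneg)
  qed simp
  finally show ?thesis .
qed

lemma fourier_decay:
  fixes f :: "real^'n::finite \<Rightarrow> complex"
  assumes f: "f \<in> schwartz"
  obtains C where "C \<ge> 0" "\<And>\<omega>. norm (fourier f \<omega>) \<le> C * (1 / (1 + norm \<omega>) ^ k)"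
proof -
  define A where "A js = (LINT x|lborel. norm (pderivs js f x))" for js
  have A0: "A js \<ge> 0" for js by (simp add: A_def)
  define C where "C = (1 + real CARD('n)) ^ k * (A [] + (\<Sum>j\<in>UNIV. A (replicate k j)))"
  have "(1 + norm \<omega>) ^ k * norm (fourier f \<omega>) \<le> C" for \<omega>
  proof -
    have *: "\<bar>\<omega> $ j\<bar> ^ k * norm (fourier f \<omega>) \<le> A (replicate k j)" for j
    proof -
      have "\<bar>\<omega> $ j\<bar> ^ k \<le> \<bar>2 * pi * \<omega> $ j\<bar> ^ k"
        using pi_ge_two by (intro power_mono) (auto simp: abs_mult mult_le_cancel_right1)
      then have "\<bar>\<omega> $ j\<bar> ^ k * norm (fourier f \<omega>) \<le> \<bar>2 * pi * \<omega> $ j\<bar> ^ k * norm (fourier f \<omega>)"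
        by (rule mult_right_mono) simp
      also have "\<dots> = norm (fourier (pderivs (replicate k j) f) \<omega>)"
        by (simp add: fourier_pderivs_replicate[OF f] norm_mult norm_power abs_mult power_mult_distrib)
      also have "\<dots> \<le> A (replicate k j)" unfolding A_def by (rule norm_fourier_le)
      finally show ?thesis .
    qed
    have "(1 + norm \<omega>) ^ k * norm (fourier f \<omega>)
      \<le> (1 + real CARD('n)) ^ k * (1 + (\<Sum>j\<in>UNIV. \<bar>\<omega> $ j\<bar> ^ k)) * norm (fourier f \<omega>)"
      by (intro mult_right_mono one_plus_norm_power_le) simp
    also have "\<dots> = (1 + real CARD('n)) ^ k * (norm (fourier f \<omega>) + (\<Sum>j\<in>UNIV. \<bar>\<omega> $ j\<bar> ^ k * norm (fourier f \<omega>)))"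
      by (simp add: algebra_simps sum_distrib_left sum_distrib_right)
    also have "\<dots> \<le> C"
      unfolding C_def using norm_fourier_le(1)[of f \<omega>]
      by (intro mult_left_mono add_mono sum_mono *) (auto simp: A_def)
    finally show ?thesis .
  qed
  then have "norm (fourier f \<omega>) \<le> C * (1 / (1 + norm \<omega>) ^ k)" for \<omega>
    by (simp add: field_simps)
  moreover have "C \<ge> 0" by (auto simp: C_def intro!: mult_nonneg_nonneg add_nonneg_nonneg sum_nonneg A0)
  ultimately show thesis by (rule that[rotated])
qed

lemma fourier_schwartz_integrable:
  fixes f :: "real^'n::finite \<Rightarrow> complex"
  assumes f: "f \<in> schwartz"
  shows "integrable lborel (fourier f)"
proof -
  obtain C where C: "C \<ge> 0" "\<And>\<omega>. norm (fourier f \<omega>) \<le> C * (1 / (1 + norm \<omega>) ^ (2 * CARD('n)))"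
    using fourier_decay[OF f] by metis
  note [measurable] = schwartz_measurable[OF f]
  show ?thesis
    by (rule Bochner_Integration.integrable_bound[where f="\<lambda>x. C * (1 / (1 + norm x) ^ (2 * CARD('n)))"])
       (use C in \<open>auto simp: integrable_weight simp del: times_divide_eq_right mult_1_right\<close>)
qed

lemma schwartz_inversion:
  fixes f :: "real^'n::finite \<Rightarrow> complex"
  assumes f: "f \<in> schwartz"
  shows "inv_fourier (fourier f) = f"
proof
  fix x
  obtain C where C: "\<And>x. norm (pderivs [] f x) \<le> C * (1 / (1 + norm x) ^ 0)"
    using schwartz_decay[OF f] by metis
  show "inv_fourier (fourier f) x = f x"
    by (rule fourier_inversion[where B=C])
       (use C f in \<open>auto intro: schwartz_integrable fourier_schwartz_integrable smooth_continuous0 schwartz_smooth\<close>)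
qed

section \<open>Superpositions of translates\<close>

lemma integrable_translates:
  fixes h :: "real^'n::finite \<Rightarrow> complex" and \<kappa> :: "'m \<Rightarrow> complex"
  assumes M: "sigma_finite_measure M" and \<kappa>: "integrable M \<kappa>" and T [measurable]: "T \<in> borel_measurable M"
    and h: "integrable lborel h"
  shows "integrable (M \<Otimes>\<^sub>M lborel) (\<lambda>(m, x). \<kappa> m * h (x - T m))"
proof -
  interpret M: sigma_finite_measure M by fact
  interpret pair_sigma_finite M "lborel :: (real^'n) measure" ..
  have [measurable]: "h \<in> borel_measurable borel" "\<kappa> \<in> borel_measurable M" using h \<kappa> by auto
  show ?thesis
  proof (rule Fubini_integrable)
    show "integrable M (\<lambda>m. LINT x|lborel. norm (case (m, x) of (m, x) \<Rightarrow> \<kappa> m * h (x - T m)))"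
      using \<kappa> integral_translate[of "\<lambda>x. norm (h x)"] by (simp add: norm_mult)
    show "AE m in M. integrable lborel (\<lambda>x. case (m, x) of (m, x) \<Rightarrow> \<kappa> m * h (x - T m))"
      using h by (auto simp: integrable_translate intro!: AE_I2)
  qed measurable
qed

text \<open>Convolution with the image under \<open>T\<close> of the complex measure with density
  \<open>\<kappa>\<close>. The free parameter space covers both convolution with an integrable
  function (\<open>T = id\<close>) and the multipliers \<open>cutoff_quot\<close>, whose measures
  are parametrised by pairs \<open>(y, t)\<close>.\<close>

lemma superposition_of_translates:
  fixes h :: "real^'n::finite \<Rightarrow> complex" and \<kappa> :: "'m \<Rightarrow> complex"
  assumes M: "sigma_finite_measure M" and \<kappa>: "integrable M \<kappa>" and T [measurable]: "T \<in> borel_measurable M"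
    and h: "integrable lborel h"
  shows "integrable lborel (\<lambda>x. LINT m|M. \<kappa> m * h (x - T m))"
    and "(LINT x|lborel. norm (LINT m|M. \<kappa> m * h (x - T m))) \<le> (LINT m|M. norm (\<kappa> m)) * (LINT x|lborel. norm (h x))"
    and "fourier (\<lambda>x. LINT m|M. \<kappa> m * h (x - T m)) \<omega> = (LINT m|M. \<kappa> m * cis (- 2 * pi * (T m \<bullet> \<omega>))) * fourier h \<omega>"
proof -
  interpret M: sigma_finite_measure M by fact
  interpret pair_sigma_finite M "lborel :: (real^'n) measure" ..
  have [measurable]: "h \<in> borel_measurable borel" "\<kappa> \<in> borel_measurable M" using h \<kappa> by auto
  note int = integrable_translates[OF assms]
  show int': "integrable lborel (\<lambda>x. LINT m|M. \<kappa> m * h (x - T m))"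
    by (rule integrable_snd[OF int])
  have intn: "integrable (M \<Otimes>\<^sub>M lborel) (\<lambda>(m, x). norm (\<kappa> m * h (x - T m)))"
    using integrable_norm[OF int] by (simp add: case_prod_unfold)
  have "(LINT x|lborel. norm (LINT m|M. \<kappa> m * h (x - T m))) \<le> (LINT x|lborel. (LINT m|M. norm (\<kappa> m * h (x - T m))))"
    by (intro integral_mono integrable_norm int' integrable_snd[OF intn] integral_norm_bound)
  also have "\<dots> = (LINT m|M. (LINT x|lborel. norm (\<kappa> m * h (x - T m))))"
    using integral_fst[OF intn] integral_snd[OF intn] by simp
  also have "\<dots> = (LINT m|M. norm (\<kappa> m)) * (LINT x|lborel. norm (h x))"
    using integral_translate[of "\<lambda>x. norm (h x)"] by (simp add: norm_mult)
  finally show "(LINT x|lborel. norm (LINT m|M. \<kappa> m * h (x - T m))) \<le> (LINT m|M. norm (\<kappa> m)) * (LINT x|lborel. norm (h x))" .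
  let ?c = "\<lambda>x. cis (- 2 * pi * (x \<bullet> \<omega>))"
  have intc: "integrable (M \<Otimes>\<^sub>M lborel) (\<lambda>(m, x). \<kappa> m * h (x - T m) * ?c x)"
    using integrable_mult_cis[OF int, of "\<lambda>(m, x). - 2 * pi * (x \<bullet> \<omega>)"] by (simp add: case_prod_unfold)
  have tr: "(LINT x|lborel. h (x - a) * ?c x) = ?c a * fourier h \<omega>" for a
  proof -
    have "(LINT x|lborel. h (x - a) * ?c x) = (LINT x|lborel. (\<lambda>y. h y * ?c (y + a)) (x - a))" by simp
    also have "\<dots> = (LINT y|lborel. h y * ?c (y + a))" by (rule integral_translate) measurable
    also have "\<dots> = (LINT y|lborel. ?c a * (h y * ?c y))"
      by (intro Bochner_Integration.integral_cong) (auto simp: cis_mult inner_add_left algebra_simps)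
    finally show ?thesis by (simp add: fourier_def)
  qed
  have "fourier (\<lambda>x. LINT m|M. \<kappa> m * h (x - T m)) \<omega> = (LINT x|lborel. (LINT m|M. \<kappa> m * h (x - T m) * ?c x))"
    by (simp add: fourier_def)
  also have "\<dots> = (LINT m|M. (LINT x|lborel. \<kappa> m * h (x - T m) * ?c x))"
    using integral_fst[OF intc] integral_snd[OF intc] by simp
  also have "\<dots> = (LINT m|M. \<kappa> m * (?c (T m) * fourier h \<omega>))"
    by (simp only: mult.assoc[of "\<kappa> _"] integral_mult_right_zero tr)
  finally show "fourier (\<lambda>x. LINT m|M. \<kappa> m * h (x - T m)) \<omega> = (LINT m|M. \<kappa> m * ?c (T m)) * fourier h \<omega>"
    by (simp add: mult.assoc[symmetric])
qed

text \<open>The inverse transform of the product is the convolution of \<open>g\<close> with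
  \<open>inv_fourier \<psi>\<close>, so this is Young's inequality on L^1.\<close>

lemma inv_fourier_mult_bound:
  fixes \<psi> g :: "real^'n::finite \<Rightarrow> complex"
  assumes \<psi>: "integrable lborel \<psi>" and K: "integrable lborel (inv_fourier \<psi>)" and g: "integrable lborel g"
  shows "integrable lborel (inv_fourier (\<lambda>\<omega>. \<psi> \<omega> * fourier g \<omega>))"
    and "(LINT x|lborel. norm (inv_fourier (\<lambda>\<omega>. \<psi> \<omega> * fourier g \<omega>) x))
      \<le> (LINT x|lborel. norm (inv_fourier \<psi> x)) * (LINT x|lborel. norm (g x))"
proof -
  have *: "inv_fourier (\<lambda>\<omega>. \<psi> \<omega> * fourier g \<omega>) x = (LINT y|lborel. g y * inv_fourier \<psi> (x - id y))" for x
  proof -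
    have "inv_fourier (\<lambda>\<omega>. \<psi> \<omega> * fourier g \<omega>) x =
      (LINT \<omega>|lborel. (\<psi> \<omega> * cis (2 * pi * (x \<bullet> \<omega>))) * (LINT y|lborel. g y * cis (- 2 * pi * (y \<bullet> \<omega>))))"
      by (simp add: inv_fourier_def fourier_def mult_ac)
    also have "\<dots> = (LINT y|lborel. g y * (LINT \<omega>|lborel. (\<psi> \<omega> * cis (2 * pi * (x \<bullet> \<omega>))) * cis (- 2 * pi * (y \<bullet> \<omega>))))"
      by (rule lborel_pair.Fubini_kernel) (auto intro!: integrable_mult_cis \<psi> g)
    also have "\<dots> = (LINT y|lborel. g y * inv_fourier \<psi> (x - id y))"
      by (simp add: inv_fourier_def mult.assoc cis_mult inner_diff_left algebra_simps)
    finally show ?thesis .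
  qed
  note sup = superposition_of_translates[OF sigma_finite_lborel g _ K, of id, unfolded *[symmetric]]
  show "integrable lborel (inv_fourier (\<lambda>\<omega>. \<psi> \<omega> * fourier g \<omega>))"
    using sup(1) by simp
  show "(LINT x|lborel. norm (inv_fourier (\<lambda>\<omega>. \<psi> \<omega> * fourier g \<omega>) x))
      \<le> (LINT x|lborel. norm (inv_fourier \<psi> x)) * (LINT x|lborel. norm (g x))"
    using sup(2) by (simp add: mult.commute)
qed

section \<open>A frequency cutoff\<close>

text \<open>Squaring \<open>1 - t\<^sup>2\<close> makes the function continuously differentiable
  across the endpoints, which gives a transform of order \<open>1 / \<bar>y\<bar> ^ 3\<close>: two
  powers for integrability and one for the coordinate factor in Hadamard's lemma.\<close>

definition bump :: "real \<Rightarrow> real" where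
  "bump t = indicator {-1..1} t * (1 - t\<^sup>2)\<^sup>2"

definition bump_ker :: "real \<Rightarrow> complex" where
  "bump_ker y = (LINT t|lborel. complex_of_real (bump t) * cis (2 * pi * (y * t)))"

lemma bump_alt: "bump t = (max 0 (1 - t\<^sup>2))\<^sup>2"
proof (cases "\<bar>t\<bar> \<le> 1")
  case True
  then have "t\<^sup>2 \<le> 1" by (simp add: abs_square_le_1)
  then show ?thesis using True by (simp add: bump_def abs_le_iff)
next
  case False
  then have "\<not> t\<^sup>2 \<le> 1" by (simp add: abs_square_le_1)
  moreover have "t \<notin> {-1..1}" using False by auto
  ultimately show ?thesis by (simp add: bump_def)
qed

lemma bump_continuous: "continuous_on A bump"
  unfolding bump_alt[abs_def] by (intro continuous_intros)

lemma bump_measurable [measurable]: "bump \<in> borel_measurable borel"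
  by (intro borel_measurable_continuous_onI bump_continuous)

lemma bump_bounds: "0 \<le> bump t" "bump t \<le> 1"
proof -
  show "0 \<le> bump t" by (simp add: bump_def)
  have "(max 0 (1 - t\<^sup>2))\<^sup>2 \<le> 1\<^sup>2" by (intro power_mono) auto
  then show "bump t \<le> 1" by (simp add: bump_alt)
qed

lemma bump_le_indicator: "bump t \<le> indicator {-1..1} t"
  using bump_bounds[of t] by (auto simp: bump_def split: split_indicator)

lemma bump_integrable: "integrable lborel bump"
proof (rule Bochner_Integration.integrable_bound)
  show "integrable lborel (indicator {-1..1::real} :: real \<Rightarrow> real)"
    by (simp add: integrable_indicator_iff)
qed (use bump_le_indicator bump_bounds in \<open>auto\<close>)

lemma bump_ker_small: "norm (bump_ker y) \<le> 2"
proof -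
  have "norm (bump_ker y) \<le> (LINT t|lborel. norm (complex_of_real (bump t) * cis (2 * pi * (y * t))))"
    unfolding bump_ker_def by (rule integral_norm_bound)
  also have "\<dots> = (LINT t|lborel. bump t)" using bump_bounds by (simp add: norm_mult)
  also have "\<dots> \<le> (LINT t|lborel. indicator {-1..1::real} t)"
    by (intro integral_mono bump_integrable bump_le_indicator) (simp add: integrable_indicator_iff)
  finally show ?thesis by simp
qed

text \<open>Repeated integration by parts: the boundary terms of \<open>p\<close> and \<open>p'\<close> vanish at \<open>\<plusminus>1\<close>, where \<open>p = (1 - t\<^sup>2)\<^sup>2\<close>.\<close>

lemma bump_ker_large:
  assumes y: "\<bar>y\<bar> \<ge> 1" shows "norm (bump_ker y) \<le> 112 / \<bar>y\<bar> ^ 3"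
proof -
  define a where "a = 2 * pi * y"
  have a: "\<bar>y\<bar> \<le> \<bar>a\<bar>" using pi_ge_two by (simp add: a_def abs_mult mult_le_cancel_right1)
  then have a0: "a \<noteq> 0" and a1: "1 \<le> \<bar>a\<bar>" using y by auto
  define c where "c = \<i> * complex_of_real a"
  have c0: "c \<noteq> 0" and nc: "norm c = \<bar>a\<bar>" using a0 by (auto simp: c_def norm_mult)
  \<comment> \<open>With \<open>p = (1 - t\<^sup>2)\<^sup>2\<close> this is the alternating sum
    \<open>p / c - p' / c ^ 2 + p'' / c ^ 3 - ...\<close>. It solves \<open>r' + c * r = p\<close>,
    so \<open>F\<close> is an antiderivative of the integrand.\<close>
  define r where "r t = (1 - t\<^sup>2)\<^sup>2 / c - (4 * t ^ 3 - 4 * t) / c ^ 2 + (12 * t\<^sup>2 - 4) / c ^ 3 - 24 * t / c ^ 4 + 24 / c ^ 5"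
    for t :: complex
  define F where "F t = r (of_real t) * cis (a * t)" for t :: real
  have der: "(F has_vector_derivative of_real ((1 - t\<^sup>2)\<^sup>2) * cis (a * t)) (at t within {-1..1})" for t
  proof -
    define r' where "r' = (- 4 * of_real t * (1 - (of_real t)\<^sup>2)) / c - (12 * (of_real t)\<^sup>2 - 4) / c ^ 2 + 24 * of_real t / c ^ 3 - 24 / c ^ 4"
    have 1: "(r has_field_derivative r') (at (of_real t))"
      unfolding r_def[abs_def] r'_def using c0
      by (auto intro!: derivative_eq_intros simp: field_simps power2_eq_square power3_eq_cube)
    have 2: "((\<lambda>t. r (of_real t)) has_vector_derivative r') (at t within {-1..1})"
      using has_vector_derivative_real_field[OF 1] .
    have 3: "((\<lambda>t. cis (a * t)) has_vector_derivative c * cis (a * t)) (at t within {-1..1})"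
      unfolding has_vector_derivative_def c_def
      by (auto intro!: derivative_eq_intros simp: scaleR_conv_of_real algebra_simps)
    have 4: "r (of_real t) * c + r' = of_real ((1 - t\<^sup>2)\<^sup>2)"
      unfolding r_def r'_def using c0
      by (simp add: field_simps power2_eq_square eval_nat_numeral)
    show ?thesis
      unfolding F_def[abs_def] 4[symmetric]
      using has_vector_derivative_mult[OF 2 3] by (simp add: algebra_simps)
  qed
  have "bump_ker y = (LINT t|lborel. indicator {-1..1} t *\<^sub>R (of_real ((1 - t\<^sup>2)\<^sup>2) * cis (a * t)))"
    unfolding bump_ker_def bump_def a_def
    by (intro Bochner_Integration.integral_cong) (auto simp: scaleR_conv_of_real mult_ac split: split_indicator)
  also have "\<dots> = F 1 - F (-1)"
  proof (rule integral_FTC_Icc)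
    show "continuous_on {-1..1} (\<lambda>t. of_real ((1 - t\<^sup>2)\<^sup>2) * cis (a * t))"
      by (intro continuous_intros)
  qed (simp, rule der)
  finally have le: "norm (bump_ker y) \<le> norm (F 1) + norm (F (-1))" by (simp add: norm_triangle_ineq4)
  \<comment> \<open>At the endpoints \<open>p''\<close> is 8 and the next two derivatives have
    absolute value 24; since \<open>\<bar>a\<bar>\<close> is at least one, all three terms are
    compared with the cubic one, and 8 + 24 + 24 = 56.\<close>
  have *: "norm (F s) \<le> 56 / \<bar>a\<bar> ^ 3" if "s = 1 \<or> s = -1" for s
  proof -
    have "norm (F s) = norm (r (of_real s))" by (simp add: F_def norm_mult)
    also have "r (of_real s) = 8 / c ^ 3 - 24 * of_real s / c ^ 4 + 24 / c ^ 5" using that by (auto simp: r_def)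
    also have "norm \<dots> \<le> norm (8 / c ^ 3) + norm (24 * of_real s / c ^ 4) + norm (24 / c ^ 5)"
      by (intro order_trans[OF norm_triangle_ineq] add_mono norm_triangle_ineq4 order_refl)
    also have "\<dots> = 8 / \<bar>a\<bar> ^ 3 + 24 / \<bar>a\<bar> ^ 4 + 24 / \<bar>a\<bar> ^ 5"
      using that by (auto simp: norm_divide norm_mult norm_power nc)
    also have "\<dots> \<le> 8 / \<bar>a\<bar> ^ 3 + 24 / \<bar>a\<bar> ^ 3 + 24 / \<bar>a\<bar> ^ 3"
      using a1 by (intro add_mono divide_left_mono power_increasing) auto
    finally show ?thesis by simp
  qed
  have "norm (F 1) \<le> 56 / \<bar>a\<bar> ^ 3" "norm (F (-1)) \<le> 56 / \<bar>a\<bar> ^ 3" by (rule *; simp)+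
  with le have "norm (bump_ker y) \<le> 112 / \<bar>a\<bar> ^ 3" by simp
  also have "\<dots> \<le> 112 / \<bar>y\<bar> ^ 3" using y a by (intro divide_left_mono power_mono) auto
  finally show ?thesis .
qed

text \<open>For \<open>\<bar>y\<bar> \<ge> 1\<close> passing from \<open>\<bar>y\<bar>\<close> to
  \<open>1 + \<bar>y\<bar>\<close> costs \<open>2 ^ 3\<close>, whence 896 = 8 * 112; for smaller
  \<open>y\<close> the trivial bound 2 is far below 112.\<close>

lemma bump_ker_decay: "norm (bump_ker y) \<le> 896 / (1 + \<bar>y\<bar>) ^ 3"
proof (cases "\<bar>y\<bar> \<ge> 1")
  case True
  have "(1 + \<bar>y\<bar>) ^ 3 \<le> (2 * \<bar>y\<bar>) ^ 3" using True by (intro power_mono) auto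
  then have "112 / \<bar>y\<bar> ^ 3 \<le> 896 / (1 + \<bar>y\<bar>) ^ 3" using True by (simp add: power_mult_distrib field_simps)
  then show ?thesis using bump_ker_large[OF True] by linarith
next
  case False
  then have "(1 + \<bar>y\<bar>) ^ 3 \<le> 2 ^ 3" by (intro power_mono) auto
  then have "2 \<le> 896 / (1 + \<bar>y\<bar>) ^ 3" by (simp add: pos_le_divide_eq add_pos_nonneg)
  then show ?thesis using bump_ker_small[of y] by linarith
qed

text \<open>A product instead of a radial function, so that the inverse transform factorises into
  one-dimensional ones.\<close>

definition cutoff :: "real^'n::finite \<Rightarrow> complex" where
  "cutoff \<omega> = (\<Prod>j\<in>UNIV. complex_of_real (bump (\<omega> $ j)))"

definition cutoff_ker :: "real^'n::finite \<Rightarrow> complex" where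
  "cutoff_ker = inv_fourier cutoff"

lemma cutoff_0: "cutoff 0 = 1"
  by (simp add: cutoff_def bump_def)

lemma cutoff_eq_0:
  fixes \<omega> :: "real^'n::finite"
  assumes "real CARD('n) \<le> norm \<omega>"
  shows "cutoff \<omega> = 0"
proof -
  have "\<exists>j. 1 \<le> \<bar>\<omega> $ j\<bar>"
  proof (rule ccontr)
    assume "\<not> ?thesis"
    then have "(\<Sum>j\<in>UNIV. \<bar>\<omega> $ j\<bar>) < (\<Sum>j\<in>(UNIV::'n set). 1)"
      by (intro sum_strict_mono) (auto simp: not_le)
    then show False using norm_le_l1_cart[of \<omega>] assms by simp
  qed
  then obtain j where j: "1 \<le> \<bar>\<omega> $ j\<bar>" ..
  then have "1 \<le> (\<omega> $ j)\<^sup>2" using abs_square_less_1 not_le by blast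
  then have "bump (\<omega> $ j) = 0" by (simp add: bump_alt)
  then show ?thesis by (auto simp: cutoff_def)
qed

lemma cutoff_continuous: "continuous_on A (cutoff :: real^'n::finite \<Rightarrow> complex)"
  unfolding cutoff_def[abs_def]
  by (intro continuous_intros continuous_on_compose2[OF bump_continuous[of UNIV]]) auto

lemma cutoff_measurable [measurable]: "(cutoff :: real^'n::finite \<Rightarrow> complex) \<in> borel_measurable borel"
  by (intro borel_measurable_continuous_onI cutoff_continuous)

lemma cutoff_ker_measurable [measurable]: "(cutoff_ker :: real^'n::finite \<Rightarrow> complex) \<in> borel_measurable borel"
  unfolding cutoff_ker_def by measurable

lemma cutoff_integrable: "integrable lborel (cutoff :: real^'n::finite \<Rightarrow> complex)"
  unfolding cutoff_def[abs_def]
  by (rule integrable_vec_prod) (auto simp: bump_integrable)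

lemma cutoff_ker_prod: "cutoff_ker (y :: real^'n::finite) = (\<Prod>j\<in>UNIV. bump_ker (y $ j))"
proof -
  have "cutoff_ker y = (LINT \<omega>|lborel. (\<Prod>j\<in>UNIV. (\<lambda>t. complex_of_real (bump t) * cis (2 * pi * (y $ j * t))) (\<omega> $ j)))"
    unfolding cutoff_ker_def inv_fourier_def cutoff_def cis_inner_vec by (simp add: prod.distrib)
  also have "\<dots> = (\<Prod>j\<in>UNIV. bump_ker (y $ j))"
    unfolding bump_ker_def by (rule integral_vec_prod) (intro integrable_mult_cis, auto simp: bump_integrable)
  finally show ?thesis .
qed

text \<open>Of the three powers in each coordinate two are kept for integrability. The third is
  bounded by one except in coordinate \<open>i\<close>, where it pays for the factor on the
  left.\<close>

lemma cutoff_ker_decay: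
  "(1 + \<bar>y $ i\<bar>) * norm (cutoff_ker (y :: real^'n::finite)) \<le> (\<Prod>j\<in>UNIV. 896 * (1 / (1 + \<bar>y $ j\<bar>)\<^sup>2))"
proof -
  have "norm (cutoff_ker y) \<le> (\<Prod>j\<in>UNIV. 896 / (1 + \<bar>y $ j\<bar>) ^ 3)"
    unfolding cutoff_ker_prod prod_norm[symmetric] by (intro prod_mono) (auto simp: bump_ker_decay)
  also have "\<dots> = (\<Prod>j\<in>UNIV. 896 * (1 / (1 + \<bar>y $ j\<bar>)\<^sup>2)) * (\<Prod>j\<in>UNIV. 1 / (1 + \<bar>y $ j\<bar>))"
    unfolding prod.distrib[symmetric] by (intro prod.cong) (auto simp: power2_eq_square power3_eq_cube)
  also have "(\<Prod>j\<in>UNIV. 1 / (1 + \<bar>y $ j\<bar>)) \<le> 1 / (1 + \<bar>y $ i\<bar>)"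
  proof -
    have "(\<Prod>j\<in>UNIV. 1 / (1 + \<bar>y $ j\<bar>)) = 1 / (1 + \<bar>y $ i\<bar>) * (\<Prod>j\<in>UNIV - {i}. 1 / (1 + \<bar>y $ j\<bar>))"
      by (rule prod.remove) auto
    also have "\<dots> \<le> 1 / (1 + \<bar>y $ i\<bar>)"
      by (intro mult_left_le prod_le_1) (auto simp: divide_le_eq_1 add_pos_nonneg)
    finally show ?thesis .
  qed
  finally have "norm (cutoff_ker y) \<le> (\<Prod>j\<in>UNIV. 896 * (1 / (1 + \<bar>y $ j\<bar>)\<^sup>2)) * (1 / (1 + \<bar>y $ i\<bar>))"
    by (simp add: mult_left_mono prod_nonneg)
  then show ?thesis by (simp add: pos_le_divide_eq add_pos_nonneg mult.commute)
qed

lemma cutoff_ker_integrable: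
  shows "integrable lborel (cutoff_ker :: real^'n::finite \<Rightarrow> complex)"
    and "integrable lborel (\<lambda>y::real^'n::finite. cutoff_ker y * complex_of_real (y $ i))"
proof -
  let ?B = "\<lambda>y::real^'n. \<Prod>j\<in>UNIV. 896 * (1 / (1 + \<bar>y $ j\<bar>)\<^sup>2)"
  have B: "integrable lborel ?B"
    by (rule integrable_vec_prod) (intro integrable_mult_right integrable_inverse_square)
  have B0: "0 \<le> ?B y" for y by (intro prod_nonneg) auto
  have le: "norm (cutoff_ker y) \<le> ?B y" "\<bar>y $ i\<bar> * norm (cutoff_ker y) \<le> ?B y" for y and i
  proof -
    have "1 * norm (cutoff_ker y) \<le> (1 + \<bar>y $ i\<bar>) * norm (cutoff_ker y)"
      "\<bar>y $ i\<bar> * norm (cutoff_ker y) \<le> (1 + \<bar>y $ i\<bar>) * norm (cutoff_ker y)"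
      by (intro mult_right_mono; simp)+
    with cutoff_ker_decay[of y i] show "norm (cutoff_ker y) \<le> ?B y" "\<bar>y $ i\<bar> * norm (cutoff_ker y) \<le> ?B y"
      by linarith+
  qed
  show "integrable lborel (cutoff_ker :: real^'n \<Rightarrow> complex)"
    by (rule Bochner_Integration.integrable_bound[OF B])
       (use le(1) B0 in \<open>auto simp: abs_of_nonneg simp del: mult_1_right times_divide_eq_right\<close>)
  show "integrable lborel (\<lambda>y::real^'n. cutoff_ker y * complex_of_real (y $ i))"
    by (rule Bochner_Integration.integrable_bound[OF B])
       (use le(2) B0 in \<open>auto simp: norm_mult mult.commute abs_of_nonneg simp del: mult_1_right times_divide_eq_right\<close>)
qed

text \<open>\<open>cutoff\<close> is not a Schwartz function, so inversion is applied through
  integrability of its transform, which is the reflected kernel.\<close>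

lemma fourier_cutoff_ker: "fourier cutoff_ker \<omega> = cutoff (\<omega> :: real^'n::finite)"
proof -
  have "fourier cutoff x = cutoff_ker (- x)" for x :: "real^'n"
    unfolding cutoff_ker_def inv_fourier_eq by simp
  then have "fourier cutoff = (\<lambda>x::real^'n. cutoff_ker (- x))" by (rule ext)
  then have "integrable lborel (fourier (cutoff :: real^'n \<Rightarrow> complex))"
    using cutoff_ker_integrable(1) integrable_uminus[of "cutoff_ker :: real^'n \<Rightarrow> complex"] by simp
  then have "inv_fourier (fourier cutoff) \<omega> = cutoff \<omega>"
  proof (rule fourier_inversion[OF cutoff_integrable _ cutoff_continuous])
    show "norm (cutoff y) \<le> 1" for y :: "real^'n"
      unfolding cutoff_def prod_norm[symmetric] using bump_bounds by (intro prod_le_1) auto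
  qed
  then show ?thesis unfolding cutoff_ker_def by (simp add: fourier_inv_fourier_swap)
qed

subsection \<open>Factoring \<open>1 - cutoff\<close>\<close>

text \<open>The multipliers of Hadamard's lemma
  \<open>1 - cutoff \<eta> = (\<Sum>j. 2 * pi * \<i> * \<eta> $ j * cutoff_quot j \<eta>)\<close>; they are Fourier transforms of finite
  measures, so they act boundedly on \<open>L\<^sup>1\<close>, and rescaling does not change the bound.\<close>

definition quot_density :: "'n \<Rightarrow> (real^'n::finite) \<times> real \<Rightarrow> complex" where
  "quot_density j = (\<lambda>(y, t). cutoff_ker y * complex_of_real (y $ j) * indicator {0..1} t)"

definition cutoff_quot :: "'n \<Rightarrow> real^'n::finite \<Rightarrow> complex" where
  "cutoff_quot j \<eta> = (LINT (y, t)|lborel. quot_density j (y, t) * cis (- 2 * pi * (t * (y \<bullet> \<eta>))))"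

lemma quot_density_integrable: "integrable lborel (quot_density j)"
proof -
  have "integrable (lborel \<Otimes>\<^sub>M lborel) (quot_density j)"
  proof (rule lborel_pair.Fubini_integrable)
    have [measurable]: "(\<lambda>y::real^'a. y $ j) \<in> borel_measurable borel" by simp
    show "quot_density j \<in> borel_measurable (lborel \<Otimes>\<^sub>M lborel)"
      unfolding quot_density_def by measurable
    have "integrable lborel (\<lambda>y. norm (cutoff_ker y * complex_of_real (y $ j)))"
      by (intro integrable_norm cutoff_ker_integrable)
    moreover have "(LINT t|lborel. norm (quot_density j (y, t))) = norm (cutoff_ker y * complex_of_real (y $ j))" for y
    proof -
      have "(LINT t|lborel. norm (quot_density j (y, t))) = (LINT t|lborel. norm (cutoff_ker y * complex_of_real (y $ j)) * indicator {0..1::real} t)"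
        by (intro Bochner_Integration.integral_cong) (auto simp: quot_density_def norm_mult split: split_indicator)
      then show ?thesis by simp
    qed
    ultimately show "integrable lborel (\<lambda>y. LINT t|lborel. norm (quot_density j (y, t)))" by simp
    show "AE y in lborel. integrable lborel (\<lambda>t. quot_density j (y, t))"
    proof (rule AE_I2)
      fix y
      have "integrable lborel (indicator {0..1::real} :: real \<Rightarrow> real)" by (simp add: integrable_indicator_iff)
      then have "integrable lborel (\<lambda>t. complex_of_real (indicator {0..1::real} t))" by simp
      then have "integrable lborel (\<lambda>t. cutoff_ker y * complex_of_real (y $ j) * complex_of_real (indicator {0..1::real} t))"
        by (rule integrable_mult_right)
      moreover have "complex_of_real (indicator {0..1} t) = indicator {0..1} t" for t :: real
        by (simp split: split_indicator)
      ultimately show "integrable lborel (\<lambda>t. quot_density j (y, t))"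
        by (simp add: quot_density_def)
    qed
  qed
  then show ?thesis by (simp add: lborel_prod)
qed

text \<open>The one-dimensional core of Hadamard's lemma: the increment of \<open>cis\<close> along
  the segment from 0 to \<open>- s\<close> is the integral of its derivative.\<close>

lemma one_minus_cis:
  "(LINT t|lborel. indicator {0..1::real} t * (\<i> * complex_of_real s * cis (- (t * s)))) = 1 - cis (- s)"
proof -
  have "(LINT t|lborel. indicator {0..1::real} t *\<^sub>R (\<i> * complex_of_real s * cis (- (t * s)))) = - cis (- (1 * s)) - (- cis (- (0 * s)))"
  proof (rule integral_FTC_Icc)
    show "((\<lambda>t. - cis (- (t * s))) has_vector_derivative \<i> * complex_of_real s * cis (- (t * s))) (at t within {0..1})" for t
      unfolding has_vector_derivative_def
      by (auto intro!: derivative_eq_intros simp: scaleR_conv_of_real algebra_simps)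
  qed (auto intro!: continuous_intros)
  also have "(LINT t|lborel. indicator {0..1::real} t *\<^sub>R (\<i> * complex_of_real s * cis (- (t * s))))
     = (LINT t|lborel. indicator {0..1::real} t * (\<i> * complex_of_real s * cis (- (t * s))))"
    by (intro Bochner_Integration.integral_cong) (auto split: split_indicator)
  finally show ?thesis by simp
qed

text \<open>Since \<open>cutoff 0 = 1\<close>, the left side is the integral of
  \<open>cutoff_ker y * (1 - cis (- (2 * pi * (y \<bullet> \<eta>))))\<close>. Expanding the bracket
  by \<open>one_minus_cis\<close> produces the factor \<open>y \<bullet> \<eta>\<close>; splitting
  it into coordinates leaves \<open>\<eta> $ j\<close> outside and puts \<open>y $ j\<close> into
  the density.\<close>

lemma cutoff_quot:
  fixes \<eta> :: "real^'n::finite"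
  shows "1 - cutoff \<eta> = (\<Sum>j\<in>UNIV. 2 * pi * \<i> * \<eta> $ j * cutoff_quot j \<eta>)"
proof -
  let ?c = "\<lambda>y t. cis (- 2 * pi * (t * (y \<bullet> \<eta>)))"
  have pw: "(\<Sum>j\<in>UNIV. 2 * pi * \<i> * \<eta> $ j * (quot_density j (y, t) * ?c y t)) =
    cutoff_ker y * (indicator {0..1} t * (\<i> * complex_of_real (2 * pi * (y \<bullet> \<eta>)) * cis (- (t * (2 * pi * (y \<bullet> \<eta>))))))" for y t
  proof -
    define c where "c = ?c y t"
    have c: "cis (- (t * (2 * pi * (y \<bullet> \<eta>)))) = c" by (simp add: c_def mult_ac)
    have "complex_of_real (y \<bullet> \<eta>) = (\<Sum>j\<in>UNIV. complex_of_real (y $ j) * complex_of_real (\<eta> $ j))"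
      by (simp add: inner_vec_def)
    then show ?thesis
      unfolding c c_def[symmetric] of_real_mult
      by (simp add: quot_density_def sum_distrib_left sum_distrib_right mult_ac)
  qed
  have int: "integrable (lborel \<Otimes>\<^sub>M lborel) (\<lambda>(y, t). 2 * pi * \<i> * \<eta> $ j * (quot_density j (y, t) * ?c y t))" for j
  proof -
    have "integrable lborel (\<lambda>z. quot_density j z * (\<lambda>(y, t). ?c y t) z)"
      unfolding case_prod_unfold by (intro integrable_mult_cis quot_density_integrable) (simp add: lborel_prod[symmetric])
    then have "integrable lborel (\<lambda>z. 2 * pi * \<i> * \<eta> $ j * (quot_density j z * (\<lambda>(y, t). ?c y t) z))"
      by (rule integrable_mult_right)
    then show ?thesis by (simp add: lborel_prod case_prod_unfold)
  qed
  have "(\<Sum>j\<in>UNIV. 2 * pi * \<i> * \<eta> $ j * cutoff_quot j \<eta>) =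
     (\<Sum>j\<in>UNIV. LINT z|lborel. (\<lambda>(y, t). 2 * pi * \<i> * \<eta> $ j * (quot_density j (y, t) * ?c y t)) z)"
    unfolding cutoff_quot_def case_prod_unfold by (simp only: integral_mult_right_zero prod.collapse)
  also have "\<dots> = (LINT z|(lborel \<Otimes>\<^sub>M lborel). (\<Sum>j\<in>UNIV. (\<lambda>(y, t). 2 * pi * \<i> * \<eta> $ j * (quot_density j (y, t) * ?c y t)) z))"
    using int by (subst Bochner_Integration.integral_sum) (auto simp: lborel_prod)
  also have "\<dots> = (LINT z|(lborel \<Otimes>\<^sub>M lborel). (\<lambda>(y, t). cutoff_ker y * (indicator {0..1} t * (\<i> * complex_of_real (2 * pi * (y \<bullet> \<eta>)) * cis (- (t * (2 * pi * (y \<bullet> \<eta>))))))) z)"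
    by (intro Bochner_Integration.integral_cong) (auto simp only: pw split: prod.splits)
  also have "\<dots> = (LINT y|lborel. (LINT t|lborel. cutoff_ker y * (indicator {0..1} t * (\<i> * complex_of_real (2 * pi * (y \<bullet> \<eta>)) * cis (- (t * (2 * pi * (y \<bullet> \<eta>))))))))"
  proof (rule lborel_pair.integral_fst[symmetric])
    have "integrable (lborel \<Otimes>\<^sub>M lborel) (\<lambda>z. (\<Sum>j\<in>UNIV. (\<lambda>(y, t). 2 * pi * \<i> * \<eta> $ j * (quot_density j (y, t) * ?c y t)) z))"
      using int by (intro Bochner_Integration.integrable_sum)
    then show "integrable (lborel \<Otimes>\<^sub>M lborel) (\<lambda>(y, t). cutoff_ker y * (indicator {0..1} t * (\<i> * complex_of_real (2 * pi * (y \<bullet> \<eta>)) * cis (- (t * (2 * pi * (y \<bullet> \<eta>)))))))"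
      by (rule Bochner_Integration.integrable_cong[THEN iffD1, rotated 2])
         (auto simp only: pw split: prod.splits)
  qed
  also have "\<dots> = (LINT y|lborel. cutoff_ker y * (1 - cis (- (2 * pi * (y \<bullet> \<eta>)))))"
    by (simp only: integral_mult_right_zero one_minus_cis)
  also have "\<dots> = (LINT y|lborel. cutoff_ker y * cis (- 2 * pi * (y \<bullet> 0)) - cutoff_ker y * cis (- 2 * pi * (y \<bullet> \<eta>)))"
    by (simp add: algebra_simps)
  also have "\<dots> = fourier cutoff_ker (0::real^'n) - fourier cutoff_ker \<eta>"
    unfolding fourier_def
    by (intro Bochner_Integration.integral_diff integrable_mult_cis cutoff_ker_integrable) auto
  finally show ?thesis by (simp add: fourier_cutoff_ker cutoff_0)
qed

lemma cutoff_quot_multiplier: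
  fixes h :: "real^'n::finite \<Rightarrow> complex"
  assumes h: "integrable lborel h" and \<rho>: "\<rho> > 0"
  obtains h' where "integrable lborel h'"
    "(LINT x|lborel. norm (h' x)) \<le> (LINT z|lborel. norm (quot_density j z)) * (LINT x|lborel. norm (h x))"
    "\<And>\<omega>. fourier h' \<omega> = cutoff_quot j (\<omega> /\<^sub>R \<rho>) * fourier h \<omega>"
proof -
  \<comment> \<open>Rescaling the frequency by \<open>1 / \<rho>\<close> only shortens or lengthens
    the translations; the density keeps its total mass.\<close>
  let ?T = "\<lambda>(y, t). (t / \<rho>) *\<^sub>R y :: real^'n"
  have T: "?T \<in> borel_measurable lborel" by (simp add: lborel_prod[symmetric])
  note sup = superposition_of_translates[OF sigma_finite_lborel quot_density_integrable[of j] T h]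
  have "(LINT m|lborel. quot_density j m * cis (- 2 * pi * (?T m \<bullet> \<omega>))) = cutoff_quot j (\<omega> /\<^sub>R \<rho>)" for \<omega>
    unfolding cutoff_quot_def
    by (intro Bochner_Integration.integral_cong) (auto simp: divide_inverse mult_ac)
  with sup show thesis by (intro that) auto
qed

text \<open>\<open>f\<close> is arbitrary in the induction because the hypothesis is used for its
  first derivatives; the multiplier \<open>cutoff_quot j\<close> is then applied to the resulting
  function. \<open>C\<close> is chosen before \<open>\<rho>\<close>, so all dependence on the scale
  is in the power.\<close>

lemma high_frequency_part:
  fixes f :: "real^'n::finite \<Rightarrow> complex"
  assumes "f \<in> schwartz"
  shows "\<exists>C\<ge>0. \<forall>\<rho>>0. \<exists>g. integrable lborel g \<and> (LINT x|lborel. norm (g x)) \<le> C / \<rho> ^ k \<and>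
    (\<forall>\<omega>. fourier g \<omega> = (1 - cutoff (\<omega> /\<^sub>R \<rho>)) ^ k * fourier f \<omega>)"
  using assms
proof (induction k arbitrary: f)
  case (0 f)
  then show ?case
    by (intro exI[of _ "LINT x|lborel. norm (f x)"] conjI allI impI exI[of _ f])
       (auto intro: schwartz_integrable)
next
  case (Suc k f)
  have "\<forall>j. \<exists>C\<ge>0. \<forall>\<rho>>0. \<exists>g. integrable lborel g \<and> (LINT x|lborel. norm (g x)) \<le> C / \<rho> ^ k \<and>
    (\<forall>\<omega>. fourier g \<omega> = (1 - cutoff (\<omega> /\<^sub>R \<rho>)) ^ k * fourier (pderivs [j] f) \<omega>)"
    by (intro allI Suc.IH schwartz_pderivs Suc.prems)
  then obtain C where C0: "\<And>j. C j \<ge> 0" and C: "\<And>j \<rho>. \<rho> > 0 \<Longrightarrow> \<exists>g. integrable lborel g \<and> (LINT x|lborel. norm (g x)) \<le> C j / \<rho> ^ k \<and>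
    (\<forall>\<omega>. fourier g \<omega> = (1 - cutoff (\<omega> /\<^sub>R \<rho>)) ^ k * fourier (pderivs [j] f) \<omega>)"
    by metis
  define b where "b j = (LINT z|lborel. norm (quot_density (j::'n) z))" for j
  have b0: "b j \<ge> 0" for j by (simp add: b_def)
  show ?case
  proof (intro exI[of _ "\<Sum>j\<in>UNIV. b j * C j"] conjI allI impI)
    show "0 \<le> (\<Sum>j\<in>UNIV. b j * C j)" by (intro sum_nonneg mult_nonneg_nonneg b0 C0)
    fix \<rho> :: real assume \<rho>: "\<rho> > 0"
    have "\<exists>h. integrable lborel h \<and> (LINT x|lborel. norm (h x)) \<le> b j * C j / \<rho> ^ k \<and>
      (\<forall>\<omega>. fourier h \<omega> = cutoff_quot j (\<omega> /\<^sub>R \<rho>) * ((1 - cutoff (\<omega> /\<^sub>R \<rho>)) ^ k * fourier (pderivs [j] f) \<omega>))" for j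
    proof -
      obtain g where g: "integrable lborel g" "(LINT x|lborel. norm (g x)) \<le> C j / \<rho> ^ k"
        "\<And>\<omega>. fourier g \<omega> = (1 - cutoff (\<omega> /\<^sub>R \<rho>)) ^ k * fourier (pderivs [j] f) \<omega>"
        using C[OF \<rho>] by blast
      obtain h where h: "integrable lborel h"
        "(LINT x|lborel. norm (h x)) \<le> b j * (LINT x|lborel. norm (g x))"
        "\<And>\<omega>. fourier h \<omega> = cutoff_quot j (\<omega> /\<^sub>R \<rho>) * fourier g \<omega>"
        unfolding b_def using cutoff_quot_multiplier[OF g(1) \<rho>, of j] by metis
      have "b j * (LINT x|lborel. norm (g x)) \<le> b j * (C j / \<rho> ^ k)"
        by (intro mult_left_mono g b0)
      with h g(3) show ?thesis by (intro exI[of _ h]) auto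
    qed
    then obtain h where h: "\<And>j. integrable lborel (h j)" "\<And>j. (LINT x|lborel. norm (h j x)) \<le> b j * C j / \<rho> ^ k"
      "\<And>j \<omega>. fourier (h j) \<omega> = cutoff_quot j (\<omega> /\<^sub>R \<rho>) * ((1 - cutoff (\<omega> /\<^sub>R \<rho>)) ^ k * fourier (pderivs [j] f) \<omega>)"
      by metis
    define g :: "real^'n \<Rightarrow> complex" where "g x = (\<Sum>j\<in>UNIV. h j x / \<rho>)" for x
    show "\<exists>g. integrable lborel g \<and> (LINT x|lborel. norm (g x)) \<le> (\<Sum>j\<in>UNIV. b j * C j) / \<rho> ^ Suc k \<and>
      (\<forall>\<omega>. fourier g \<omega> = (1 - cutoff (\<omega> /\<^sub>R \<rho>)) ^ Suc k * fourier f \<omega>)"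
    proof (intro exI[of _ g] conjI allI)
      show "integrable lborel g" unfolding g_def[abs_def] using h(1) by (intro Bochner_Integration.integrable_sum) auto
      have "(LINT x|lborel. norm (g x)) \<le> (LINT x|lborel. (\<Sum>j\<in>UNIV. norm (h j x) / \<rho>))"
        using \<rho> \<open>integrable lborel g\<close> h(1)
        by (intro integral_mono Bochner_Integration.integrable_sum) (auto simp: g_def norm_divide intro!: order_trans[OF norm_sum])
      also have "\<dots> = (\<Sum>j\<in>UNIV. (LINT x|lborel. norm (h j x)) / \<rho>)"
        using h(1) by (subst Bochner_Integration.integral_sum) auto
      also have "\<dots> \<le> (\<Sum>j\<in>UNIV. (b j * C j / \<rho> ^ k) / \<rho>)"
        using \<rho> by (intro sum_mono divide_right_mono h(2)) auto
      also have "\<dots> = (\<Sum>j\<in>UNIV. b j * C j) / \<rho> ^ Suc k"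
        by (simp add: sum_divide_distrib mult.commute)
      finally show "(LINT x|lborel. norm (g x)) \<le> (\<Sum>j\<in>UNIV. b j * C j) / \<rho> ^ Suc k" .
      fix \<omega> :: "real^'n"
      let ?q = "1 - cutoff (\<omega> /\<^sub>R \<rho>)"
      have "fourier g \<omega> = (LINT x|lborel. (\<Sum>j\<in>UNIV. (h j x * cis (- 2 * pi * (x \<bullet> \<omega>))) / \<rho>))"
        unfolding fourier_def g_def by (simp add: sum_distrib_right)
      also have "\<dots> = (\<Sum>j\<in>UNIV. fourier (h j) \<omega> / \<rho>)"
      proof (subst Bochner_Integration.integral_sum)
        show "integrable lborel (\<lambda>x. h j x * cis (- 2 * pi * (x \<bullet> \<omega>)) / \<rho>)" for j
          by (intro integrable_divide_zero impI integrable_mult_cis h(1)) auto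
      qed (simp add: fourier_def)
      also have "\<dots> = (\<Sum>j\<in>UNIV. (2 * pi * \<i> * (\<omega> /\<^sub>R \<rho>) $ j * cutoff_quot j (\<omega> /\<^sub>R \<rho>)) * (?q ^ k * fourier f \<omega>))"
        unfolding h(3) fourier_pderivs[OF Suc.prems]
        by (intro sum.cong) (auto simp: divide_inverse mult_ac)
      also have "\<dots> = ?q * (?q ^ k * fourier f \<omega>)"
        unfolding cutoff_quot[of "\<omega> /\<^sub>R \<rho>"] by (rule sum_distrib_right[symmetric])
      finally show "fourier g \<omega> = ?q ^ Suc k * fourier f \<omega>" by simp
    qed
  qed
qed

section \<open>Norms and functionals\<close>

text \<open>Interpolation in its elementary form: \<open>g powr P \<le> K powr (P - 1) * g\<close>
  pointwise. The measure is arbitrary so that L^p on space and \<ell>^q on the index set are both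
  covered.\<close>

lemma Lp_norm_le:
  assumes [measurable]: "g \<in> borel_measurable M" and p: "1 \<le> p"
    and sup: "\<And>x. x \<in> space M \<Longrightarrow> g x \<le> ennreal K" and int: "(\<integral>\<^sup>+x. g x \<partial>M) \<le> ennreal K" and K: "0 \<le> K"
  shows "Lp_norm M p g \<le> ennreal K"
proof (cases "p = \<infinity>")
  case True
  then show ?thesis using sup by (auto simp: Lp_norm_def intro!: esssup_I)
next
  case False
  define P where "P = enn2real p"
  have P: "1 \<le> P"
    using p False unfolding P_def by (cases p) (auto simp: ennreal_1[symmetric] simp del: ennreal_1)
  have gtop: "g x \<noteq> \<infinity>" if "x \<in> space M" for x using sup[OF that] by (auto simp: top_unique)
  have "ennreal_powr (g x) P \<le> ennreal (K powr (P - 1)) * g x" if x: "x \<in> space M" for x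
  proof -
    define r where "r = enn2real (g x)"
    have g: "g x = ennreal r" using gtop[OF x] by (simp add: r_def less_top)
    have r0: "0 \<le> r" by (simp add: r_def)
    have "ennreal r \<le> ennreal K" using sup[OF x] by (simp only: g)
    with r0 K have r: "0 \<le> r" "r \<le> K" by simp_all
    have "r powr P = r powr (P - 1) * r"
      using r(1) by (cases "r = 0") (auto simp: powr_diff)
    also have "\<dots> \<le> K powr (P - 1) * r" using r P by (intro mult_right_mono powr_mono2) auto
    finally show ?thesis using r gtop[of x] unfolding ennreal_powr_def
      by (simp add: g ennreal_mult[symmetric] ennreal_leI)
  qed
  then have "(\<integral>\<^sup>+x. ennreal_powr (g x) P \<partial>M) \<le> (\<integral>\<^sup>+x. ennreal (K powr (P - 1)) * g x \<partial>M)"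
    by (intro nn_integral_mono)
  also have "\<dots> = ennreal (K powr (P - 1)) * (\<integral>\<^sup>+x. g x \<partial>M)" by (rule nn_integral_cmult) measurable
  also have "\<dots> \<le> ennreal (K powr (P - 1)) * ennreal K" by (intro mult_left_mono int) simp
  also have "\<dots> = ennreal (K powr P)"
    using K by (cases "K = 0") (auto simp: ennreal_mult[symmetric] powr_diff)
  finally have le: "(\<integral>\<^sup>+x. ennreal_powr (g x) P \<partial>M) \<le> ennreal (K powr P)" (is "?J \<le> _") .
  then have J: "?J \<noteq> \<infinity>" by (auto simp: top_unique)
  have "enn2real ?J \<le> K powr P" using le by (simp add: enn2real_leI)
  then have "enn2real ?J powr (1 / P) \<le> (K powr P) powr (1 / P)"
    using P by (intro powr_mono2) auto
  also have "\<dots> = K" using P K by (simp add: powr_powr powr_one_gt_zero_iff)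
  finally show ?thesis using False J
    by (simp add: Lp_norm_def P_def[symmetric] ennreal_powr_def ennreal_leI)
qed

lemma Lp_norm_1: "Lp_norm M 1 g = (\<integral>\<^sup>+x. g x \<partial>M)"
proof -
  have "ennreal_powr y 1 = y" for y
    by (cases y) (auto simp: ennreal_powr_def)
  then show ?thesis by (simp add: Lp_norm_def)
qed

lemma test_integrable: "\<phi> \<in> test_functions \<Longrightarrow> integrable lborel \<phi>"
  using test_functions_schwartz schwartz_integrable by blast

lemma fourier_add:
  assumes "integrable lborel f" "integrable lborel g"
  shows "fourier (\<lambda>x. f x + g x) = (\<lambda>\<omega>. fourier f \<omega> + fourier g \<omega>)"
proof
  fix \<omega>
  have "fourier (\<lambda>x. f x + g x) \<omega> = (LINT x|lborel. f x * cis (- 2 * pi * (x \<bullet> \<omega>)) + g x * cis (- 2 * pi * (x \<bullet> \<omega>)))"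
    by (simp add: fourier_def algebra_simps)
  also have "\<dots> = fourier f \<omega> + fourier g \<omega>"
    unfolding fourier_def by (intro Bochner_Integration.integral_add integrable_mult_cis assms) auto
  finally show "fourier (\<lambda>x. f x + g x) \<omega> = fourier f \<omega> + fourier g \<omega>" .
qed

lemma fourier_scale: "fourier (\<lambda>x. a * f x) = (\<lambda>\<omega>. a * fourier f \<omega>)"
  by (rule ext) (simp add: fourier_def mult.assoc)

lemma integrable_mult_fourier:
  fixes f \<phi> :: "real^'n::finite \<Rightarrow> complex"
  assumes f: "integrable lborel f" and \<phi>: "integrable lborel \<phi>"
  shows "integrable lborel (\<lambda>x. f x * fourier \<phi> x)"
proof (rule Bochner_Integration.integrable_bound)
  have [measurable]: "f \<in> borel_measurable borel" "\<phi> \<in> borel_measurable borel" using f \<phi> by auto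
  show "integrable lborel (\<lambda>x. f x * complex_of_real (LINT x|lborel. norm (\<phi> x)))" using f by simp
  show "(\<lambda>x. f x * fourier \<phi> x) \<in> borel_measurable lborel" by measurable
  show "AE x in lborel. norm (f x * fourier \<phi> x) \<le> norm (f x * complex_of_real (LINT x|lborel. norm (\<phi> x)))"
    by (rule AE_I2) (auto simp: norm_mult intro!: mult_left_mono norm_fourier_le)
qed

text \<open>Continuity holds with the seminorm of order zero: the transform of \<open>\<phi>\<close>
  is bounded by its L^1 norm, hence by the measure of \<open>K\<close> times the supremum of
  \<open>\<phi>\<close>.\<close>

lemma functional_of_schwartz_in_Z_dual:
  fixes f :: "real^'n::finite \<Rightarrow> complex"
  assumes f: "f \<in> schwartz"
  shows "functional_of f \<in> Z_dual"
proof -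
  note fi = schwartz_integrable[OF f]
  have add: "functional_of f (\<lambda>x. \<phi> x + \<eta> x) = functional_of f \<phi> + functional_of f \<eta>"
    if Z: "\<phi> \<in> Z_space" "\<eta> \<in> Z_space" for \<phi> \<eta>
  proof -
    obtain a b where ab: "a \<in> test_functions" "b \<in> test_functions" "\<phi> = fourier a" "\<eta> = fourier b"
      using Z by (auto simp: Z_space_def)
    have "(\<lambda>x. \<phi> x + \<eta> x) = fourier (\<lambda>x. a x + b x)"
      using ab by (simp add: fourier_add test_integrable)
    then have "(\<lambda>x. \<phi> x + \<eta> x) \<in> Z_space"
      using test_functions_add[OF ab(1,2)] by (auto simp: Z_space_def)
    then show ?thesis
      using Z ab fi by (simp add: functional_of_def distrib_left integrable_mult_fourier test_integrable)
  qed
  have scale: "functional_of f (\<lambda>x. c * \<phi> x) = c * functional_of f \<phi>" if Z: "\<phi> \<in> Z_space" for c \<phi>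
  proof -
    obtain a where a: "a \<in> test_functions" "\<phi> = fourier a" using Z by (auto simp: Z_space_def)
    have "(\<lambda>x. c * \<phi> x) = fourier (\<lambda>x. c * a x)" by (simp add: a fourier_scale)
    then have "(\<lambda>x. c * \<phi> x) \<in> Z_space"
      using test_functions_scale[OF a(1)] by (auto simp: Z_space_def)
    then show ?thesis using Z by (simp add: functional_of_def mult.left_commute)
  qed
  have cont: "norm (functional_of f (fourier \<phi>)) \<le>
      (LINT x|lborel. norm (f x)) * measure lborel K * (\<Sum>js | length js \<le> 0. SUP x. norm (pderivs js \<phi> x))"
    if K: "compact K" and \<phi>: "\<phi> \<in> test_functions" "supp \<phi> \<subseteq> K" for K \<phi>
  proof -
    obtain B where B: "\<And>x. norm (pderivs [] \<phi> x) \<le> B * (1 / (1 + norm x) ^ 0)"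
      using schwartz_decay[of \<phi> "[]" 0] \<phi>(1) test_functions_schwartz by blast
    define S where "S = (SUP x. norm (\<phi> x))"
    have S: "norm (\<phi> x) \<le> S" for x
      unfolding S_def using B by (intro cSUP_upper bdd_aboveI[of _ B]) auto
    have "(LINT x|lborel. norm (\<phi> x)) \<le> (LINT x|lborel. S * indicator K x)"
    proof (intro integral_mono)
      show "integrable lborel (\<lambda>x. norm (\<phi> x))" using test_integrable[OF \<phi>(1)] by simp
      have "emeasure lborel K < \<infinity>" using K by (rule emeasure_compact_finite)
      then show "integrable lborel (\<lambda>x. S * indicator K x)"
        using K by (intro integrable_mult_right) (auto simp: integrable_indicator_iff borel_compact)
      show "norm (\<phi> x) \<le> S * indicator K x" for x
        using S[of x] in_supp[of \<phi> x] \<phi>(2) by (cases "\<phi> x = 0") (auto split: split_indicator)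
    qed
    also have "\<dots> = measure lborel K * S" by simp
    finally have l1: "(LINT x|lborel. norm (\<phi> x)) \<le> measure lborel K * S" .
    have "fourier \<phi> \<in> Z_space" using \<phi> by (simp add: Z_space_def)
    then have "norm (functional_of f (fourier \<phi>)) \<le> (LINT x|lborel. norm (f x * fourier \<phi> x))"
      by (simp add: functional_of_def integral_norm_bound)
    also have "\<dots> \<le> (LINT x|lborel. norm (f x) * (measure lborel K * S))"
    proof (intro integral_mono)
      show "integrable lborel (\<lambda>x. norm (f x * fourier \<phi> x))"
        by (intro integrable_norm integrable_mult_fourier fi test_integrable \<phi>)
      show "integrable lborel (\<lambda>x. norm (f x) * (measure lborel K * S))" using fi by simp
      show "norm (f x * fourier \<phi> x) \<le> norm (f x) * (measure lborel K * S)" for x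
        unfolding norm_mult by (intro mult_left_mono order_trans[OF norm_fourier_le(1) l1]) simp
    qed
    also have "\<dots> = (LINT x|lborel. norm (f x)) * measure lborel K * S" by simp
    finally show ?thesis by (simp add: S_def)
  qed
  show ?thesis
    unfolding Z_dual_def
  proof (intro CollectI conjI ballI allI impI)
    show "functional_of f \<in> extensional Z_space" by (simp add: functional_of_def)
    fix K :: "(real^'n) set" assume "compact K"
    then show "\<exists>C m. \<forall>\<phi>\<in>test_functions. supp \<phi> \<subseteq> K \<longrightarrow>
        norm (functional_of f (fourier \<phi>)) \<le> C * (\<Sum>js | length js \<le> m. SUP x. norm (pderivs js \<phi> x))"
      by (intro exI[of _ "(LINT x|lborel. norm (f x)) * measure lborel K"] exI[of _ 0] ballI impI cont)
  qed (rule add scale; assumption)+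
qed

text \<open>The norm of a functional is an infimum over representing functions, so exhibiting
  \<open>u\<close> is enough. Unfolding the functional gives \<open>f\<close> paired with
  \<open>fourier (\<psi> * \<phi>)\<close>; two uses of the multiplication formula turn this into
  \<open>u\<close> paired with \<open>fourier \<phi>\<close>.\<close>

lemma Lp_norm_functional_piece:
  fixes f :: "real^'n::finite \<Rightarrow> complex" and \<psi> :: "real^'n \<Rightarrow> real"
  assumes f: "f \<in> schwartz" and \<psi>: "smooth \<psi>" "integrable lborel \<psi>" "\<And>x. 0 \<le> \<psi> x" "\<And>x. \<psi> x \<le> 1"
    and p: "1 \<le> p"
    and u: "u = inv_fourier (\<lambda>\<omega>. complex_of_real (\<psi> \<omega>) * fourier f \<omega>)"
    and ui: "integrable lborel u" and u1: "(LINT x|lborel. norm (u x)) \<le> K" and uinf: "\<And>x. norm (u x) \<le> K"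
  shows "Lp_norm_functional p (inv_fourier_functional (mult_functional \<psi> (fourier_functional (functional_of f)))) \<le> ennreal K"
proof -
  note fi = schwartz_integrable[OF f] and Ffi = fourier_schwartz_integrable[OF f]
  have K: "0 \<le> K" using uinf[of 0] norm_ge_zero order_trans by blast
  have [measurable]: "u \<in> borel_measurable borel" "fourier f \<in> borel_measurable borel" "\<psi> \<in> borel_measurable borel"
    using ui Ffi \<psi>(2) by auto
  have \<psi>fi: "integrable lborel (\<lambda>\<omega>. complex_of_real (\<psi> \<omega>) * fourier f \<omega>)"
    by (rule Bochner_Integration.integrable_bound[OF Ffi])
       (use \<psi>(3,4) in \<open>auto simp: norm_mult mult_left_le_one_le\<close>)
  have Lp: "Lp_norm lborel p (\<lambda>x. ennreal (norm (u x))) \<le> ennreal K"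
    using uinf u1 K ui by (intro Lp_norm_le p) (auto simp: nn_integral_eq_integral ennreal_leI)
  have rep: "inv_fourier_functional (mult_functional \<psi> (fourier_functional (functional_of f))) \<eta> = (LINT x|lborel. u x * \<eta> x)"
    if Z: "\<eta> \<in> Z_space" for \<eta>
  proof -
    obtain \<phi> where \<phi>: "\<phi> \<in> test_functions" "\<eta> = fourier \<phi>" using Z by (auto simp: Z_space_def)
    have \<phi>s: "\<phi> \<in> schwartz" using \<phi>(1) test_functions_schwartz by blast
    have inv: "inv_fourier \<eta> = \<phi>" by (simp add: \<phi>(2) schwartz_inversion[OF \<phi>s])
    have \<psi>\<phi>: "(\<lambda>x. complex_of_real (\<psi> x) * \<phi> x) \<in> test_functions"
      by (rule test_functions_mult[OF \<psi>(1) \<phi>(1)])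
    have "inv_fourier_functional (mult_functional \<psi> (fourier_functional (functional_of f))) \<eta>
      = (LINT x|lborel. f x * fourier (\<lambda>x. complex_of_real (\<psi> x) * \<phi> x) x)"
      using Z \<phi>(1) \<psi>\<phi> inv
      by (simp add: inv_fourier_functional_def mult_functional_def fourier_functional_def functional_of_def Z_space_def)
    also have "\<dots> = (LINT x|lborel. (complex_of_real (\<psi> x) * \<phi> x) * fourier f x)"
      by (rule fourier_multiplication(1)[OF fi test_integrable[OF \<psi>\<phi>]])
    also have "\<dots> = (LINT x|lborel. (complex_of_real (\<psi> x) * fourier f x) * inv_fourier \<eta> x)"
      by (simp add: inv mult_ac)
    also have "\<dots> = (LINT x|lborel. \<eta> x * u x)"
      unfolding u by (rule fourier_multiplication(2)[OF \<psi>fi]) (simp add: \<phi>(2) fourier_schwartz_integrable[OF \<phi>s])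
    finally show ?thesis by (simp add: mult.commute)
  qed
  have "Lp_norm_functional p (inv_fourier_functional (mult_functional \<psi> (fourier_functional (functional_of f))))
    \<le> Lp_norm lborel p (\<lambda>x. ennreal (norm (u x)))"
    unfolding Lp_norm_functional_def
  proof (rule Inf_lower, intro CollectI exI[of _ u] conjI refl ballI rep)
    show "Lp_norm lborel p (\<lambda>x. ennreal (norm (u x))) < \<infinity>"
      using Lp by (auto simp: order.strict_trans1)
  qed auto
  with Lp show ?thesis by simp
qed

text \<open>On the support of \<open>\<psi>\<close>, which avoids the ball of radius \<open>d\<close>, nothing changes when \<open>fourier f\<close> is
  replaced by its high frequency part at scale proportional to \<open>d\<close>.\<close>

lemma localized_piece_decay:
  fixes f :: "real^'n::finite \<Rightarrow> complex"
  assumes f: "f \<in> schwartz" and B: "0 \<le> B"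
  shows "\<exists>C\<ge>0. \<forall>\<psi>::real^'n \<Rightarrow> real. \<forall>d. integrable lborel \<psi> \<longrightarrow> (\<forall>x. 0 \<le> \<psi> x \<and> \<psi> x \<le> 1) \<longrightarrow>
     integrable lborel (inv_fourier (\<lambda>\<omega>. complex_of_real (\<psi> \<omega>))) \<longrightarrow>
     (LINT x|lborel. norm (inv_fourier (\<lambda>\<omega>. complex_of_real (\<psi> \<omega>)) x)) \<le> B \<longrightarrow>
     0 \<le> d \<longrightarrow> (\<forall>\<omega>. \<psi> \<omega> \<noteq> 0 \<longrightarrow> d \<le> norm \<omega>) \<longrightarrow>
     integrable lborel (inv_fourier (\<lambda>\<omega>. complex_of_real (\<psi> \<omega>) * fourier f \<omega>)) \<and>
     (LINT x|lborel. norm (inv_fourier (\<lambda>\<omega>. complex_of_real (\<psi> \<omega>) * fourier f \<omega>) x)) \<le> C / (1 + d) ^ k \<and>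
     (\<forall>x. norm (inv_fourier (\<lambda>\<omega>. complex_of_real (\<psi> \<omega>) * fourier f \<omega>) x) \<le> C / (1 + d) ^ k)"
proof -
  let ?N = "real CARD('n)"
  have N: "?N > 0" by simp
  note fi = schwartz_integrable[OF f] and Ffi = fourier_schwartz_integrable[OF f]
  obtain C1 where C1: "C1 \<ge> 0" and hf: "\<And>\<rho>. \<rho> > 0 \<Longrightarrow> \<exists>g. integrable lborel g \<and> (LINT x|lborel. norm (g x)) \<le> C1 / \<rho> ^ k \<and>
    (\<forall>\<omega>. fourier g \<omega> = (1 - cutoff (\<omega> /\<^sub>R \<rho>)) ^ k * fourier f \<omega>)"
    using high_frequency_part[OF f, of k] by blast
  \<comment> \<open>\<open>k\<close> powers become decay in \<open>d\<close>, the other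
    \<open>2 * CARD('n)\<close> keep the majorant integrable.\<close>
  obtain C2 where C2: "C2 \<ge> 0" "\<And>\<omega>. norm (fourier f \<omega>) \<le> C2 * (1 / (1 + norm \<omega>) ^ (k + 2 * CARD('n)))"
    using fourier_decay[OF f] by metis
  define W where "W = (LINT \<omega>|lborel. 1 / (1 + norm (\<omega>::real^'n)) ^ (2 * CARD('n)))"
  have W: "W \<ge> 0" unfolding W_def by simp
  define F1 where "F1 = (LINT x|lborel. norm (f x))"
  have F1: "F1 \<ge> 0" by (simp add: F1_def)
  \<comment> \<open>The summands serve, in this order, the L^1 bound for \<open>d \<le> 1\<close>,
    where \<open>1 + d \<le> 2\<close>, the L^1 bound for \<open>d > 1\<close>, where
    \<open>1 + d \<le> 2 * d\<close>, and the supremum.\<close>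
  define C where "C = B * F1 * 2 ^ k + B * C1 * (2 * ?N) ^ k + C2 * W"
  have parts: "0 \<le> B * F1 * 2 ^ k" "0 \<le> B * C1 * (2 * ?N) ^ k" "0 \<le> C2 * W"
    using B F1 C1 C2 W by auto
  show ?thesis
  proof (intro exI[of _ C] conjI allI impI)
    show "0 \<le> C" using parts by (simp add: C_def)
    fix \<psi> :: "real^'n \<Rightarrow> real" and d :: real
    assume \<psi>: "integrable lborel \<psi>" and \<psi>01: "\<forall>x. 0 \<le> \<psi> x \<and> \<psi> x \<le> 1"
      and Ki: "integrable lborel (inv_fourier (\<lambda>\<omega>. complex_of_real (\<psi> \<omega>)))"
      and KB: "(LINT x|lborel. norm (inv_fourier (\<lambda>\<omega>. complex_of_real (\<psi> \<omega>)) x)) \<le> B"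
      and d: "0 \<le> d" and away: "\<forall>\<omega>. \<psi> \<omega> \<noteq> 0 \<longrightarrow> d \<le> norm \<omega>"
    let ?u = "inv_fourier (\<lambda>\<omega>. complex_of_real (\<psi> \<omega>) * fourier f \<omega>)"
    have [measurable]: "\<psi> \<in> borel_measurable borel" "fourier f \<in> borel_measurable borel" using \<psi> Ffi by auto
    have \<psi>c: "integrable lborel (\<lambda>\<omega>. complex_of_real (\<psi> \<omega>))" using \<psi> by simp
    show "integrable lborel ?u" by (rule inv_fourier_mult_bound(1)[OF \<psi>c Ki fi])
    have bound: "(LINT x|lborel. norm (inv_fourier (\<lambda>\<omega>. complex_of_real (\<psi> \<omega>) * fourier g \<omega>) x)) \<le> B * (LINT x|lborel. norm (g x))"
      if "integrable lborel g" for g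
      using inv_fourier_mult_bound(2)[OF \<psi>c Ki that] KB
      by (rule order_trans[OF _ mult_right_mono]) simp
    have dk: "(1 + d) ^ k > 0" using d by simp
    show "(LINT x|lborel. norm (?u x)) \<le> C / (1 + d) ^ k"
    proof (cases "d \<le> 1")
      case True
      have "(LINT x|lborel. norm (?u x)) * (1 + d) ^ k \<le> (B * F1) * 2 ^ k"
        using bound[OF fi] True d B F1 by (intro mult_mono power_mono) (auto simp: F1_def)
      also have "\<dots> \<le> C" using parts by (simp add: C_def)
      finally show ?thesis using dk by (simp add: pos_le_divide_eq)
    next
      case False
      \<comment> \<open>The largest scale for which \<open>cutoff_eq_0\<close> applies to every
        frequency of norm at least \<open>d\<close>.\<close>
      define \<rho> where "\<rho> = d / ?N"
      have \<rho>: "\<rho> > 0" using False N by (simp add: \<rho>_def)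
      obtain g where g: "integrable lborel g" "(LINT x|lborel. norm (g x)) \<le> C1 / \<rho> ^ k"
        "\<And>\<omega>. fourier g \<omega> = (1 - cutoff (\<omega> /\<^sub>R \<rho>)) ^ k * fourier f \<omega>" using hf[OF \<rho>] by blast
      have eq: "complex_of_real (\<psi> \<omega>) * fourier f \<omega> = complex_of_real (\<psi> \<omega>) * fourier g \<omega>" for \<omega>
      proof (cases "\<psi> \<omega> = 0")
        case False
        then have "d \<le> norm \<omega>" using away by blast
        then have "?N \<le> norm (\<omega> /\<^sub>R \<rho>)" using \<rho> N by (simp add: \<rho>_def field_simps)
        then have "cutoff (\<omega> /\<^sub>R \<rho>) = 0" by (rule cutoff_eq_0)
        then show ?thesis by (simp add: g(3))
      qed simp
      have "(LINT x|lborel. norm (?u x)) \<le> B * (LINT x|lborel. norm (g x))"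
        unfolding eq by (rule bound[OF g(1)])
      also have "\<dots> \<le> B * (C1 / \<rho> ^ k)" by (intro mult_left_mono g B)
      finally have "(LINT x|lborel. norm (?u x)) * (1 + d) ^ k \<le> B * (C1 / \<rho> ^ k) * (2 * d) ^ k"
        using False d B C1 \<rho> by (intro mult_mono power_mono) auto
      also have "\<dots> = B * C1 * (2 * ?N) ^ k"
        using False N by (simp add: \<rho>_def power_mult_distrib power_divide)
      also have "\<dots> \<le> C" using parts by (simp add: C_def)
      finally show ?thesis using dk by (simp add: pos_le_divide_eq)
    qed
    fix x
    have "norm (?u x) \<le> (LINT \<omega>|lborel. norm (complex_of_real (\<psi> \<omega>) * fourier f \<omega>))"
      by (rule norm_fourier_le(2))
    also have "\<dots> \<le> (LINT \<omega>|lborel. C2 / (1 + d) ^ k * (1 / (1 + norm (\<omega>::real^'n)) ^ (2 * CARD('n))))"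
    proof (intro integral_mono)
      show "integrable lborel (\<lambda>\<omega>. norm (complex_of_real (\<psi> \<omega>) * fourier f \<omega>))"
        by (intro integrable_norm Bochner_Integration.integrable_bound[OF Ffi])
           (use \<psi>01 in \<open>auto simp: norm_mult mult_left_le_one_le\<close>)
      show "integrable lborel (\<lambda>\<omega>::real^'n. C2 / (1 + d) ^ k * (1 / (1 + norm \<omega>) ^ (2 * CARD('n))))"
        by (intro integrable_mult_right integrable_weight) simp
      fix \<omega> :: "real^'n"
      show "norm (complex_of_real (\<psi> \<omega>) * fourier f \<omega>) \<le> C2 / (1 + d) ^ k * (1 / (1 + norm \<omega>) ^ (2 * CARD('n)))"
      proof (cases "\<psi> \<omega> = 0")
        case True
        then show ?thesis using C2(1) dk by simp
      next
        case False
        then have le: "d \<le> norm \<omega>" using away by blast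
        have "norm (complex_of_real (\<psi> \<omega>) * fourier f \<omega>) \<le> 1 * norm (fourier f \<omega>)"
          unfolding norm_mult using \<psi>01 by (intro mult_right_mono) auto
        also have "\<dots> \<le> C2 * (1 / (1 + norm \<omega>) ^ (k + 2 * CARD('n)))" using C2(2) by simp
        also have "\<dots> = C2 / (1 + norm \<omega>) ^ k * (1 / (1 + norm \<omega>) ^ (2 * CARD('n)))"
          by (simp add: power_add)
        also have "\<dots> \<le> C2 / (1 + d) ^ k * (1 / (1 + norm \<omega>) ^ (2 * CARD('n)))"
          using C2(1) le d dk by (intro mult_right_mono divide_left_mono power_mono mult_pos_pos) auto
        finally show ?thesis .
      qed
    qed
    also have "\<dots> = C2 * W / (1 + d) ^ k" unfolding W_def integral_mult_right_zero by simp
    also have "\<dots> \<le> C / (1 + d) ^ k" using parts dk by (intro divide_right_mono) (auto simp: C_def)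
    finally show "norm (?u x) \<le> C / (1 + d) ^ k" .
  qed
qed

section \<open>Shears preserve Lebesgue measure\<close>

lemma nn_integral_translate:
  fixes f :: "'b::euclidean_space \<Rightarrow> ennreal"
  assumes [measurable]: "f \<in> borel_measurable borel"
  shows "(\<integral>\<^sup>+x. f (x + t) \<partial>lborel) = (\<integral>\<^sup>+x. f x \<partial>lborel)"
proof -
  have "(\<integral>\<^sup>+x. f x \<partial>lborel) = (\<integral>\<^sup>+x. f x \<partial>distr lborel borel ((+) t))" by (simp add: lborel_distr_plus)
  also have "\<dots> = (\<integral>\<^sup>+x. f (t + x) \<partial>lborel)" by (rule nn_integral_distr) auto
  finally show ?thesis by (simp add: add.commute)
qed

text \<open>Inserting \<open>1 = (\<integral>t. indicator {0..1} (y $ j + t))\<close> and translating turns the integral over \<open>y\<close> into one that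
  involves \<open>f\<close> only through its integrals along lines parallel to the \<open>j\<close>-th axis.\<close>

lemma nn_integral_fibres:
  fixes f :: "real^'n::finite \<Rightarrow> ennreal"
  assumes [measurable]: "f \<in> borel_measurable borel"
  shows "(\<integral>\<^sup>+y. f y \<partial>lborel) =
    (\<integral>\<^sup>+y. indicator {0..1} (y $ j) * (\<integral>\<^sup>+t. f (y - t *\<^sub>R axis j 1) \<partial>lborel) \<partial>lborel)"
proof -
  have [measurable]: "(\<lambda>y::real^'n. y $ j) \<in> borel_measurable borel" by simp
  have one: "(\<integral>\<^sup>+t. indicator {0..1} (a + t) \<partial>lborel) = 1" for a :: real
    using nn_integral_translate[of "indicator {0..1::real}" a] by (simp add: add.commute)
  have "(\<integral>\<^sup>+y. f y \<partial>lborel) = (\<integral>\<^sup>+y. (\<integral>\<^sup>+t. f y * indicator {0..1} (y $ j + t) \<partial>lborel) \<partial>lborel)"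
    by (simp add: nn_integral_cmult one)
  also have "\<dots> = (\<integral>\<^sup>+t. (\<integral>\<^sup>+y. f y * indicator {0..1} (y $ j + t) \<partial>lborel) \<partial>lborel)"
    by (rule lborel_pair.Fubini') measurable
  also have "\<dots> = (\<integral>\<^sup>+t. (\<integral>\<^sup>+y. f (y - t *\<^sub>R axis j 1) * indicator {0..1} (y $ j) \<partial>lborel) \<partial>lborel)"
  proof (rule nn_integral_cong)
    fix t :: real
    have "(\<integral>\<^sup>+y. f y * indicator {0..1} (y $ j + t) \<partial>lborel) =
        (\<integral>\<^sup>+y. (\<lambda>y. f (y - t *\<^sub>R axis j 1) * indicator {0..1} (y $ j)) (y + t *\<^sub>R axis j 1) \<partial>lborel)"
      by (simp add: axis_def)
    also have "\<dots> = (\<integral>\<^sup>+y. f (y - t *\<^sub>R axis j 1) * indicator {0..1} (y $ j) \<partial>lborel)"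
      by (rule nn_integral_translate) measurable
    finally show "(\<integral>\<^sup>+y. f y * indicator {0..1} (y $ j + t) \<partial>lborel) = \<dots>" .
  qed
  also have "\<dots> = (\<integral>\<^sup>+y. (\<integral>\<^sup>+t. f (y - t *\<^sub>R axis j 1) * indicator {0..1} (y $ j) \<partial>lborel) \<partial>lborel)"
    by (rule lborel_pair.Fubini') measurable
  also have "\<dots> = (\<integral>\<^sup>+y. indicator {0..1} (y $ j) * (\<integral>\<^sup>+t. f (y - t *\<^sub>R axis j 1) \<partial>lborel) \<partial>lborel)"
  proof (rule nn_integral_cong)
    fix y :: "real^'n"
    show "(\<integral>\<^sup>+t. f (y - t *\<^sub>R axis j 1) * indicator {0..1} (y $ j) \<partial>lborel) =
        indicator {0..1} (y $ j) * (\<integral>\<^sup>+t. f (y - t *\<^sub>R axis j 1) \<partial>lborel)"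
      by (subst nn_integral_multc, measurable) (simp only: mult.commute)
  qed
  finally show ?thesis .
qed

text \<open>\<open>q\<close> is constant on each line parallel to the \<open>j\<close>-th axis, so
  the shear acts there as a translation and leaves the fibre integrals unchanged.\<close>

lemma nn_integral_shear:
  fixes f :: "real^'n::finite \<Rightarrow> ennreal"
  assumes [measurable]: "f \<in> borel_measurable borel" "q \<in> borel_measurable borel"
    and q: "\<And>y t. q (y + t *\<^sub>R axis j 1) = q y"
  shows "(\<integral>\<^sup>+y. f (y + q y *\<^sub>R axis j 1) \<partial>lborel) = (\<integral>\<^sup>+y. f y \<partial>lborel)"
proof -
  have q': "q (y - t *\<^sub>R axis j 1) = q y" for y t
    using q[of y "- t"] by simp
  have fibre: "(\<integral>\<^sup>+t. f (y - t *\<^sub>R axis j 1 + q (y - t *\<^sub>R axis j 1) *\<^sub>R axis j 1) \<partial>lborel) = (\<integral>\<^sup>+t. f (y - t *\<^sub>R axis j 1) \<partial>lborel)" for y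
  proof -
    have "(\<integral>\<^sup>+t. f (y - t *\<^sub>R axis j 1 + q (y - t *\<^sub>R axis j 1) *\<^sub>R axis j 1) \<partial>lborel)
      = (\<integral>\<^sup>+t. (\<lambda>s. f (y - s *\<^sub>R axis j 1)) (t + (- q y)) \<partial>lborel)"
      by (simp add: q' algebra_simps)
    also have "\<dots> = (\<integral>\<^sup>+t. f (y - t *\<^sub>R axis j 1) \<partial>lborel)"
      by (rule nn_integral_translate) measurable
    finally show ?thesis .
  qed
  show ?thesis
    by (subst (1 2) nn_integral_fibres[where j=j]) (simp_all add: fibre)
qed

section \<open>The group law in exponential coordinates\<close>

text \<open>The word of a Dynkin term, with \<open>False\<close> for \<open>x\<close> and
  \<open>True\<close> for \<open>y\<close>. Separating it from the vectors permits induction along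
  the nested bracket.\<close>

definition bch_pattern :: "(nat \<times> nat) list \<Rightarrow> bool list" where
  "bch_pattern rs = concat (map (\<lambda>(r, s). replicate r False @ replicate s True) rs)"

definition pattern_bracket ::
    "(real^'n \<Rightarrow> real^'n \<Rightarrow> real^'n) \<Rightarrow> bool list \<Rightarrow> real^'n \<Rightarrow> real^'n \<Rightarrow> real^'n" where
  "pattern_bracket br bs x y = nested_bracket br (map (\<lambda>b. if b then y else x) bs)"

definition bch_coeff :: "(nat \<times> nat) list \<Rightarrow> real" where
  "bch_coeff rs = (-1) ^ (length rs - 1) /
          (real (length rs) * real (bch_length rs) * (\<Prod>(r, s)\<leftarrow>rs. fact r * fact s))"

text \<open>The nonlinear part of the group law. Its terms contain at least one genuine bracket,
  which raises the degree.\<close>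

definition bch_rem ::
    "(real^'n \<Rightarrow> real^'n \<Rightarrow> real^'n) \<Rightarrow> nat \<Rightarrow> real^'n \<Rightarrow> real^'n \<Rightarrow> real^'n" where
  "bch_rem br \<sigma> x y =
     (\<Sum>rs\<in>{rs \<in> bch_index \<sigma>. 2 \<le> bch_length rs}. bch_coeff rs *\<^sub>R pattern_bracket br (bch_pattern rs) x y)"

lemma length_bch_pattern: "length (bch_pattern rs) = bch_length rs"
  unfolding bch_pattern_def bch_length_def by (induction rs) auto

lemma gmult_pattern:
  "gmult br \<sigma> x y = (\<Sum>rs\<in>bch_index \<sigma>. bch_coeff rs *\<^sub>R pattern_bracket br (bch_pattern rs) x y)"
proof -
  have "concat (map (\<lambda>(r, s). replicate r x @ replicate s y) rs) = map (\<lambda>b. if b then y else x) (bch_pattern rs)" for rs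
    unfolding bch_pattern_def by (induction rs) (auto simp: map_replicate)
  then show ?thesis by (simp add: gmult_def bch_coeff_def pattern_bracket_def)
qed

lemma length_le_bch_length: "(\<forall>(r, s)\<in>set rs. 0 < r + s) \<Longrightarrow> length rs \<le> bch_length rs"
proof (induction rs)
  case (Cons a rs)
  obtain r s where a: "a = (r, s)" by fastforce
  from Cons have "length rs \<le> bch_length rs" "0 < r + s" by (auto simp: a)
  then have "Suc (length rs) \<le> (r + s) + bch_length rs" by arith
  then show ?case by (simp add: bch_length_def a)
qed (simp add: bch_length_def)

lemma le_bch_length: "(r, s) \<in> set rs \<Longrightarrow> r \<le> bch_length rs \<and> s \<le> bch_length rs"
  unfolding bch_length_def by (induction rs) auto

text \<open>Each pair contributes at least one to the length, which bounds the number of pairs as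
  well as their entries. Finiteness matters because a sum over an infinite set is 0 by
  convention.\<close>

lemma finite_bch_index: "finite (bch_index \<sigma>)"
proof (rule finite_subset)
  show "bch_index \<sigma> \<subseteq> {rs. set rs \<subseteq> {..\<sigma>} \<times> {..\<sigma>} \<and> length rs \<le> \<sigma>}"
    unfolding bch_index_def
    using length_le_bch_length le_bch_length by (fastforce dest: order_trans)
  show "finite {rs. set rs \<subseteq> {..\<sigma>} \<times> {..\<sigma>} \<and> length rs \<le> \<sigma>}"
    by (intro finite_lists_length_le) auto
qed

lemma bch_length_1:
  assumes "1 \<le> \<sigma>"
  shows "{rs \<in> bch_index \<sigma>. \<not> 2 \<le> bch_length rs} = {[(1, 0)], [(0, 1)]}"
proof (intro set_eqI iffI)
  fix rs assume rs: "rs \<in> {rs \<in> bch_index \<sigma>. \<not> 2 \<le> bch_length rs}"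
  then have "rs \<noteq> []" and pos: "\<forall>(r, s)\<in>set rs. 0 < r + s" and "bch_length rs \<le> 1" by (auto simp: bch_index_def)
  with length_le_bch_length[OF pos] have "length rs \<le> 1" by linarith
  with \<open>rs \<noteq> []\<close> obtain r s where a: "rs = [(r, s)]"
    by (cases rs) auto
  then show "rs \<in> {[(1, 0)], [(0, 1)]}" using pos \<open>bch_length rs \<le> 1\<close> by (auto simp: bch_length_def)
next
  fix rs :: "(nat \<times> nat) list" assume "rs \<in> {[(1, 0)], [(0, 1)]}"
  then show "rs \<in> {rs \<in> bch_index \<sigma>. \<not> 2 \<le> bch_length rs}"
    using assms by (auto simp: bch_index_def bch_length_def)
qed

lemma gmult_eq:
  assumes "1 \<le> \<sigma>"
  shows "gmult br \<sigma> x y = x + y + bch_rem br \<sigma> x y"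
proof -
  let ?t = "\<lambda>rs. bch_coeff rs *\<^sub>R pattern_bracket br (bch_pattern rs) x y"
  have "gmult br \<sigma> x y = sum ?t {rs \<in> bch_index \<sigma>. \<not> 2 \<le> bch_length rs} + bch_rem br \<sigma> x y"
    unfolding gmult_pattern bch_rem_def
    by (subst sum.union_disjoint[symmetric]) (auto simp: finite_bch_index intro!: sum.cong)
  also have "sum ?t {rs \<in> bch_index \<sigma>. \<not> 2 \<le> bch_length rs} = x + y"
    unfolding bch_length_1[OF assms]
    by (simp add: bch_coeff_def bch_length_def bch_pattern_def pattern_bracket_def)
  finally show ?thesis .
qed

lemma vec_expand: "z = (\<Sum>k\<in>UNIV. z $ k *\<^sub>R axis k 1)" for z :: "real^'n::finite"
  by (simp add: vec_eq_iff axis_def if_distrib cong: if_cong)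

section \<open>The grading and the triangular form of the group law\<close>

locale stratified_algebra =
  fixes br :: "real^'n::finite \<Rightarrow> real^'n \<Rightarrow> real^'n" and v :: "'n \<Rightarrow> nat" and \<sigma> :: nat
  assumes stratified: "stratified br v \<sigma>"
begin

lemma bil: "bilinear br" and alt: "br x x = 0"
  and jacobi: "br x (br y z) + br y (br z x) + br z (br x y) = 0"
  and \<sigma>_pos: "1 \<le> \<sigma>" and v_pos: "1 \<le> v j" and v_le: "v j \<le> \<sigma>"
  and bracket_layer: "1 \<le> k \<Longrightarrow> k < \<sigma> \<Longrightarrow> bracket_span br (layer v 1) (layer v k) = layer v (k + 1)"
  and bracket_top: "bracket_span br (layer v 1) (layer v \<sigma>) = {0}"
  using stratified by (auto simp: stratified_def lie_bracket_def)

lemma bounded_bil: "bounded_bilinear br"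
  using bil by (simp add: bilinear_conv_bounded_bilinear)

lemma skew: "br x y = - br y x"
proof -
  have "br (x + y) (x + y) = br x y + br y x"
    unfolding bilinear_ladd[OF bil] bilinear_radd[OF bil] by (simp add: alt)
  then show ?thesis using alt[of "x + y"] by (simp add: eq_neg_iff_add_eq_0)
qed

lemma layer_comp: "x \<in> layer v k \<Longrightarrow> v j \<noteq> k \<Longrightarrow> x $ j = 0"
  unfolding layer_def
proof (induction rule: span_induct)
  case base
  show ?case by (auto simp: subspace_def)
next
  case (step x)
  then show ?case by (auto simp: axis_def)
qed

lemma axis_in_layer: "axis j 1 \<in> layer v (v j)"
  unfolding layer_def by (intro span_base) auto

lemma layer_empty:
  assumes "k = 0 \<or> \<sigma> < k" shows "layer v k = {0}"
proof -
  have "v j \<noteq> k" for j using assms v_pos[of j] v_le[of j] by linarith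
  then show ?thesis by (simp add: layer_def)
qed

lemma subspace_layer: "subspace (layer v k)"
  by (simp add: layer_def)

lemma br_layer_1: "x \<in> layer v 1 \<Longrightarrow> y \<in> layer v b \<Longrightarrow> br x y \<in> layer v (b + 1)"
proof -
  assume xy: "x \<in> layer v 1" "y \<in> layer v b"
  have in_span: "br x y \<in> bracket_span br (layer v 1) (layer v b)"
    unfolding bracket_span_def using xy by (intro span_base) auto
  consider "1 \<le> b" "b < \<sigma>" | "b = \<sigma>" | "b = 0 \<or> \<sigma> < b" by linarith
  then show ?thesis
  proof cases
    case 1 then show ?thesis using in_span bracket_layer by simp
  next
    case 2 then show ?thesis using in_span bracket_top subspace_0[OF subspace_layer] by auto
  next
    case 3 then show ?thesis using xy layer_empty subspace_0[OF subspace_layer] by (auto simp: bilinear_rzero[OF bil])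
  qed
qed

text \<open>The stratification only describes brackets with the first layer. An element of layer
  \<open>a + 1\<close> is a combination of brackets \<open>br x1 xa\<close>, and the Jacobi identity
  \<open>[[x1, xa], y] = [x1, [xa, y]] - [xa, [x1, y]]\<close> reduces to smaller \<open>a\<close>.
  Indices outside the range of degrees are harmless since those layers are
  \<open>{0}\<close>.\<close>

lemma br_layer: "x \<in> layer v a \<Longrightarrow> y \<in> layer v b \<Longrightarrow> br x y \<in> layer v (a + b)"
proof (induction a arbitrary: x y b)
  case 0
  then show ?case using layer_empty[of 0] subspace_0[OF subspace_layer] by (auto simp: bilinear_lzero[OF bil])
next
  case (Suc a)
  consider "a = 0" | "1 \<le> a" "a < \<sigma>" | "\<sigma> \<le> a" by linarith
  then show ?case
  proof cases
    case 1 then show ?thesis using br_layer_1 Suc.prems by simp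
  next
    case 2
    then have "x \<in> span {br x y | x y. x \<in> layer v 1 \<and> y \<in> layer v a}"
      using Suc.prems bracket_layer[of a] by (simp add: bracket_span_def)
    then show ?thesis
    proof (induction rule: span_induct)
      case base
      show ?case
        using subspace_layer[of "Suc a + b"]
        by (auto simp: subspace_def bilinear_lzero[OF bil] bilinear_ladd[OF bil] bilinear_lmul[OF bil])
    next
      case (step x)
      then obtain x1 xa where x: "x = br x1 xa" "x1 \<in> layer v 1" "xa \<in> layer v a" by blast
      have "br x y = br x1 (br xa y) - br xa (br x1 y)"
        using jacobi[of x1 xa y] skew[of y "br x1 xa"] skew[of y x1] x(1)
        by (simp add: bilinear_rneg[OF bil] algebra_simps add_eq_0_iff)
      moreover have "br x1 (br xa y) \<in> layer v (Suc a + b)"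
        using br_layer_1[OF x(2) Suc.IH[OF x(3) Suc.prems(2)]] by simp
      moreover have "br xa (br x1 y) \<in> layer v (Suc a + b)"
        using Suc.IH[OF x(3) br_layer_1[OF x(2) Suc.prems(2)]] by simp
      ultimately show ?case using subspace_diff[OF subspace_layer] by simp
    qed
  next
    case 3
    then show ?thesis using Suc.prems layer_empty[of "Suc a"] subspace_0[OF subspace_layer]
      by (auto simp: bilinear_lzero[OF bil])
  qed
qed

text \<open>All degrees are positive, so bracketing a vector whose components have degree at least
  \<open>v j\<close> produces only degrees above \<open>v j\<close>.\<close>

lemma br_comp_eq_0:
  assumes d: "\<And>k. v k < v j \<Longrightarrow> d $ k = 0"
  shows "br d y $ j = 0"
proof -
  have "br d y = (\<Sum>(k, l)\<in>UNIV \<times> UNIV. br (d $ k *\<^sub>R axis k 1) (y $ l *\<^sub>R axis l 1))"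
    by (subst vec_expand[of d], subst vec_expand[of y]) (rule bilinear_sum[OF bil])
  also have "\<dots> $ j = (\<Sum>(k, l)\<in>UNIV \<times> UNIV. d $ k * (y $ l * br (axis k 1) (axis l 1) $ j))"
    by (auto simp: case_prod_unfold bilinear_lmul[OF bil] bilinear_rmul[OF bil] mult_ac intro!: sum.cong)
  also have "\<dots> = 0"
  proof (rule sum.neutral, clarify)
    fix k l
    show "d $ k * (y $ l * br (axis k 1) (axis l 1) $ j) = 0"
    proof (cases "v k < v j")
      case False
      then have "v j \<noteq> v k + v l" using v_pos[of l] by linarith
      then have "br (axis k 1) (axis l 1) $ j = 0"
        by (intro layer_comp[OF br_layer[OF axis_in_layer axis_in_layer]])
      then show ?thesis by simp
    qed (simp add: d)
  qed
  finally show ?thesis .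
qed

text \<open>Congruence modulo the ideal spanned by the basis vectors of degree at least
  \<open>k\<close>.\<close>

definition agree :: "nat \<Rightarrow> real^'n \<Rightarrow> real^'n \<Rightarrow> bool" where
  "agree k x y \<longleftrightarrow> (\<forall>i. v i < k \<longrightarrow> x $ i = y $ i)"

lemma agree_refl [simp]: "agree k x x"
  by (simp add: agree_def)

lemma br_agree:
  assumes "agree (v j) x x'" "agree (v j) y y'"
  shows "br x y $ j = br x' y' $ j"
proof -
  have "br (x - x') y $ j = 0" "br (y - y') x' $ j = 0"
    using assms by (intro br_comp_eq_0; simp add: agree_def)+
  then have "br x y $ j = br x' y $ j" "br x' y $ j = br x' y' $ j"
    using skew[of x' y] skew[of x' y'] by (auto simp: bilinear_lsub[OF bil])
  then show ?thesis by simp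
qed

lemma agree_mono: "agree k x y \<Longrightarrow> l \<le> k \<Longrightarrow> agree l x y"
  by (auto simp: agree_def)

lemma pattern_bracket_agree:
  assumes "agree k x x'" "agree k y y'"
  shows "agree k (pattern_bracket br bs x y) (pattern_bracket br bs x' y')"
proof (induction bs)
  case (Cons b bs)
  show ?case
  proof (cases bs)
    case Nil then show ?thesis using assms by (simp add: pattern_bracket_def)
  next
    case (Cons c cs)
    have "br (if b then y else x) (pattern_bracket br bs x y) $ j = br (if b then y' else x') (pattern_bracket br bs x' y') $ j"
      if "v j < k" for j
      using that assms Cons.IH by (intro br_agree) (auto intro: agree_mono)
    then show ?thesis by (simp add: pattern_bracket_def Cons agree_def)
  qed
qed (simp add: pattern_bracket_def)

text \<open>The outermost bracket raises the degree, so coordinate \<open>j\<close> of the remainder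
  sees only coordinates of smaller degree. Measure preservation and the coordinatewise elimination
  both rest on this triangularity.\<close>

lemma bch_rem_agree:
  assumes "agree (v j) x x'" "agree (v j) y y'"
  shows "bch_rem br \<sigma> x y $ j = bch_rem br \<sigma> x' y' $ j"
proof -
  have "pattern_bracket br bs x y $ j = pattern_bracket br bs x' y' $ j" if len: "2 \<le> length bs" for bs
  proof -
    obtain b bs' where b: "bs = b # bs'" using len by (cases bs) auto
    obtain c cs where "bs' = c # cs" using len b by (cases bs') auto
    with b have bs: "bs = b # c # cs" by simp
    have pb: "pattern_bracket br (b # c # cs) x y = br (if b then y else x) (pattern_bracket br (c # cs) x y)" for x y
      by (simp add: pattern_bracket_def)
    show ?thesis
      unfolding bs pb by (rule br_agree) (use assms pattern_bracket_agree[OF assms] in auto)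
  qed
  then show ?thesis
    unfolding bch_rem_def sum_component
    by (intro sum.cong) (auto simp: length_bch_pattern)
qed

lemma pattern_bracket_bound:
  assumes B: "1 \<le> B" "\<And>x y. norm (br x y) \<le> norm x * norm y * B"
    and M: "1 \<le> M" "norm x \<le> M" "norm y \<le> M"
  shows "norm (pattern_bracket br bs x y) \<le> (B * M) ^ length bs"
proof (induction bs)
  case (Cons b bs)
  have BM: "1 \<le> B * M" using B M mult_mono[of 1 B 1 M] by simp
  have le: "norm (if b then y else x) \<le> M" using M by simp
  show ?case
  proof (cases bs)
    case Nil
    have "M \<le> B * M" using B M by (simp add: mult_le_cancel_right1)
    then show ?thesis using le Nil by (simp add: pattern_bracket_def)
  next
    case (Cons c cs)
    have "norm (pattern_bracket br (b # bs) x y) = norm (br (if b then y else x) (pattern_bracket br bs x y))"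
      by (simp add: pattern_bracket_def Cons)
    also have "\<dots> \<le> norm (if b then y else x) * norm (pattern_bracket br bs x y) * B" by (rule B)
    also have "\<dots> \<le> M * (B * M) ^ length bs * B"
      using le Cons.IH B M by (intro mult_right_mono mult_mono) auto
    finally show ?thesis by (simp add: mult_ac)
  qed
qed (simp add: pattern_bracket_def)

lemma bch_rem_bound: "\<exists>C\<ge>0. \<forall>x y. norm (bch_rem br \<sigma> x y) \<le> C * (1 + norm x + norm y) ^ \<sigma>"
proof -
  obtain B0 where B0: "\<And>x y. norm (br x y) \<le> norm x * norm y * B0"
    using bounded_bilinear.bounded[OF bounded_bil] by blast
  \<comment> \<open>Kept at least one so that powers of \<open>B * M\<close> increase and every term
    is bounded by the power \<open>\<sigma>\<close>.\<close>
  define B where "B = max 1 B0"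
  have B: "1 \<le> B" "norm (br x y) \<le> norm x * norm y * B" for x y
  proof -
    show "norm (br x y) \<le> norm x * norm y * B"
      by (rule order_trans[OF B0]) (auto simp: B_def intro!: mult_left_mono)
  qed (simp add: B_def)
  let ?I = "{rs \<in> bch_index \<sigma>. 2 \<le> bch_length rs}"
  have "norm (bch_rem br \<sigma> x y) \<le> (\<Sum>rs\<in>?I. \<bar>bch_coeff rs\<bar>) * B ^ \<sigma> * (1 + norm x + norm y) ^ \<sigma>" for x y
  proof -
    define M where "M = 1 + norm x + norm y"
    have M: "1 \<le> M" "norm x \<le> M" "norm y \<le> M" by (auto simp: M_def)
    have BM: "1 \<le> B * M" using B(1) M mult_mono[of 1 B 1 M] by simp
    have "norm (bch_rem br \<sigma> x y) \<le> (\<Sum>rs\<in>?I. \<bar>bch_coeff rs\<bar> * (B * M) ^ \<sigma>)"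
      unfolding bch_rem_def
    proof (rule sum_norm_le)
      fix rs assume rs: "rs \<in> ?I"
      have "norm (pattern_bracket br (bch_pattern rs) x y) \<le> (B * M) ^ bch_length rs"
        using pattern_bracket_bound[OF B M, of "bch_pattern rs"] by (simp add: length_bch_pattern)
      also have "\<dots> \<le> (B * M) ^ \<sigma>" using rs BM by (intro power_increasing) (auto simp: bch_index_def)
      finally show "norm (bch_coeff rs *\<^sub>R pattern_bracket br (bch_pattern rs) x y) \<le> \<bar>bch_coeff rs\<bar> * (B * M) ^ \<sigma>"
        by (simp add: mult_left_mono)
    qed
    also have "\<dots> = (\<Sum>rs\<in>?I. \<bar>bch_coeff rs\<bar>) * B ^ \<sigma> * M ^ \<sigma>"
      by (simp add: sum_distrib_right[symmetric] power_mult_distrib mult.assoc)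
    finally show ?thesis by (simp add: M_def)
  qed
  moreover have "0 \<le> (\<Sum>rs\<in>?I. \<bar>bch_coeff rs\<bar>) * B ^ \<sigma>" using B(1) by (intro mult_nonneg_nonneg sum_nonneg) auto
  ultimately show ?thesis by blast
qed

lemma continuous_pattern_bracket: "continuous_on UNIV (pattern_bracket br bs x)"
proof (induction bs)
  case (Cons b bs)
  show ?case
  proof (cases bs)
    case Nil then show ?thesis by (cases b) (auto simp: pattern_bracket_def[abs_def])
  next
    case (Cons c cs)
    have "pattern_bracket br (b # bs) x = (\<lambda>y. br (if b then y else x) (pattern_bracket br bs x y))"
      by (simp add: fun_eq_iff pattern_bracket_def Cons)
    moreover have "continuous_on UNIV (\<lambda>y. if b then y else x)" by (cases b) auto
    ultimately show ?thesis
      using bounded_bilinear.continuous_on[OF bounded_bil _ Cons.IH] by simp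
  qed
qed (simp add: pattern_bracket_def[abs_def])

lemma continuous_bch_rem: "continuous_on UNIV (bch_rem br \<sigma> x)"
  unfolding bch_rem_def[abs_def] by (intro continuous_intros continuous_pattern_bracket)

subsection \<open>Left translations are measure preserving\<close>

text \<open>Left translation is a composition of shears, one per coordinate. \<open>T A\<close>
  carries out those in \<open>A\<close>. A new coordinate \<open>j\<close> has maximal degree, and
  its shear comes first: the shifts \<open>q i\<close> for \<open>i\<close> in \<open>A\<close>
  depend only on coordinates of degree below \<open>v i\<close>, so they do not notice it.\<close>

lemma nn_integral_gmult:
  fixes f :: "real^'n \<Rightarrow> ennreal"
  assumes [measurable]: "f \<in> borel_measurable borel"
  shows "(\<integral>\<^sup>+y. f (gmult br \<sigma> c y) \<partial>lborel) = (\<integral>\<^sup>+y. f y \<partial>lborel)"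
proof -
  define q where "q j y = c $ j + bch_rem br \<sigma> c y $ j" for j y
  have [measurable]: "q j \<in> borel_measurable borel" for j
    unfolding q_def[abs_def]
    by (intro borel_measurable_continuous_onI continuous_intros continuous_bch_rem)
  define T where "T A y = (\<chi> j. if j \<in> A then y $ j + q j y else y $ j)" for A and y :: "real^'n"
  have q_agree: "q j y = q j y'" if "agree (v j) y y'" for j y y'
    unfolding q_def using bch_rem_agree[OF agree_refl that] by simp
  have [measurable]: "T A \<in> borel_measurable borel" for A
  proof -
    have [measurable]: "(\<lambda>y. T A y $ j) \<in> borel_measurable borel" for j
      by (cases "j \<in> A") (auto simp: T_def)
    have "T A = (\<lambda>y. \<Sum>j\<in>UNIV. T A y $ j *\<^sub>R axis j 1)" by (rule ext) (rule vec_expand)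
    moreover have "\<dots> \<in> borel_measurable borel" by measurable
    ultimately show ?thesis by (simp only:)
  qed
  have "(\<integral>\<^sup>+y. f (T A y) \<partial>lborel) = (\<integral>\<^sup>+y. f y \<partial>lborel)" for A
    using finite[of A]
  proof (induction A rule: finite_ranking_induct[where f=v])
    case empty
    then show ?case by (simp add: T_def)
  next
    case (insert j A)
    show ?case
    proof (cases "j \<in> A")
      case True then show ?thesis using insert by (simp add: insert_absorb)
    next
      case False
      have shear: "T (Set.insert j A) y = T A (y + q j y *\<^sub>R axis j 1)" for y
      proof -
        have "q i (y + q j y *\<^sub>R axis j 1) = q i y" if "i \<in> A" for i
          using insert(2)[OF that] by (intro q_agree) (auto simp: agree_def axis_def)
        then show ?thesis using False by (auto simp: T_def vec_eq_iff axis_def)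
      qed
      have "(\<integral>\<^sup>+y. f (T (Set.insert j A) y) \<partial>lborel) = (\<integral>\<^sup>+y. (\<lambda>y. f (T A y)) (y + q j y *\<^sub>R axis j 1) \<partial>lborel)"
        by (simp add: shear)
      also have "\<dots> = (\<integral>\<^sup>+y. f (T A y) \<partial>lborel)"
        by (rule nn_integral_shear) (auto intro!: q_agree simp: agree_def axis_def)
      finally show ?thesis using insert by simp
    qed
  qed
  from this[of UNIV] show ?thesis
    by (simp add: T_def q_def gmult_eq[OF \<sigma>_pos] plus_vec_def algebra_simps)
qed

lemma continuous_gmult: "continuous_on UNIV (gmult br \<sigma> c)"
proof -
  have "gmult br \<sigma> c = (\<lambda>y. c + y + bch_rem br \<sigma> c y)" by (simp add: fun_eq_iff gmult_eq[OF \<sigma>_pos])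
  then show ?thesis by (simp add: continuous_intros continuous_bch_rem)
qed

subsection \<open>Points with a common bounded left translate\<close>

text \<open>A representative modulo \<open>agree k\<close> to which \<open>bch_rem_bound\<close> can
  be applied while only the coordinates of degree below \<open>k\<close> are under control.\<close>

definition trunc :: "nat \<Rightarrow> real^'n \<Rightarrow> real^'n" where
  "trunc k x = (\<chi> i. if v i < k then x $ i else 0)"

lemma bch_rem_trunc: "bch_rem br \<sigma> x y $ j = bch_rem br \<sigma> (trunc (v j) x) (trunc (v j) y) $ j"
  by (rule bch_rem_agree) (auto simp: agree_def trunc_def)

lemma norm_trunc_le:
  assumes "\<And>i. v i < k \<Longrightarrow> \<bar>x $ i\<bar> \<le> M" "0 \<le> M"
  shows "norm (trunc k x) \<le> real CARD('n) * M"
proof -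
  have "norm (trunc k x) \<le> (\<Sum>i\<in>UNIV. \<bar>trunc k x $ i\<bar>)" by (rule norm_le_l1_cart)
  also have "\<dots> \<le> (\<Sum>i\<in>(UNIV::'n set). M)" using assms by (intro sum_mono) (auto simp: trunc_def)
  finally show ?thesis by simp
qed

lemma norm_trunc_le_norm: "norm (trunc k x) \<le> real CARD('n) * norm x"
  by (rule norm_trunc_le) (auto simp: component_le_norm_cart)

text \<open>If \<open>z = - c * x\<close> and \<open>z' = - c * x'\<close> are bounded, then solving coordinate by coordinate, in order of degree,
  first for \<open>c\<close> in terms of \<open>x\<close>, \<open>z\<close> and then for \<open>x'\<close> in terms of \<open>c\<close>, \<open>z'\<close> avoids the associativity of the
  group law.\<close>

lemma common_translate_coords:
  assumes R: "0 \<le> R"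
  shows "\<exists>A\<ge>0. \<exists>m. \<forall>c x x'. norm (gmult br \<sigma> (- c) x) \<le> R \<longrightarrow> norm (gmult br \<sigma> (- c) x') \<le> R \<longrightarrow>
    (\<forall>j. v j < k \<longrightarrow> \<bar>c $ j\<bar> \<le> A * (1 + norm x) ^ m \<and> \<bar>x' $ j\<bar> \<le> A * (1 + norm x) ^ m)"
proof (induction k)
  case 0
  then show ?case by (intro exI[of _ 0]) auto
next
  case (Suc k)
  obtain A m where A: "0 \<le> A" and IH: "\<And>c x x' j. norm (gmult br \<sigma> (- c) x) \<le> R \<Longrightarrow> norm (gmult br \<sigma> (- c) x') \<le> R \<Longrightarrow>
    v j < k \<Longrightarrow> \<bar>c $ j\<bar> \<le> A * (1 + norm x) ^ m \<and> \<bar>x' $ j\<bar> \<le> A * (1 + norm x) ^ m"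
    using Suc.IH by blast
  obtain C where C: "0 \<le> C" "\<And>x y. norm (bch_rem br \<sigma> x y) \<le> C * (1 + norm x + norm y) ^ \<sigma>"
    using bch_rem_bound by blast
  define N where "N = real CARD('n)"
  have N: "0 \<le> N" by (simp add: N_def)
  \<comment> \<open>The truncated arguments of the remainder are of order \<open>Y ^ (m + 1)\<close>
    with \<open>Y = 1 + norm x\<close>, and \<open>bch_rem_bound\<close> raises this to the power
    \<open>\<sigma>\<close>; \<open>D\<close> collects the constants and \<open>M\<close> absorbs
    the exponent.\<close>
  define D where "D = C * (1 + N + 2 * N * A) ^ \<sigma>"
  have D: "0 \<le> D" using A N C by (simp add: D_def)
  define M where "M = (m + 1) * \<sigma> + 1"
  have M: "m \<le> M" "1 \<le> M" "(m + 1) * \<sigma> \<le> M"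
    using \<sigma>_pos mult_le_mono2[of 1 \<sigma> "m + 1"] by (auto simp: M_def)
  \<comment> \<open>\<open>A\<close> for the coordinates already treated, one for
    \<open>x $ j\<close>, and \<open>R + D\<close> twice: once in solving for \<open>c $ j\<close>
    and once more for \<open>x' $ j\<close>.\<close>
  define A' where "A' = A + (1 + 2 * R + 2 * D)"
  show ?case
  proof (intro exI[of _ A'] exI[of _ M] conjI allI impI)
    show "0 \<le> A'" using A R D by (simp add: A'_def)
    fix c x x' j
    assume z: "norm (gmult br \<sigma> (- c) x) \<le> R" "norm (gmult br \<sigma> (- c) x') \<le> R" and j: "v j < Suc k"
    define Y where "Y = 1 + norm x"
    have Y: "1 \<le> Y" "norm x \<le> Y" by (simp_all add: Y_def)
    have YM: "1 \<le> Y ^ M" "Y \<le> Y ^ M" "Y ^ m \<le> Y ^ M" "Y ^ ((m + 1) * \<sigma>) \<le> Y ^ M"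
      using Y M power_increasing[of 1 M Y] by (auto intro: power_increasing one_le_power)
    have "\<bar>c $ j\<bar> \<le> A' * Y ^ M \<and> \<bar>x' $ j\<bar> \<le> A' * Y ^ M"
    proof (cases "v j < k")
      case True
      have "A * Y ^ m \<le> A' * Y ^ M"
        using A R D YM Y by (intro mult_mono zero_le_power) (auto simp: A'_def)
      then show ?thesis using IH[OF z True] by (auto simp: Y_def)
    next
      case False
      with j have vj: "v j = k" by simp
      have AY: "0 \<le> A * Y ^ m" using A Y by simp
      have tc: "norm (trunc k (- c)) \<le> N * (A * Y ^ m)" unfolding N_def
        using IH[OF z] AY by (intro norm_trunc_le) (auto simp: Y_def)
      have tx': "norm (trunc k x') \<le> N * (A * Y ^ m)" unfolding N_def
        using IH[OF z] AY by (intro norm_trunc_le) (auto simp: Y_def)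
      have tx: "norm (trunc k x) \<le> N * Y"
        using norm_trunc_le_norm[of k x] mult_left_mono[OF Y(2) N] unfolding N_def by linarith
      \<comment> \<open>The assumption on \<open>y\<close> leaves room for both applications:
        \<open>trunc k x\<close> is of order \<open>Y\<close>, \<open>trunc k x'\<close> of order
        \<open>Y ^ m\<close>.\<close>
      have rem: "\<bar>bch_rem br \<sigma> (- c) y $ j\<bar> \<le> D * Y ^ M" if y: "norm (trunc k y) \<le> N * Y + N * (A * Y ^ m)" for y
      proof -
        have "Y ^ m \<le> Y ^ (m + 1)" "Y \<le> Y ^ (m + 1)"
          using Y power_increasing[of 1 "m + 1" Y] by (auto intro: power_increasing)
        then have Ym: "N * (A * Y ^ m) \<le> N * (A * Y ^ (m + 1))" "N * Y \<le> N * Y ^ (m + 1)" "1 \<le> Y ^ (m + 1)"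
          using N A Y by (auto intro!: mult_left_mono one_le_power simp del: power_Suc)
        have "\<bar>bch_rem br \<sigma> (- c) y $ j\<bar> \<le> norm (bch_rem br \<sigma> (trunc k (- c)) (trunc k y))"
          unfolding bch_rem_trunc[of "- c" y j] vj by (rule component_le_norm_cart)
        also have "\<dots> \<le> C * (1 + norm (trunc k (- c)) + norm (trunc k y)) ^ \<sigma>" by (rule C)
        also have "\<dots> \<le> C * ((1 + N + 2 * N * A) * Y ^ (m + 1)) ^ \<sigma>"
        proof (intro mult_left_mono power_mono C)
          have "1 + norm (trunc k (- c)) + norm (trunc k y) \<le> 1 + N * Y + 2 * (N * (A * Y ^ m))"
            using tc y by linarith
          also have "\<dots> \<le> Y ^ (m + 1) + N * Y ^ (m + 1) + 2 * (N * (A * Y ^ (m + 1)))"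
            using Ym by linarith
          also have "\<dots> = (1 + N + 2 * N * A) * Y ^ (m + 1)"
            unfolding distrib_right by (simp only: mult_1_left mult.assoc)
          finally show "1 + norm (trunc k (- c)) + norm (trunc k y) \<le> (1 + N + 2 * N * A) * Y ^ (m + 1)" .
        qed simp
        also have "\<dots> = D * Y ^ ((m + 1) * \<sigma>)"
          unfolding D_def power_mult_distrib power_mult by (rule mult.assoc[symmetric])
        also have "\<dots> \<le> D * Y ^ M" by (intro mult_left_mono YM D)
        finally show ?thesis .
      qed
      have comp: "gmult br \<sigma> (- c) y $ j = - c $ j + y $ j + bch_rem br \<sigma> (- c) y $ j" for y
        by (simp add: gmult_eq[OF \<sigma>_pos])
      have zj: "\<bar>gmult br \<sigma> (- c) x $ j\<bar> \<le> R" "\<bar>gmult br \<sigma> (- c) x' $ j\<bar> \<le> R"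
        using z component_le_norm_cart order_trans by blast+
      have r1: "\<bar>bch_rem br \<sigma> (- c) x $ j\<bar> \<le> D * Y ^ M"
        using tx mult_nonneg_nonneg[OF N AY] by (intro rem) linarith
      have r2: "\<bar>bch_rem br \<sigma> (- c) x' $ j\<bar> \<le> D * Y ^ M"
        using tx' mult_nonneg_nonneg[OF N, of Y] Y by (intro rem) linarith
      have xj: "\<bar>x $ j\<bar> \<le> Y" using component_le_norm_cart[of x j] Y by linarith
      have RY: "R \<le> R * Y ^ M" using R YM(1) mult_left_mono[of 1 "Y ^ M" R] by simp
      have c1: "\<bar>c $ j\<bar> \<le> Y ^ M + R * Y ^ M + D * Y ^ M"
        using comp[of x] zj(1) r1 xj RY YM(2) by linarith
      have c2: "\<bar>x' $ j\<bar> \<le> Y ^ M + 2 * (R * Y ^ M) + 2 * (D * Y ^ M)"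
        using comp[of x'] zj(2) r2 c1 RY by linarith
      have "0 \<le> A * Y ^ M" "0 \<le> R * Y ^ M" "0 \<le> D * Y ^ M" using A R D Y by auto
      moreover have "A' * Y ^ M = A * Y ^ M + Y ^ M + 2 * (R * Y ^ M) + 2 * (D * Y ^ M)"
        by (simp add: A'_def algebra_simps)
      ultimately show ?thesis using c1 c2 by linarith
    qed
    then show "\<bar>c $ j\<bar> \<le> A' * (1 + norm x) ^ M" "\<bar>x' $ j\<bar> \<le> A' * (1 + norm x) ^ M"
      by (simp_all add: Y_def)
  qed
qed

lemma common_translate:
  assumes R: "0 \<le> R"
  shows "\<exists>A\<ge>0. \<exists>m. \<forall>c x x'. norm (gmult br \<sigma> (- c) x) \<le> R \<longrightarrow> norm (gmult br \<sigma> (- c) x') \<le> R \<longrightarrow>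
    1 + norm x' \<le> A * (1 + norm x) ^ m"
proof -
  obtain A m where A: "0 \<le> A" and b: "\<And>c x x' j. norm (gmult br \<sigma> (- c) x) \<le> R \<Longrightarrow> norm (gmult br \<sigma> (- c) x') \<le> R \<Longrightarrow>
    v j < Suc \<sigma> \<Longrightarrow> \<bar>x' $ j\<bar> \<le> A * (1 + norm x) ^ m"
    using common_translate_coords[OF R, of "Suc \<sigma>"] by blast
  have "1 + norm x' \<le> (1 + real CARD('n) * A) * (1 + norm x) ^ m"
    if "norm (gmult br \<sigma> (- c) x) \<le> R" "norm (gmult br \<sigma> (- c) x') \<le> R" for c x x'
  proof -
    have "norm x' \<le> (\<Sum>j\<in>UNIV. \<bar>x' $ j\<bar>)" by (rule norm_le_l1_cart)
    also have "\<dots> \<le> (\<Sum>j\<in>(UNIV::'n set). A * (1 + norm x) ^ m)"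
      using b[OF that] v_le by (intro sum_mono) (auto simp: less_Suc_eq_le)
    finally have "norm x' \<le> real CARD('n) * (A * (1 + norm x) ^ m)" by simp
    moreover have "1 \<le> (1 + norm x) ^ m" by (simp add: one_le_power)
    moreover have "(1 + real CARD('n) * A) * (1 + norm x) ^ m = (1 + norm x) ^ m + real CARD('n) * (A * (1 + norm x) ^ m)"
      by (simp only: distrib_right mult_1_left mult.assoc)
    ultimately show ?thesis by linarith
  qed
  then show ?thesis using A by (intro exI[of _ "1 + real CARD('n) * A"] conjI exI[of _ m]) auto
qed

end

section \<open>Quasi-norms and \<open>\<alpha>\<close>-coverings\<close>

locale quasi_normed_algebra = stratified_algebra br v \<sigma>
  for br :: "real^'n::finite \<Rightarrow> real^'n \<Rightarrow> real^'n" and v \<sigma> +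
  fixes nrm :: "real^'n \<Rightarrow> real"
  assumes quasi_norm: "homogeneous_quasi_norm v nrm"
begin

lemma nrm_continuous: "continuous_on A nrm" and nrm_nonneg: "0 \<le> nrm x"
  and nrm_dilation: "0 < r \<Longrightarrow> nrm (dilation v r x) = r * nrm x"
  and nrm_eq_0: "nrm x = 0 \<Longrightarrow> x = 0"
  using quasi_norm by (auto simp: homogeneous_quasi_norm_def intro: continuous_on_subset)

lemma nrm_0: "nrm 0 = 0"
proof -
  have "dilation v 2 0 = 0" by (simp add: dilation_def vec_eq_iff)
  then show ?thesis using nrm_dilation[of 2 0] by simp
qed

lemma dilation_inverse: "0 < r \<Longrightarrow> dilation v r (dilation v (1 / r) x) = x"
  by (simp add: dilation_def vec_eq_iff power_divide)

lemma nrm_inverse_dilation: "0 < r \<Longrightarrow> nrm x = r * nrm (dilation v (1 / r) x)"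
  using nrm_dilation[of r "dilation v (1 / r) x"] by (simp add: dilation_inverse)

lemma dilation_comp_le:
  assumes "1 \<le> r" shows "\<bar>dilation v (1 / r) x $ j\<bar> \<le> \<bar>x $ j\<bar> / r"
proof -
  have "r ^ 1 \<le> r ^ v j" using assms v_pos by (intro power_increasing) auto
  then have "\<bar>x $ j\<bar> / r ^ v j \<le> \<bar>x $ j\<bar> / r" using assms by (intro divide_left_mono mult_pos_pos) auto
  then show ?thesis using assms by (simp add: dilation_def abs_mult power_divide)
qed

text \<open>Dilation by \<open>1 / (1 + norm x)\<close> carries \<open>x\<close> into a fixed
  compact ball, where \<open>nrm\<close> is bounded; homogeneity restores the factor.\<close>

lemma nrm_le: "\<exists>A\<ge>0. \<forall>x. nrm x \<le> A * (1 + norm x)"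
proof -
  let ?N = "real CARD('n)"
  have "bounded (nrm ` cball 0 ?N)"
    by (intro compact_imp_bounded compact_continuous_image nrm_continuous compact_cball)
  then obtain A where "\<forall>z\<in>nrm ` cball 0 ?N. norm z \<le> A" unfolding bounded_iff ..
  then have A: "\<bar>nrm y\<bar> \<le> A" if "norm y \<le> ?N" for y using that by auto
  have "nrm x \<le> A * (1 + norm x)" for x
  proof -
    define r where "r = 1 + norm x"
    have r: "1 \<le> r" "0 < r" by (simp_all add: r_def)
    have "norm (dilation v (1 / r) x) \<le> (\<Sum>j\<in>UNIV. \<bar>dilation v (1 / r) x $ j\<bar>)" by (rule norm_le_l1_cart)
    also have "\<dots> \<le> (\<Sum>j\<in>(UNIV::'n set). 1)"
    proof (rule sum_mono)
      fix j
      have "\<bar>x $ j\<bar> / r \<le> 1" using component_le_norm_cart[of x j] r by (simp add: r_def)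
      then show "\<bar>dilation v (1 / r) x $ j\<bar> \<le> 1" using dilation_comp_le[OF r(1), of x j] by linarith
    qed
    finally have "nrm (dilation v (1 / r) x) \<le> A" using A abs_le_D1 by fastforce
    then have "r * nrm (dilation v (1 / r) x) \<le> r * A" using r by simp
    then show ?thesis using nrm_inverse_dilation[OF r(2), of x] by (simp add: r_def mult.commute)
  qed
  moreover have "0 \<le> A" using A[of 0] nrm_0 by simp
  ultimately show ?thesis by blast
qed

text \<open>\<open>nrm\<close> has a positive minimum \<open>\<mu>\<close> on the Euclidean sphere
  and stays above it outside. A dilation by a factor of order \<open>1 + nrm x\<close> therefore
  brings \<open>x\<close> into the unit ball, and undoing it costs at most the power
  \<open>\<sigma>\<close> in each coordinate.\<close>

lemma norm_le_nrm: "\<exists>A\<ge>0. \<forall>x. norm x \<le> A * (1 + nrm x) ^ \<sigma>"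
proof -
  have "axis undefined 1 \<in> sphere (0::real^'n) 1" by (simp add: norm_axis_1)
  then obtain y0 where y0: "y0 \<in> sphere (0::real^'n) 1" "\<And>y. y \<in> sphere 0 1 \<Longrightarrow> nrm y0 \<le> nrm y"
    using continuous_attains_inf[of "sphere (0::real^'n) 1" nrm] nrm_continuous by (metis compact_sphere empty_iff)
  define \<mu> where "\<mu> = nrm y0"
  have \<mu>: "0 < \<mu>" using y0(1) nrm_nonneg[of y0] nrm_eq_0[of y0] by (force simp: \<mu>_def)
  \<comment> \<open>The dilation path from 0 to \<open>x\<close> crosses the unit sphere, and
    \<open>nrm\<close> grows linearly along it.\<close>
  have big: "\<mu> \<le> nrm x" if x: "1 < norm x" for x
  proof -
    have "continuous_on {0..1} (\<lambda>t. norm (dilation v t x))"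
      unfolding dilation_def by (intro continuous_intros)
    moreover have v_nonzero: "v i \<noteq> 0" for i using v_pos[of i] by linarith
    have "dilation v 0 x = 0" "dilation v 1 x = x"
      by (simp_all add: dilation_def vec_eq_iff power_0_left v_nonzero)
    ultimately obtain t where t: "0 \<le> t" "t \<le> 1" "norm (dilation v t x) = 1"
      using IVT'[of "\<lambda>t. norm (dilation v t x)" 0 1 1] x by auto
    have "t \<noteq> 0" using t(3) \<open>dilation v 0 x = 0\<close> by auto
    then have "t * nrm x = nrm (dilation v t x)" using nrm_dilation[of t x] t by simp
    also have "\<mu> \<le> \<dots>" unfolding \<mu>_def using t by (intro y0) simp
    finally have "\<mu> \<le> t * nrm x" .
    also have "\<dots> \<le> nrm x" using t nrm_nonneg[of x] by (simp add: mult_left_le_one_le)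
    finally show ?thesis .
  qed
  \<comment> \<open>The factor 2 gives the strict inequality \<open>nrm x < \<mu> * r\<close>
    below.\<close>
  define b where "b = max 1 (2 / \<mu>)"
  have b: "1 \<le> b" "2 / \<mu> \<le> b" by (simp_all add: b_def)
  have "norm x \<le> (real CARD('n) * b ^ \<sigma>) * (1 + nrm x) ^ \<sigma>" for x
  proof -
    define r where "r = b * (1 + nrm x)"
    have r: "1 \<le> r" "0 < r"
      using b nrm_nonneg[of x] mult_mono[of 1 b 1 "1 + nrm x"] by (auto simp: r_def)
    have "nrm x < \<mu> * r"
    proof -
      have "nrm x < (\<mu> * (2 / \<mu>)) * (1 + nrm x)" using \<mu> nrm_nonneg[of x] by simp
      also have "\<dots> \<le> (\<mu> * b) * (1 + nrm x)" using b \<mu> nrm_nonneg[of x] by (intro mult_right_mono mult_left_mono) auto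
      finally show ?thesis by (simp add: r_def mult.assoc)
    qed
    then have "nrm (dilation v (1 / r) x) < \<mu>"
      using nrm_inverse_dilation[OF r(2), of x] r by (simp add: mult.commute)
    then have le1: "norm (dilation v (1 / r) x) \<le> 1" using big not_le by (metis linorder_not_less)
    have "\<bar>x $ j\<bar> \<le> r ^ \<sigma>" for j
    proof -
      have "\<bar>dilation v (1 / r) x $ j\<bar> \<le> 1" using component_le_norm_cart le1 order_trans by blast
      then have "\<bar>x $ j\<bar> \<le> r ^ v j" using r by (simp add: dilation_def abs_mult power_divide)
      also have "\<dots> \<le> r ^ \<sigma>" using r v_le by (intro power_increasing) auto
      finally show ?thesis .
    qed
    then have "(\<Sum>j\<in>UNIV. \<bar>x $ j\<bar>) \<le> (\<Sum>j\<in>(UNIV::'n set). r ^ \<sigma>)" by (intro sum_mono)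
    then show ?thesis using norm_le_l1_cart[of x] by (simp add: r_def power_mult_distrib mult.assoc)
  qed
  then show ?thesis using b by (intro exI[of _ "real CARD('n) * b ^ \<sigma>"]) auto
qed

section \<open>Volumes and radii of quasi-balls\<close>

lemma emeasure_qball:
  "qball br \<sigma> nrm c r \<in> sets borel"
  "emeasure lborel (qball br \<sigma> nrm c r) = emeasure lborel {y. nrm y < r}"
proof -
  have [measurable]: "nrm \<in> borel_measurable borel" "gmult br \<sigma> (- c) \<in> borel_measurable borel"
    by (intro borel_measurable_continuous_onI nrm_continuous continuous_gmult)+
  show m: "qball br \<sigma> nrm c r \<in> sets borel" unfolding qball_def by measurable
  have "emeasure lborel (qball br \<sigma> nrm c r) = (\<integral>\<^sup>+y. indicator (qball br \<sigma> nrm c r) y \<partial>lborel)"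
    using m by simp
  also have "\<dots> = (\<integral>\<^sup>+y. indicator {y. nrm y < r} (gmult br \<sigma> (- c) y) \<partial>lborel)"
    by (intro nn_integral_cong) (auto simp: qball_def indicator_def)
  also have "\<dots> = (\<integral>\<^sup>+y. indicator {y. nrm y < r} y \<partial>lborel)" by (rule nn_integral_gmult) measurable
  also have "\<dots> = emeasure lborel {y. nrm y < r}" by (rule nn_integral_indicator) measurable
  finally show "emeasure lborel (qball br \<sigma> nrm c r) = emeasure lborel {y. nrm y < r}" .
qed

text \<open>For \<open>r \<ge> 1\<close> the dilation by \<open>1 / r\<close> shrinks every
  coordinate at least by \<open>r\<close>, so the ball contains a Euclidean cube of side
  proportional to \<open>r\<close>. This growth already suffices to bound inner radii; invariance
  makes it uniform in the centre.\<close>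

lemma qball_large: "\<exists>\<delta>>0. \<forall>r\<ge>1. \<forall>c. ennreal ((\<delta> * r) ^ CARD('n)) \<le> emeasure lborel (qball br \<sigma> nrm c r)"
proof -
  let ?N = "real CARD('n)"
  have "isCont nrm 0" using nrm_continuous[of UNIV] by (simp add: continuous_on_eq_continuous_at)
  then obtain e where e: "0 < e" "\<And>x. norm x < e \<Longrightarrow> nrm x < 1"
    unfolding continuous_at_eps_delta by (metis abs_less_iff dist_norm diff_zero nrm_0 real_norm_def zero_less_one)
  define \<delta> where "\<delta> = e / (2 * ?N)"
  have \<delta>: "0 < \<delta>" using e by (simp add: \<delta>_def)
  have "ennreal ((2 * \<delta> * r) ^ CARD('n)) \<le> emeasure lborel (qball br \<sigma> nrm c r)" if r: "1 \<le> r" for r c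
  proof -
    define u :: "real^'n" where "u = (\<chi> j. \<delta> * r)"
    have "cbox (- u) u \<subseteq> {y. nrm y < r}"
    proof
      fix x assume "x \<in> cbox (- u) u"
      then have x: "\<bar>x $ j\<bar> \<le> \<delta> * r" for j by (auto simp: mem_box_cart u_def abs_le_iff minus_le_iff)
      have "norm (dilation v (1 / r) x) \<le> (\<Sum>j\<in>UNIV. \<bar>dilation v (1 / r) x $ j\<bar>)" by (rule norm_le_l1_cart)
      also have "\<dots> \<le> (\<Sum>j\<in>(UNIV::'n set). \<delta>)"
      proof (rule sum_mono)
        fix j
        have "\<bar>x $ j\<bar> / r \<le> \<delta>" using x[of j] r by (simp add: pos_divide_le_eq)
        then show "\<bar>dilation v (1 / r) x $ j\<bar> \<le> \<delta>" using dilation_comp_le[OF r, of x j] by linarith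
      qed
      also have "\<dots> = e / 2" by (simp add: \<delta>_def)
      finally have "nrm (dilation v (1 / r) x) < 1" using e by (intro e) simp
      then show "x \<in> {y. nrm y < r}" using nrm_inverse_dilation[of r x] r by simp
    qed
    moreover have [measurable]: "nrm \<in> borel_measurable borel"
      by (intro borel_measurable_continuous_onI nrm_continuous)
    ultimately have "emeasure lborel (cbox (- u) u) \<le> emeasure lborel {y. nrm y < r}"
      by (intro emeasure_mono) auto
    moreover have "emeasure lborel (cbox (- u) u) = ennreal ((2 * \<delta> * r) ^ CARD('n))"
    proof -
      have u: "u \<bullet> b = \<delta> * r" if "b \<in> Basis" for b
        using that by (auto simp: Basis_vec_def u_def inner_axis)
      have "(\<Prod>b\<in>Basis. (u - (- u)) \<bullet> b) = (\<Prod>b\<in>(Basis :: (real^'n) set). 2 * \<delta> * r)"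
        by (rule prod.cong, rule refl) (simp only: inner_diff_left inner_minus_left u diff_minus_eq_add mult_2 distrib_right inner_add_left)
      then show ?thesis using \<delta> r
        by (simp add: emeasure_lborel_cbox_eq u del: diff_minus_eq_add)
    qed
    ultimately show ?thesis by (simp add: emeasure_qball)
  qed
  then show ?thesis using \<delta> by (intro exI[of _ "2 * \<delta>"]) auto
qed

lemma hom_dim_pos: "0 < hom_dim v \<sigma>"
proof -
  define j :: 'n where "j = undefined"
  have "axis j 1 \<noteq> (0::real^'n)" by (simp add: axis_eq_0_iff)
  then have "\<not> layer v (v j) \<subseteq> {0}" using axis_in_layer[of j] by blast
  then have "0 < dim (layer v (v j))" using dim_eq_0[of "layer v (v j)"] by linarith
  then have "0 < v j * dim (layer v (v j))" using v_pos[of j] by simp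
  also have "\<dots> \<le> hom_dim v \<sigma>"
    unfolding hom_dim_def using v_pos[of j] v_le[of j] by (intro member_le_sum) auto
  finally show ?thesis .
qed

text \<open>Bounded volume bounds the inner radius, and the ratio transfers this to the outer one.
  The summand 1 gives room because the infimum defining the outer radius may not be
  attained.\<close>

lemma bounded_outer_radius:
  assumes P: "P i \<noteq> {}" "emeasure lborel (P i) \<le> ennreal C" "P i \<in> sets borel"
    and ratio: "outer_radius br \<sigma> nrm (P i) / inner_radius br \<sigma> nrm (P i) \<le> ennreal \<Lambda>"
    and \<delta>: "0 < \<delta>" "\<And>r c. 1 \<le> r \<Longrightarrow> ennreal ((\<delta> * r) ^ CARD('n)) \<le> emeasure lborel (qball br \<sigma> nrm c r)"
    and pos: "0 \<le> C" "0 \<le> \<Lambda>"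
  shows "\<exists>c. P i \<subseteq> qball br \<sigma> nrm c (\<Lambda> * max 1 ((1 + C) / \<delta>) + 1)"
proof -
  \<comment> \<open>For \<open>r > r0\<close> one has \<open>\<delta> * r > 1 + C\<close>, so the
    ball has measure at least \<open>(\<delta> * r) ^ CARD('n) \<ge> \<delta> * r > C\<close>, too
    much for \<open>P i\<close>.\<close>
  define r0 where "r0 = max 1 ((1 + C) / \<delta>)"
  have "inner_radius br \<sigma> nrm (P i) \<le> ennreal r0"
    unfolding inner_radius_def
  proof (rule Sup_least, clarify)
    fix r c assume sub: "qball br \<sigma> nrm c r \<subseteq> P i"
    have "r \<le> r0"
    proof (rule ccontr)
      assume "\<not> r \<le> r0"
      then have r: "1 \<le> r" "(1 + C) / \<delta> < r" by (auto simp: r0_def)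
      then have dr: "1 + C < \<delta> * r" using \<delta>(1) by (simp add: pos_divide_less_eq mult.commute)
      have "ennreal ((\<delta> * r) ^ CARD('n)) \<le> ennreal C"
        using \<delta>(2)[OF r(1), of c] emeasure_mono[OF sub, of lborel] P(2,3) by (auto intro: order_trans)
      then have "(\<delta> * r) ^ CARD('n) \<le> C" using pos by simp
      moreover have "(\<delta> * r) ^ 1 \<le> (\<delta> * r) ^ CARD('n)"
        using dr pos by (intro power_increasing) (auto simp: Suc_le_eq)
      ultimately show False using dr by simp
    qed
    then show "ennreal r \<le> ennreal r0" by (rule ennreal_leI)
  qed
  moreover have "outer_radius br \<sigma> nrm (P i) \<le> ennreal \<Lambda> * inner_radius br \<sigma> nrm (P i)"
  proof (cases "inner_radius br \<sigma> nrm (P i) = 0")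
    \<comment> \<open>In \<open>ennreal\<close> a nonzero numerator over zero is infinite, so the
      finite ratio forces the outer radius to vanish as well.\<close>
    case True
    then have "outer_radius br \<sigma> nrm (P i) = 0"
      using ratio by (metis ennreal_divide_zero ennreal_less_top ennreal_zero_divide leD neq_iff not_gr_zero ennreal_divide_self)
    then show ?thesis by simp
  next
    case False
    have fin: "inner_radius br \<sigma> nrm (P i) \<noteq> \<infinity>"
      using calculation by (auto simp: top_unique)
    have "outer_radius br \<sigma> nrm (P i) = outer_radius br \<sigma> nrm (P i) / inner_radius br \<sigma> nrm (P i) * inner_radius br \<sigma> nrm (P i)"
      using False fin by (simp add: ennreal_divide_times ennreal_divide_self less_top)
    also have "\<dots> \<le> ennreal \<Lambda> * inner_radius br \<sigma> nrm (P i)" by (rule mult_right_mono[OF ratio]) simp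
    finally show ?thesis .
  qed
  ultimately have "outer_radius br \<sigma> nrm (P i) \<le> ennreal \<Lambda> * ennreal r0"
    by (meson mult_left_mono order_trans zero_le)
  also have "\<dots> = ennreal (\<Lambda> * r0)" using pos by (simp add: ennreal_mult r0_def)
  also have "\<dots> < ennreal (\<Lambda> * r0 + 1)" using pos by (intro ennreal_lessI) (auto simp: r0_def add_nonneg_pos)
  finally have "outer_radius br \<sigma> nrm (P i) < ennreal (\<Lambda> * r0 + 1)" .
  then obtain R c where R: "ennreal R < ennreal (\<Lambda> * r0 + 1)" "P i \<subseteq> qball br \<sigma> nrm c R"
    unfolding outer_radius_def Inf_less_iff by auto
  have "R < \<Lambda> * r0 + 1" using R(1) by (metis ennreal_leI not_le)
  then have "qball br \<sigma> nrm c R \<subseteq> qball br \<sigma> nrm c (\<Lambda> * r0 + 1)" by (auto simp: qball_def)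
  then show ?thesis using R(2) by (auto simp: r0_def)
qed

text \<open>The measures of the members control their position when \<open>\<alpha> > 0\<close>; for \<open>\<alpha> = 0\<close> they only bound the measure,
  and the shape condition on the radii is needed.\<close>

lemma covering_comparable:
  assumes cov: "generalized_alpha_covering br v \<sigma> nrm \<alpha> I P" and \<alpha>: "0 \<le> \<alpha>"
  shows "\<exists>A\<ge>0. \<exists>m. \<forall>i\<in>I. \<forall>x\<in>P i. \<forall>x'\<in>P i. 1 + norm x' \<le> A * (1 + norm x) ^ m"
proof -
  define E where "E = \<alpha> * hom_dim v \<sigma> / 2"
  from cov obtain c C where cC: "0 < c" "0 < C" and vol: "\<And>i x. i \<in> I \<Longrightarrow> x \<in> P i \<Longrightarrow>
      ennreal (c * (1 + (nrm x)\<^sup>2) powr E) \<le> emeasure lborel (P i) \<and>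
      emeasure lborel (P i) \<le> ennreal (C * (1 + (nrm x)\<^sup>2) powr E)"
    unfolding generalized_alpha_covering_def E_def by blast
  obtain A1 where A1: "0 \<le> A1" "\<And>x. nrm x \<le> A1 * (1 + norm x)" using nrm_le by blast
  obtain A2 where A2: "0 \<le> A2" "\<And>x. norm x \<le> A2 * (1 + nrm x) ^ \<sigma>" using norm_le_nrm by blast
  show ?thesis
  proof (cases "\<alpha> = 0")
    case False
    then have E: "0 < E" using \<alpha> hom_dim_pos by (simp add: E_def)
    define B where "B = (C / c) powr (1 / E)"
    have B: "0 \<le> B" by (simp add: B_def)
    \<comment> \<open>The lower volume bound at \<open>x'\<close> and the upper one at
      \<open>x\<close> concern the same set; taking the root \<open>1 / E\<close> compares the two
      weights.\<close>
    have sq: "1 + (nrm x')\<^sup>2 \<le> B * (1 + (nrm x)\<^sup>2)" if i: "i \<in> I" "x \<in> P i" "x' \<in> P i" for i x x'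
    proof -
      have "ennreal (c * (1 + (nrm x')\<^sup>2) powr E) \<le> ennreal (C * (1 + (nrm x)\<^sup>2) powr E)"
        using vol[OF i(1,3)] vol[OF i(1,2)] order_trans by blast
      then have "c * (1 + (nrm x')\<^sup>2) powr E \<le> C * (1 + (nrm x)\<^sup>2) powr E" using cC by simp
      then have "(1 + (nrm x')\<^sup>2) powr E \<le> C / c * (1 + (nrm x)\<^sup>2) powr E"
        using cC by (simp add: field_simps)
      then have "((1 + (nrm x')\<^sup>2) powr E) powr (1 / E) \<le> (C / c * (1 + (nrm x)\<^sup>2) powr E) powr (1 / E)"
        using E by (intro powr_mono2) auto
      moreover have "(C / c * (1 + (nrm x)\<^sup>2) powr E) powr (1 / E) = B * (1 + (nrm x)\<^sup>2)"
        unfolding B_def using E cC by (subst powr_mult) (auto simp: powr_powr add_nonneg_eq_0_iff)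
      moreover have "((1 + (nrm x')\<^sup>2) powr E) powr (1 / E) = 1 + (nrm x')\<^sup>2"
        using E by (simp add: powr_powr add_nonneg_eq_0_iff)
      ultimately show ?thesis by simp
    qed
    define G where "G = 1 + B * (1 + A1)\<^sup>2"
    have G: "1 \<le> G" using B by (simp add: G_def)
    have "1 + norm x' \<le> (1 + A2) * (1 + G) ^ \<sigma> * (1 + norm x) ^ (2 * \<sigma>)" if i: "i \<in> I" "x \<in> P i" "x' \<in> P i" for i x x'
    proof -
      define Y where "Y = 1 + norm x"
      have Y: "1 \<le> Y" by (simp add: Y_def)
      have "1 + (nrm x)\<^sup>2 \<le> (1 + A1)\<^sup>2 * Y\<^sup>2"
      proof -
        have "1 + (nrm x)\<^sup>2 \<le> (1 + nrm x)\<^sup>2" using nrm_nonneg[of x] by (simp add: power2_eq_square algebra_simps)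
        also have "\<dots> \<le> ((1 + A1) * Y)\<^sup>2"
        proof (intro power_mono)
          show "1 + nrm x \<le> (1 + A1) * Y"
            using A1(2)[of x] norm_ge_zero[of x] unfolding Y_def distrib_right[of 1 A1] mult_1_left by linarith
        qed (use nrm_nonneg[of x] in simp)
        finally show ?thesis by (simp add: power_mult_distrib)
      qed
      then have "B * (1 + (nrm x)\<^sup>2) \<le> B * ((1 + A1)\<^sup>2 * Y\<^sup>2)" using B by (rule mult_left_mono)
      with sq[OF i] have "1 + (nrm x')\<^sup>2 \<le> B * (1 + A1)\<^sup>2 * Y\<^sup>2" by (simp add: mult.assoc)
      moreover have "nrm x' \<le> 1 + (nrm x')\<^sup>2"
        using sum_power2_ge_zero[of "nrm x' - 1" 0] nrm_nonneg[of x'] by (simp add: power2_eq_square algebra_simps)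
      ultimately have "1 + nrm x' \<le> 1 + B * (1 + A1)\<^sup>2 * Y\<^sup>2" by linarith
      also have "\<dots> \<le> Y\<^sup>2 + G * Y\<^sup>2"
        using one_le_power[OF Y, of 2] unfolding G_def distrib_right mult_1_left by linarith
      also have "\<dots> = (1 + G) * Y\<^sup>2" by (simp add: algebra_simps)
      finally have le: "(1 + nrm x') ^ \<sigma> \<le> ((1 + G) * Y\<^sup>2) ^ \<sigma>"
        using nrm_nonneg[of x'] by (intro power_mono) auto
      have one: "1 \<le> (1 + nrm x') ^ \<sigma>" using nrm_nonneg[of x'] by (intro one_le_power) auto
      have "1 + norm x' \<le> (1 + nrm x') ^ \<sigma> + A2 * (1 + nrm x') ^ \<sigma>" using A2(2)[of x'] one by linarith
      also have "\<dots> = (1 + A2) * (1 + nrm x') ^ \<sigma>" by (simp add: algebra_simps)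
      also have "\<dots> \<le> (1 + A2) * ((1 + G) * Y\<^sup>2) ^ \<sigma>" using A2(1) le by (intro mult_left_mono) auto
      also have "\<dots> = (1 + A2) * (1 + G) ^ \<sigma> * Y ^ (2 * \<sigma>)" by (simp add: power_mult_distrib power_mult[symmetric])
      finally show ?thesis by (simp add: Y_def)
    qed
    then show ?thesis using A2 G by (intro exI[of _ "(1 + A2) * (1 + G) ^ \<sigma>"] conjI exI[of _ "2 * \<sigma>"]) auto
  next
    case True
    have adm: "admissible_covering I P" and opn: "\<And>i. i \<in> I \<Longrightarrow> open (P i)"
      and ratio: "(SUP i\<in>I. outer_radius br \<sigma> nrm (P i) / inner_radius br \<sigma> nrm (P i)) < \<infinity>"
      using cov by (auto simp: generalized_alpha_covering_def)
    define \<Lambda> where "\<Lambda> = enn2real (SUP i\<in>I. outer_radius br \<sigma> nrm (P i) / inner_radius br \<sigma> nrm (P i))"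
    have \<Lambda>: "outer_radius br \<sigma> nrm (P i) / inner_radius br \<sigma> nrm (P i) \<le> ennreal \<Lambda>" if "i \<in> I" for i
      using ratio SUP_upper[OF that, of "\<lambda>i. outer_radius br \<sigma> nrm (P i) / inner_radius br \<sigma> nrm (P i)"]
      by (simp add: \<Lambda>_def less_top)
    obtain \<delta> where \<delta>: "0 < \<delta>" "\<And>r c. 1 \<le> r \<Longrightarrow> ennreal ((\<delta> * r) ^ CARD('n)) \<le> emeasure lborel (qball br \<sigma> nrm c r)"
      using qball_large by blast
    define R where "R = \<Lambda> * max 1 ((1 + C) / \<delta>) + 1"
    have R: "0 \<le> R" by (auto simp: R_def \<Lambda>_def intro!: add_nonneg_nonneg mult_nonneg_nonneg)
    have ball: "\<exists>c. P i \<subseteq> qball br \<sigma> nrm c R" if i: "i \<in> I" for i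
    proof -
      have ne: "P i \<noteq> {}" using adm i by (auto simp: admissible_covering_def)
      then obtain x where "x \<in> P i" by blast
      \<comment> \<open>For \<alpha> = 0 the exponent \<open>E\<close> is 0 and the volume condition
        reads \<open>\<le> C\<close>.\<close>
      then have "emeasure lborel (P i) \<le> ennreal C"
        using vol[OF i] True by (simp add: E_def add_nonneg_eq_0_iff)
      then show ?thesis
        unfolding R_def using ne opn[OF i] \<Lambda>[OF i] \<delta> cC
        by (intro bounded_outer_radius) (auto simp: \<Lambda>_def)
    qed
    define R' where "R' = A2 * (1 + R) ^ \<sigma>"
    have R': "0 \<le> R'" using A2 R by (simp add: R'_def)
    obtain A m where A: "0 \<le> A" "\<And>c x x'. norm (gmult br \<sigma> (- c) x) \<le> R' \<Longrightarrow> norm (gmult br \<sigma> (- c) x') \<le> R' \<Longrightarrow>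
      1 + norm x' \<le> A * (1 + norm x) ^ m"
      using common_translate[OF R'] by blast
    have "1 + norm x' \<le> A * (1 + norm x) ^ m" if i: "i \<in> I" "x \<in> P i" "x' \<in> P i" for i x x'
    proof -
      obtain c where c: "P i \<subseteq> qball br \<sigma> nrm c R" using ball[OF i(1)] by blast
      have "norm (gmult br \<sigma> (- c) y) \<le> R'" if "y \<in> P i" for y
      proof -
        have "nrm (gmult br \<sigma> (- c) y) < R" using c that by (auto simp: qball_def)
        then have "(1 + nrm (gmult br \<sigma> (- c) y)) ^ \<sigma> \<le> (1 + R) ^ \<sigma>"
          using nrm_nonneg by (intro power_mono) auto
        then have "A2 * (1 + nrm (gmult br \<sigma> (- c) y)) ^ \<sigma> \<le> R'"
          unfolding R'_def using A2(1) by (rule mult_left_mono)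
        then show ?thesis using A2(2) order_trans by blast
      qed
      with i show ?thesis by (intro A(2)) auto
    qed
    then show ?thesis using A(1) by blast
  qed
qed

end

section \<open>Summation over an admissible covering\<close>

text \<open>Each \<open>t i\<close> times the measure of \<open>P i\<close> is at most the integral
  of \<open>h\<close> over \<open>P i\<close>. Bounded overlap sums these to at most
  \<open>m\<close> times the integral of \<open>h\<close>, and \<open>c\<close> removes the
  measures. The conclusion has the two bounds that \<open>Lp_norm_le\<close> asks for.\<close>

lemma admissible_sum_bound:
  fixes P :: "'i \<Rightarrow> (real^'n::finite) set"
  assumes adm: "admissible_covering I P" and opn: "\<And>i. i \<in> I \<Longrightarrow> open (P i)"
    and c: "0 < c" "\<And>i. i \<in> I \<Longrightarrow> ennreal c \<le> emeasure lborel (P i)"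
    and h: "integrable lborel h" "\<And>x. 0 \<le> h x"
    and t: "\<And>i. i \<in> I \<Longrightarrow> 0 \<le> t i" "\<And>i x. i \<in> I \<Longrightarrow> x \<in> P i \<Longrightarrow> t i \<le> h x"
  shows "\<exists>K\<ge>0. (\<forall>i\<in>I. t i \<le> K) \<and> (\<integral>\<^sup>+i. ennreal (t i) \<partial>count_space I) \<le> ennreal K"
proof -
  obtain m :: nat where m: "\<And>i. i \<in> I \<Longrightarrow> finite {j\<in>I. P i \<inter> P j \<noteq> {}}"
    "\<And>i. i \<in> I \<Longrightarrow> card {j\<in>I. P i \<inter> P j \<noteq> {}} \<le> m"
    using adm unfolding admissible_covering_def by blast
  define H where "H = (LINT x|lborel. h x)"
  have H: "(\<integral>\<^sup>+x. ennreal (h x) \<partial>lborel) = ennreal H"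
    unfolding H_def using h by (simp add: nn_integral_eq_integral)
  have H0: "0 \<le> H" unfolding H_def using h(2) by (simp add: integral_nonneg_AE)
  have [measurable]: "h \<in> borel_measurable borel" using h(1) by auto
  \<comment> \<open>All members containing \<open>x\<close> meet any one of them, so admissibility
    bounds their number.\<close>
  have overlap: "(\<Sum>i\<in>F. indicator (P i) x) \<le> (of_nat m :: ennreal)" if F: "finite F" "F \<subseteq> I" for F x
  proof -
    let ?G = "{i\<in>F. x \<in> P i}"
    have "card ?G \<le> m"
    proof (cases "?G = {}")
      case False
      then obtain i where i: "i \<in> F" "x \<in> P i" by blast
      then have "?G \<subseteq> {j\<in>I. P i \<inter> P j \<noteq> {}}" using F by auto
      then show ?thesis using m i F card_mono order_trans by (metis (no_types, lifting) subsetD)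
    next
      case True
      show ?thesis unfolding True by simp
    qed
    moreover have "(\<Sum>i\<in>F. indicator (P i) x) = (of_nat (card ?G) :: ennreal)"
      using F by (simp add: indicator_def sum.If_cases Int_def of_bool_def)
    ultimately show ?thesis by simp
  qed
  have fin: "(\<Sum>i\<in>F. t i) \<le> m * H / c" if F: "finite F" "F \<subseteq> I" for F
  proof -
    have "ennreal (t i) * ennreal c \<le> (\<integral>\<^sup>+x. ennreal (h x) * indicator (P i) x \<partial>lborel)" if i: "i \<in> I" for i
    proof -
      have [measurable]: "P i \<in> sets borel" using opn[OF i] by simp
      have "ennreal (t i) * ennreal c \<le> ennreal (t i) * emeasure lborel (P i)"
        by (intro mult_left_mono c i) simp
      also have "\<dots> = (\<integral>\<^sup>+x. ennreal (t i) * indicator (P i) x \<partial>lborel)" by (simp add: nn_integral_cmult_indicator)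
      also have "\<dots> \<le> (\<integral>\<^sup>+x. ennreal (h x) * indicator (P i) x \<partial>lborel)"
        using t(2)[OF i] by (intro nn_integral_mono) (auto split: split_indicator intro: ennreal_leI)
      finally show ?thesis .
    qed
    then have "(\<Sum>i\<in>F. ennreal (t i) * ennreal c) \<le> (\<Sum>i\<in>F. \<integral>\<^sup>+x. ennreal (h x) * indicator (P i) x \<partial>lborel)"
      using F by (intro sum_mono) auto
    also have "\<dots> = (\<integral>\<^sup>+x. (\<Sum>i\<in>F. ennreal (h x) * indicator (P i) x) \<partial>lborel)"
      using F opn by (intro nn_integral_sum[symmetric]) auto
    also have "\<dots> \<le> (\<integral>\<^sup>+x. ennreal (h x) * of_nat m \<partial>lborel)"
      unfolding sum_distrib_left[symmetric] by (intro nn_integral_mono mult_left_mono overlap F) simp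
    also have "\<dots> = ennreal H * of_nat m" by (simp add: nn_integral_multc H)
    also have "\<dots> = ennreal (H * m)" using H0 by (simp add: ennreal_mult ennreal_of_nat_eq_real_of_nat)
    finally have "(\<Sum>i\<in>F. ennreal (t i)) * ennreal c \<le> ennreal (H * m)" by (simp add: sum_distrib_right)
    moreover have "(\<Sum>i\<in>F. ennreal (t i)) = ennreal (\<Sum>i\<in>F. t i)" using F t(1) by (intro sum_ennreal) auto
    moreover have "0 \<le> (\<Sum>i\<in>F. t i)" using F t(1) by (intro sum_nonneg) auto
    ultimately have "(\<Sum>i\<in>F. t i) * c \<le> H * m" using c(1) H0 by (simp add: ennreal_mult[symmetric])
    then show ?thesis using c(1) by (simp add: pos_le_divide_eq mult.commute)
  qed
  \<comment> \<open>The bound is uniform over finite index sets, so it passes to \<open>I\<close>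
    whatever its cardinality.\<close>
  have "t summable_on I"
    using t(1) fin by (intro nonneg_bdd_above_summable_on bdd_aboveI[of _ "m * H / c"]) auto
  then have "integrable (count_space I) t"
    using summable_on_iff_abs_summable_on_real[of t I] abs_summable_equivalent[of t I] by (simp add: abs_summable_on_def)
  then have "(\<integral>\<^sup>+i. ennreal (norm (t i)) \<partial>count_space I) < \<infinity>" by (simp add: integrable_iff_bounded)
  also have "(\<integral>\<^sup>+i. ennreal (norm (t i)) \<partial>count_space I) = (\<integral>\<^sup>+i. ennreal (t i) \<partial>count_space I)"
    using t(1) by (intro nn_integral_cong) auto
  finally obtain K where K: "0 \<le> K" "(\<integral>\<^sup>+i. ennreal (t i) \<partial>count_space I) = ennreal K"
    by (cases "\<integral>\<^sup>+i. ennreal (t i) \<partial>count_space I") auto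
  have "t i \<le> max K (m * H / c)" if "i \<in> I" for i using fin[of "{i}"] that by auto
  then show ?thesis using K by (intro exI[of _ "max K (m * H / c)"]) (auto intro: ennreal_leI)
qed

section \<open>Schwartz functions in \<open>M\<close>\<close>

lemma BAPU_le_1:
  assumes "BAPU I P \<psi>" "i \<in> I" shows "\<psi> i x \<le> 1"
proof -
  have "((\<lambda>i. \<psi> i x) has_sum 1) I" and nn: "\<And>j. j \<in> I \<Longrightarrow> 0 \<le> \<psi> j x" using assms by (auto simp: BAPU_def)
  moreover have "((\<lambda>i. \<psi> i x) has_sum (\<Sum>i\<in>{i}. \<psi> i x)) {i}" by (rule has_sum_finite) simp
  ultimately have "(\<Sum>i\<in>{i}. \<psi> i x) \<le> 1"
    using assms(2) by (elim has_sum_mono_neutral[rotated]) auto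
  then show ?thesis by simp
qed

text \<open>An integral power is wanted so that the weight can be cancelled against the powers of
  \<open>1 + d i\<close>.\<close>

lemma weight_le:
  fixes a s :: real
  assumes "0 \<le> a" shows "(1 + a\<^sup>2) powr (s / 2) \<le> (1 + a) ^ nat \<lceil>\<bar>s\<bar>\<rceil>"
proof -
  have "(1 + a\<^sup>2) powr (s / 2) \<le> (1 + a\<^sup>2) powr (\<bar>s\<bar> / 2)"
    by (intro powr_mono) auto
  also have "\<dots> \<le> ((1 + a)\<^sup>2) powr (\<bar>s\<bar> / 2)"
    using assms by (intro powr_mono2) (auto simp: power2_eq_square algebra_simps)
  also have "\<dots> = (1 + a) powr \<bar>s\<bar>"
    using assms by (simp add: powr_powr flip: powr_numeral)
  also have "\<dots> \<le> (1 + a) powr real (nat \<lceil>\<bar>s\<bar>\<rceil>)"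
    using assms by (intro powr_mono) (auto simp: real_nat_ceiling_ge)
  also have "\<dots> = (1 + a) ^ nat \<lceil>\<bar>s\<bar>\<rceil>" using assms by (intro powr_realpow) auto
  finally show ?thesis .
qed

theorem proposition4p6:
  fixes br :: "real^'n::finite \<Rightarrow> real^'n \<Rightarrow> real^'n"
    and v :: "'n \<Rightarrow> nat" and \<sigma> :: nat
    and nrm :: "real^'n \<Rightarrow> real"
    and I :: "'i set" and P :: "'i \<Rightarrow> (real^'n) set"
    and \<psi> :: "'i \<Rightarrow> real^'n \<Rightarrow> real" and \<xi> :: "'i \<Rightarrow> real^'n"
    and p q :: ennreal and s \<alpha> :: real
  assumes "stratified br v \<sigma>"
    and "rational_group br \<sigma>"
    and "homogeneous_quasi_norm v nrm"
    and "1 \<le> p" and "1 \<le> q" and "0 \<le> \<alpha>" and "\<alpha> \<le> 1"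
    and "generalized_alpha_covering br v \<sigma> nrm \<alpha> I P"
    and "BAPU I P \<psi>"
    and "\<forall>i\<in>I. \<xi> i \<in> P i"
  shows "functional_of ` schwartz \<subseteq> alpha_modulation_space nrm I \<psi> \<xi> p q s"
proof
  fix T :: "(real^'n \<Rightarrow> complex) \<Rightarrow> complex" assume "T \<in> functional_of ` schwartz"
  then obtain f where f: "f \<in> schwartz" and T: "T = functional_of f" by blast
  interpret quasi_normed_algebra br v \<sigma> nrm
    using assms(1,3) by unfold_locales
  note cov = assms(8) and bapu = assms(9)
  have adm: "admissible_covering I P" and opn: "\<And>i. i \<in> I \<Longrightarrow> open (P i)"
    using cov by (auto simp: generalized_alpha_covering_def)
  have ne: "P i \<noteq> {}" if "i \<in> I" for i using adm that by (auto simp: admissible_covering_def)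
  have \<xi>: "\<xi> i \<in> P i" if "i \<in> I" for i using assms(10) that by blast
  obtain c C0 where c: "0 < c" and vol: "\<And>i x. i \<in> I \<Longrightarrow> x \<in> P i \<Longrightarrow>
      ennreal (c * (1 + (nrm x)\<^sup>2) powr (\<alpha> * hom_dim v \<sigma> / 2)) \<le> emeasure lborel (P i) \<and>
      emeasure lborel (P i) \<le> ennreal (C0 * (1 + (nrm x)\<^sup>2) powr (\<alpha> * hom_dim v \<sigma> / 2))"
    using cov unfolding generalized_alpha_covering_def by blast
  have vol_ge: "ennreal c \<le> emeasure lborel (P i)" if i: "i \<in> I" for i
  proof -
    have "1 \<le> (1 + (nrm (\<xi> i))\<^sup>2) powr (\<alpha> * hom_dim v \<sigma> / 2)"
      using assms(6) by (intro ge_one_powr_ge_zero) auto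
    then have "ennreal c \<le> ennreal (c * (1 + (nrm (\<xi> i))\<^sup>2) powr (\<alpha> * hom_dim v \<sigma> / 2))"
      using c by (intro ennreal_leI) simp
    also have "\<dots> \<le> emeasure lborel (P i)" using vol[OF i \<xi>[OF i]] by blast
    finally show ?thesis .
  qed
  have vol_fin: "emeasure lborel (P i) < \<infinity>" if i: "i \<in> I" for i
    using vol[OF i \<xi>[OF i]] by (auto intro: order.strict_trans1)
  have \<psi>: "smooth (\<psi> i)" "\<And>x. 0 \<le> \<psi> i x" "supp (\<psi> i) \<subseteq> P i" if "i \<in> I" for i
    using bapu that by (auto simp: BAPU_def)
  have \<psi>1: "\<psi> i x \<le> 1" if "i \<in> I" for i x using BAPU_le_1[OF bapu that] .
  have \<psi>_supp: "x \<in> P i" if "i \<in> I" "\<psi> i x \<noteq> 0" for i x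
    using in_supp[of "\<psi> i" x] \<psi>(3)[OF that(1)] that(2) by blast
  have \<psi>_int: "integrable lborel (\<psi> i)" if i: "i \<in> I" for i
  proof (rule Bochner_Integration.integrable_bound)
    show "integrable lborel (indicator (P i) :: real^'n \<Rightarrow> real)"
      using opn[OF i] vol_fin[OF i] by (simp add: integrable_indicator_iff)
    show "\<psi> i \<in> borel_measurable lborel"
      using smooth_continuous0[OF \<psi>(1)[OF i]] by (simp add: borel_measurable_continuous_onI)
    show "AE x in lborel. norm (\<psi> i x) \<le> norm (indicator (P i) x :: real)"
    proof (rule AE_I2)
      fix x
      show "norm (\<psi> i x) \<le> norm (indicator (P i) x :: real)"
        using \<psi>(2)[OF i, of x] \<psi>1[OF i, of x] \<psi>_supp[OF i, of x] by (cases "\<psi> i x = 0") auto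
    qed
  qed
  let ?K = "\<lambda>i. inv_fourier (\<lambda>\<omega>. complex_of_real (\<psi> i \<omega>))"
  define B where "B = enn2real (SUP i\<in>I. Lp_norm lborel 1 (\<lambda>x. ennreal (norm (?K i x))))"
  have B: "0 \<le> B" by (simp add: B_def)
  have KB: "integrable lborel (?K i) \<and> (LINT x|lborel. norm (?K i x)) \<le> B" if i: "i \<in> I" for i
  proof -
    have "(SUP i\<in>I. Lp_norm lborel 1 (\<lambda>x. ennreal (norm (?K i x)))) < \<infinity>" using bapu by (simp add: BAPU_def)
    then have le: "(\<integral>\<^sup>+x. ennreal (norm (?K i x)) \<partial>lborel) \<le> ennreal B"
      using SUP_upper[OF i, of "\<lambda>i. Lp_norm lborel 1 (\<lambda>x. ennreal (norm (?K i x)))"]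
      by (simp add: B_def less_top Lp_norm_1)
    have [measurable]: "\<psi> i \<in> borel_measurable borel" using \<psi>_int[OF i] by auto
    have int: "integrable lborel (?K i)"
      using le by (intro integrableI_bounded) (auto intro: order.strict_trans1)
    then have "ennreal (LINT x|lborel. norm (?K i x)) \<le> ennreal B"
      using le by (simp add: nn_integral_eq_integral)
    then show ?thesis using int B by simp
  qed
  obtain A m where A: "0 \<le> A" "\<And>i x x'. i \<in> I \<Longrightarrow> x \<in> P i \<Longrightarrow> x' \<in> P i \<Longrightarrow> 1 + norm x' \<le> A * (1 + norm x) ^ m"
    using covering_comparable[OF cov assms(6)] by blast
  obtain A1 where A1: "0 \<le> A1" "\<And>x. nrm x \<le> A1 * (1 + norm x)" using nrm_le by blast
  define d where "d i = Inf (norm ` P i)" for i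
  have d_le: "d i \<le> norm x" if "x \<in> P i" for i x
    unfolding d_def using that by (intro cInf_lower bdd_belowI[of _ 0]) auto
  have d0: "0 \<le> d i" if "i \<in> I" for i
    unfolding d_def using ne[OF that] by (intro cInf_greatest) auto
  \<comment> \<open>The infimum \<open>d i\<close> is approached by some \<open>x'\<close> with
    \<open>norm x' < d i + 1\<close>, so \<open>1 + norm x'\<close> is at most
    \<open>2 * (1 + d i)\<close>; hence \<open>2 ^ m\<close>.\<close>
  define A' where "A' = A * 2 ^ m"
  have A': "0 \<le> A'" using A by (simp add: A'_def)
  have le_d: "1 + norm x \<le> A' * (1 + d i) ^ m" if i: "i \<in> I" "x \<in> P i" for i x
  proof -
    have "Inf (norm ` P i) < d i + 1" by (simp add: d_def)
    then obtain x' where x': "x' \<in> P i" "norm x' < d i + 1"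
      using cInf_lessD[of "norm ` P i"] ne[OF i(1)] by blast
    have "1 + norm x \<le> A * (1 + norm x') ^ m" using A(2)[OF i(1) x'(1) i(2)] .
    also have "\<dots> \<le> A * (2 * (1 + d i)) ^ m"
      using x'(2) d0[OF i(1)] A(1) by (intro mult_left_mono power_mono) auto
    also have "\<dots> = A' * (1 + d i) ^ m" unfolding A'_def power_mult_distrib by (rule mult.assoc[symmetric])
    finally show ?thesis .
  qed
  define M where "M = nat \<lceil>\<bar>s\<bar>\<rceil>"
  define n where "n = 2 * CARD('n)"
  \<comment> \<open>On \<open>P i\<close> the quantity \<open>1 + norm x\<close> may be as large as
    \<open>(1 + d i) ^ m\<close> up to a constant. So \<open>m * M\<close> powers are spent on the
    weight, and \<open>m * n\<close> remain to dominate \<open>t i\<close> by the integrable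
    \<open>1 / (1 + norm x) ^ n\<close>.\<close>
  obtain C where C: "0 \<le> C" and dec: "\<And>\<psi> d. integrable lborel \<psi> \<Longrightarrow> (\<forall>x. 0 \<le> \<psi> x \<and> \<psi> x \<le> 1) \<Longrightarrow>
     integrable lborel (inv_fourier (\<lambda>\<omega>. complex_of_real (\<psi> \<omega>))) \<Longrightarrow>
     (LINT x|lborel. norm (inv_fourier (\<lambda>\<omega>. complex_of_real (\<psi> \<omega>)) x)) \<le> B \<Longrightarrow>
     0 \<le> d \<Longrightarrow> (\<forall>\<omega>. \<psi> \<omega> \<noteq> 0 \<longrightarrow> d \<le> norm \<omega>) \<Longrightarrow>
     integrable lborel (inv_fourier (\<lambda>\<omega>. complex_of_real (\<psi> \<omega>) * fourier f \<omega>)) \<and>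
     (LINT x|lborel. norm (inv_fourier (\<lambda>\<omega>. complex_of_real (\<psi> \<omega>) * fourier f \<omega>) x)) \<le> C / (1 + d) ^ (m * M + m * n) \<and>
     (\<forall>x. norm (inv_fourier (\<lambda>\<omega>. complex_of_real (\<psi> \<omega>) * fourier f \<omega>) x) \<le> C / (1 + d) ^ (m * M + m * n))"
    using localized_piece_decay[OF f B, of "m * M + m * n"] by blast
  define L where "L i = Lp_norm_functional p (inv_fourier_functional (mult_functional (\<psi> i) (fourier_functional T)))" for i
  have L: "L i \<le> ennreal (C / (1 + d i) ^ (m * M + m * n))" if i: "i \<in> I" for i
  proof -
    have "\<forall>\<omega>. \<psi> i \<omega> \<noteq> 0 \<longrightarrow> d i \<le> norm \<omega>" using \<psi>_supp[OF i] d_le by blast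
    with dec[OF \<psi>_int[OF i] _ _ _ d0[OF i]] KB[OF i] \<psi>(2)[OF i] \<psi>1[OF i]
    have "integrable lborel (inv_fourier (\<lambda>\<omega>. complex_of_real (\<psi> i \<omega>) * fourier f \<omega>))"
      "(LINT x|lborel. norm (inv_fourier (\<lambda>\<omega>. complex_of_real (\<psi> i \<omega>) * fourier f \<omega>) x)) \<le> C / (1 + d i) ^ (m * M + m * n)"
      "\<And>x. norm (inv_fourier (\<lambda>\<omega>. complex_of_real (\<psi> i \<omega>) * fourier f \<omega>) x) \<le> C / (1 + d i) ^ (m * M + m * n)"
      by blast+
    then show ?thesis
      unfolding L_def T by (intro Lp_norm_functional_piece[OF f \<psi>(1)[OF i] \<psi>_int[OF i] \<psi>(2)[OF i] \<psi>1[OF i] assms(4) refl])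
  qed
  define G where "G = ((1 + A1) * A') ^ M * C"
  have G: "0 \<le> G" using A1 A' C by (simp add: G_def)
  define t where "t i = G / (1 + d i) ^ (m * n)" for i
  have wL: "ennreal ((1 + (nrm (\<xi> i))\<^sup>2) powr (s / 2)) * L i \<le> ennreal (t i)" if i: "i \<in> I" for i
  proof -
    have dpos: "0 < 1 + d i" using d0[OF i] by simp
    have "1 + nrm (\<xi> i) \<le> (1 + A1) * (1 + norm (\<xi> i))" 
      using A1(2)[of "\<xi> i"] norm_ge_zero[of "\<xi> i"] unfolding distrib_right[of 1 A1] mult_1_left by linarith
    also have "\<dots> \<le> (1 + A1) * (A' * (1 + d i) ^ m)"
      using A1(1) by (intro mult_left_mono le_d i \<xi>) auto
    finally have "(1 + nrm (\<xi> i)) ^ M \<le> ((1 + A1) * (A' * (1 + d i) ^ m)) ^ M"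
      using nrm_nonneg[of "\<xi> i"] by (intro power_mono) auto
    also have "\<dots> = ((1 + A1) * A') ^ M * (1 + d i) ^ (m * M)"
      by (simp add: power_mult_distrib power_mult mult.assoc)
    finally have w: "(1 + (nrm (\<xi> i))\<^sup>2) powr (s / 2) \<le> ((1 + A1) * A') ^ M * (1 + d i) ^ (m * M)"
      using weight_le[OF nrm_nonneg[of "\<xi> i"], of s] by (simp add: M_def)
    have "ennreal ((1 + (nrm (\<xi> i))\<^sup>2) powr (s / 2)) * L i \<le>
        ennreal (((1 + A1) * A') ^ M * (1 + d i) ^ (m * M)) * ennreal (C / (1 + d i) ^ (m * M + m * n))"
      by (intro mult_mono ennreal_leI w L i) auto
    also have "\<dots> = ennreal (((1 + A1) * A') ^ M * (1 + d i) ^ (m * M) * (C / (1 + d i) ^ (m * M + m * n)))"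
      using A1 A' C dpos by (intro ennreal_mult[symmetric]) auto
    also have "((1 + A1) * A') ^ M * (1 + d i) ^ (m * M) * (C / (1 + d i) ^ (m * M + m * n)) = t i"
      using dpos by (simp add: t_def G_def power_add)
    finally show ?thesis .
  qed
  have t0: "0 \<le> t i" if "i \<in> I" for i using G d0[OF that] by (simp add: t_def)
  have t_le: "t i \<le> G * A' ^ n * (1 / (1 + norm x) ^ n)" if i: "i \<in> I" "x \<in> P i" for i x
  proof -
    have "(1 + norm x) ^ n \<le> (A' * (1 + d i) ^ m) ^ n" using le_d[OF i] by (intro power_mono) auto
    then have "G * (1 + norm x) ^ n \<le> G * (A' ^ n * (1 + d i) ^ (m * n))"
      using G by (intro mult_left_mono) (simp_all add: power_mult_distrib power_mult)
    then show ?thesis using d0[OF i(1)] by (simp add: t_def divide_simps mult_ac)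
  qed
  obtain K where K: "0 \<le> K" "\<And>i. i \<in> I \<Longrightarrow> t i \<le> K" "(\<integral>\<^sup>+i. ennreal (t i) \<partial>count_space I) \<le> ennreal K"
  proof -
    have "integrable lborel (\<lambda>x::real^'n. G * A' ^ n * (1 / (1 + norm x) ^ n))"
      by (intro integrable_mult_right integrable_weight) (simp add: n_def)
    then have "\<exists>K\<ge>0. (\<forall>i\<in>I. t i \<le> K) \<and> (\<integral>\<^sup>+i. ennreal (t i) \<partial>count_space I) \<le> ennreal K"
      using G A' by (intro admissible_sum_bound[OF adm opn c vol_ge _ _ t0 t_le]) auto
    then show thesis using that by blast
  qed
  have "Lp_norm (count_space I) q (\<lambda>i. ennreal ((1 + (nrm (\<xi> i))\<^sup>2) powr (s / 2)) * L i) \<le> ennreal K"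
  proof (rule Lp_norm_le[OF _ assms(5)])
    show "(\<integral>\<^sup>+i. ennreal ((1 + (nrm (\<xi> i))\<^sup>2) powr (s / 2)) * L i \<partial>count_space I) \<le> ennreal K"
      by (rule order_trans[OF nn_integral_mono K(3)]) (simp add: wL)
    show "ennreal ((1 + (nrm (\<xi> i))\<^sup>2) powr (s / 2)) * L i \<le> ennreal K" if "i \<in> space (count_space I)" for i
      using wL[of i] K(2)[of i] that by (auto intro: order_trans ennreal_leI)
  qed (use K in auto)
  then have "Lp_norm (count_space I) q (\<lambda>i. ennreal ((1 + (nrm (\<xi> i))\<^sup>2) powr (s / 2)) * L i) < \<infinity>"
    by (auto intro: order.strict_trans1)
  then show "T \<in> alpha_modulation_space nrm I \<psi> \<xi> p q s"
    unfolding alpha_modulation_space_def L_def using functional_of_schwartz_in_Z_dual[OF f] by (simp add: T)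
qed

end
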